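(* Let $\rho>0$ and let $a,b:[0,\infty)\to[0,\infty)$ and $\mathfrak n$ satisfy: (i) $a,b\in\mathcal C^0([0,\infty))\cap\mathcal C^1(0,\infty)$; (ii) $a'$ and $b'$ are bounded on $(1,\infty)$; (iii) $a(x)>0$ for all $x>0$ and $1/a\in L^1(0,1)$; (iv) $\Phi:=b/a$ on $(0,\infty)$ has a limit $\Phi_0$ at $0^+$, $\Phi_0<\rho$, and $\Phi'\in L^1(0,1)$; (v) $\mathfrak n$ is nonnegative and locally Lipschitz on $[\Phi_0,\infty)$; (vi) there exists $x^*>0$ such that $\Phi$ is monotone on $(0,x^* )$. Let $f^{\rm in}\geq0$ with $f^{\rm in}\in L^1((0,\infty),(1+x)\,dx)$ and $\rho-\int_0^\infty xf^{\rm in}(x)\,dx>\Phi_0$. Then for all $T>0$ there exists at most one solution to the Lifshitz--Slyozov equation on $[0,T)$ with mass $\rho$, kinetic rates $\{a,b,\mathfrak n\}$ and initial value $f^{\rm in}$.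
   Context: For $T\in(0,\infty]$, a function $f$ is a solution to the Lifshitz--Slyozov equation on $[0,T)$ with mass $\rho$, kinetic rates $\{a,b,\mathfrak n\}$ and initial value $f^{\rm in}$ if: (1) $f\in\mathcal C([0,T),w-L^1((0,\infty),x\,dx))$ (continuity into $L^1$ endowed with its weak topology), $f\ge0$, and for each $T^*<T$, $f\in L^\infty((0,T^* ),L^1((0,\infty),dx))$; (2) for all $t\in[0,T)$, $u(t):=\rho-\int_0^\infty xf(t,x)\,dx>\Phi_0$; (3) for all $\varphi\in\mathcal C^1_c([0,T)\times[0,\infty))$, $\int_0^T\int_0^\infty(\partial_t\varphi+(a(x)u(t)-b(x))\partial_x\varphi)f\,dx\,dt+\int_0^T\varphi(t,0)\mathfrak n(u(t))\,dt+\int_0^\infty\varphi(0,x)f^{\rm in}(x)\,dx=0$. *)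

theory Defs
  imports "HOL-Analysis.Analysis"
begin

definition LS_dom :: "real \<Rightarrow> (real \<times> real) set" where
  "LS_dom T = {0..<T} \<times> {0..}"

definition C1c_test :: "real \<Rightarrow> (real \<Rightarrow> real \<Rightarrow> real) \<Rightarrow> (real \<Rightarrow> real \<Rightarrow> real)
    \<Rightarrow> (real \<Rightarrow> real \<Rightarrow> real) \<Rightarrow> bool" where
  "C1c_test T phi phit phix \<longleftrightarrow>
     continuous_on (LS_dom T) (\<lambda>p. phit (fst p) (snd p)) \<and>
     continuous_on (LS_dom T) (\<lambda>p. phix (fst p) (snd p)) \<and>
     (\<forall>p\<in>LS_dom T. ((\<lambda>q. phi (fst q) (snd q)) has_derivative
         (\<lambda>h. phit (fst p) (snd p) * fst h + phix (fst p) (snd p) * snd h)) (at p within LS_dom T)) \<and>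
     (\<exists>T' R. T' < T \<and> (\<forall>t x. (t, x) \<in> LS_dom T \<and> (T' \<le> t \<or> R \<le> x) \<longrightarrow> phi t x = 0))"

definition LS_u :: "real \<Rightarrow> (real \<Rightarrow> real \<Rightarrow> real) \<Rightarrow> real \<Rightarrow> real" where
  "LS_u rho f t = rho - set_lebesgue_integral lborel {0<..} (\<lambda>x. x * f t x)"

definition LS_solution :: "real \<Rightarrow> real \<Rightarrow> (real \<Rightarrow> real) \<Rightarrow> (real \<Rightarrow> real) \<Rightarrow> (real \<Rightarrow> real)
    \<Rightarrow> (real \<Rightarrow> real) \<Rightarrow> real \<Rightarrow> (real \<Rightarrow> real \<Rightarrow> real) \<Rightarrow> bool" where
  "LS_solution rho Phi0 a b nn fin T f \<longleftrightarrow>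
     \<comment> \<open>(1) measurability, nonnegativity, f in C([0,T), w-L^1((0,oo), x dx))\<close>
     (\<lambda>p. f (fst p) (snd p)) \<in> borel_measurable borel \<and>
     (\<forall>t\<in>{0..<T}. AE x in lborel. x \<in> {0<..} \<longrightarrow> f t x \<ge> 0) \<and>
     (\<forall>t\<in>{0..<T}. set_integrable lborel {0<..} (\<lambda>x. x * f t x)) \<and>
     (\<forall>psi::real \<Rightarrow> real. psi \<in> borel_measurable borel \<longrightarrow> bounded (range psi) \<longrightarrow>
        continuous_on {0..<T} (\<lambda>t. set_lebesgue_integral lborel {0<..} (\<lambda>x. psi x * x * f t x))) \<and>
     \<comment> \<open>f in L^oo((0,T*), L^1((0,oo),dx)) for every T* < T\<close>
     (\<forall>Ts. Ts < T \<longrightarrow> (\<exists>C. AE t in lborel. t \<in> {0<..<Ts} \<longrightarrow>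
        set_integrable lborel {0<..} (f t) \<and> set_lebesgue_integral lborel {0<..} (\<lambda>x. \<bar>f t x\<bar>) \<le> C)) \<and>
     \<comment> \<open>(2)\<close>
     (\<forall>t\<in>{0..<T}. LS_u rho f t > Phi0) \<and>
     \<comment> \<open>(3) weak formulation\<close>
     (\<forall>phi phit phix. C1c_test T phi phit phix \<longrightarrow>
        set_lebesgue_integral lborel {0<..<T} (\<lambda>t. set_lebesgue_integral lborel {0<..}
            (\<lambda>x. (phit t x + (a x * LS_u rho f t - b x) * phix t x) * f t x))
        + set_lebesgue_integral lborel {0<..<T} (\<lambda>t. phi t 0 * nn (LS_u rho f t))
        + set_lebesgue_integral lborel {0<..} (\<lambda>x. phi 0 x * fin x) = 0)"

end

(*
  Let G(t,x) be the integral of f - g over (x,oo), with u and v the corresponding values of the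
  monomer concentration. Then G_t + (a u - b) G_x = (u - v) a g, and G(t,0) is the time integral of
  n(u) - n(v). Since u - v is minus the integral of G, one would like a Gronwall estimate for the
  L^1 norm of G; the obstacle is that a' and b' may blow up at 0. It is removed by a weight w with
  w (a u - b) - C x nonincreasing on (0,oo): take w = 1/a near 0 if Phi increases there, w = 1/(a K - b)
  with Phi0 < K <= inf u if Phi decreases there, and w constant away from 0. For H(t) the integral of
  w |G(t,.)| this gives H(t) <= const * (integral of H over (0,t)), hence H = 0. As f and g are only
  integrable, |G| is differentiated along t and along x by a chain rule for absolutely continuous
  functions, and monotonicity of the speed is exploited by a layer-cake argument instead of an
  integration by parts.
*)

theory Submission
  imports Defs
begin

section \<open>Absolutely continuous functions of one variable\<close>

text \<open>Formally, the transport term contributes the integral of |G| against the derivative of w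
  (a u - b), plus a boundary term at x = 0. Only an upper bound on this derivative is needed, so a
  singularity of a' or b' is harmless wherever it makes w (a u - b) decrease. The boundary term is
  at most C |G(t,0)|, and the Lipschitz bound for n turns G(t,0) into a time integral of |u - v|.
  The source (u - v) a g is controlled because w a grows at most linearly and g has a finite moment.
  The loop closes because |u - v| is at most the L^1 norm of G, hence at most H / c when w >= c > 0.
  The weak formulation is used only with products of a function of t and a function of x. Fubini
  then yields the equation for G in integrated form, so no regularity of the solutions is required.
  All of this takes place on [0,S] with S < T: only on a compact time interval does continuity keep
  u at a positive distance from Phi0, and this distance is what the weight for decreasing Phi
  consumes.\<close>

lemma enn2real_inj:
  assumes "enn2real x = enn2real y" "x \<noteq> top" "y \<noteq> top"
  shows "x = y"
proof -
  have "ennreal (enn2real x) = ennreal (enn2real y)" using assms(1) by simp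
  then show ?thesis using assms(2,3) by (simp add: ennreal_enn2real_if)
qed

text \<open>The positive and the negative part of \<open>Q\<close> are densities of two finite
  measures that agree on boxes. Boxes form an intersection-stable generator of the Borel sets, so
  the measures and hence the densities coincide.\<close>

lemma AE_zero_if_box_integrals_zero:
  fixes Q :: "'a::euclidean_space \<Rightarrow> real"
  assumes Q: "integrable lborel Q"
    and zero: "\<And>a b. (LINT x:box a b|lborel. Q x) = 0"
  shows "AE x in lborel. Q x = 0"
proof -
  have [measurable]: "Q \<in> borel_measurable lborel" using Q by auto
  let ?P = "\<lambda>x. ennreal (Q x)" and ?N = "\<lambda>x. ennreal (- Q x)"
  have finP: "integral\<^sup>N lborel ?P \<noteq> \<infinity>" and finN: "integral\<^sup>N lborel ?N \<noteq> \<infinity>"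
    using Q by (auto simp: real_integrable_def)
  have box: "emeasure (density lborel ?P) (box a b) = emeasure (density lborel ?N) (box a b)" for a b :: 'a
  proof -
    let ?R = "\<lambda>x. indicator (box a b) x * Q x"
    have R: "integrable lborel ?R"
      using integrable_real_mult_indicator[OF _ Q, of "box a b"] by (simp add: mult.commute)
    have e1: "(\<integral>\<^sup>+x. ?P x * indicator (box a b) x \<partial>lborel) = (\<integral>\<^sup>+x. ennreal (?R x) \<partial>lborel)"
      by (intro nn_integral_cong) (auto split: split_indicator)
    have e2: "(\<integral>\<^sup>+x. ?N x * indicator (box a b) x \<partial>lborel) = (\<integral>\<^sup>+x. ennreal (- ?R x) \<partial>lborel)"
      by (intro nn_integral_cong) (auto split: split_indicator)
    have f1: "(\<integral>\<^sup>+x. ennreal (?R x) \<partial>lborel) \<noteq> \<infinity>" and f2: "(\<integral>\<^sup>+x. ennreal (- ?R x) \<partial>lborel) \<noteq> \<infinity>"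
      using R by (auto simp: real_integrable_def)
    have "integral\<^sup>L lborel ?R = 0"
      using zero[of a b] by (simp add: set_lebesgue_integral_def)
    then have "enn2real (\<integral>\<^sup>+x. ennreal (?R x) \<partial>lborel) = enn2real (\<integral>\<^sup>+x. ennreal (- ?R x) \<partial>lborel)"
      by (simp add: real_lebesgue_integral_def[OF R])
    then have "(\<integral>\<^sup>+x. ennreal (?R x) \<partial>lborel) = (\<integral>\<^sup>+x. ennreal (- ?R x) \<partial>lborel)"
      using enn2real_inj f1 f2 by simp
    then show ?thesis
      by (simp add: emeasure_density e1 e2)
  qed
  have "density lborel ?P = density lborel ?N"
  proof (rule measure_eqI_generator_eq)
    let ?E = "range (\<lambda>(a, b). box a b::'a set)"
    show "Int_stable ?E"
      by (auto simp: Int_stable_def box_Int_box)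
    show "?E \<subseteq> Pow UNIV" "sets (density lborel ?P) = sigma_sets UNIV ?E"
      "sets (density lborel ?N) = sigma_sets UNIV ?E"
      by (simp_all add: borel_eq_box)
    let ?A = "\<lambda>n::nat. box (- (real n *\<^sub>R One)) (real n *\<^sub>R One) :: 'a set"
    show "range ?A \<subseteq> ?E" "(\<Union>i. ?A i) = UNIV"
      unfolding UN_box_eq_UNIV by auto
    show "emeasure (density lborel ?P) (?A i) \<noteq> \<infinity>" for i
    proof -
      have "emeasure (density lborel ?P) (?A i) \<le> emeasure (density lborel ?P) (space (density lborel ?P))"
        by (rule emeasure_space)
      also have "\<dots> = integral\<^sup>N lborel ?P" by (simp add: emeasure_density)
      finally show ?thesis using finP by (auto simp: top_unique)
    qed
    show "emeasure (density lborel ?P) X = emeasure (density lborel ?N) X" if "X \<in> ?E" for X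
      using that box by auto
  qed
  then have "AE x in lborel. ?P x = ?N x"
    by (subst (asm) finite_density_unique) (use finP in auto)
  \<comment> \<open>At each point one of the two parts is zero, so where they are equal both
    vanish.\<close>
  then show ?thesis
  proof (eventually_elim)
    case (elim x)
    show ?case
    proof (cases "Q x > 0")
      case True
      then have "?N x = 0" by (simp add: ennreal_neg)
      with elim have "?P x = 0" by simp
      then show ?thesis using True by (simp add: ennreal_eq_0_iff)
    next
      case False
      then have "?P x = 0" by (simp add: ennreal_neg)
      with elim have "?N x = 0" by simp
      then show ?thesis using False by (simp add: ennreal_eq_0_iff)
    qed
  qed
qed

text \<open>Absolute continuity is encoded throughout as
  \<open>h t = c + (LINT s:{..t}|lborel. k s)\<close> with \<open>k\<close> integrable on the whole
  line. Time integrals fit this form once the integrand is zero at negative times, and tail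
  integrals fit it with \<open>c\<close> the total mass and the density negated.\<close>

lemma AC_increment:
  fixes k :: "real \<Rightarrow> real"
  assumes k: "integrable lborel k" and h: "\<And>t. h t = c + (LINT s:{..t}|lborel. k s)"
    and "a \<le> b"
  shows "h b - h a = (LINT s:{a<..b}|lborel. k s)"
proof -
  have si: "set_integrable lborel A k" if "A \<in> sets borel" for A
    using k that by (simp add: set_integrable_def integrable_mult_indicator del: real_scaleR_def)
  have "{..b} = {..a} \<union> {a<..b}" using \<open>a \<le> b\<close> by auto
  then have "(LINT s:{..b}|lborel. k s) = (LINT s:{..a}|lborel. k s) + (LINT s:{a<..b}|lborel. k s)"
    using set_integral_Un[of "{..a}" "{a<..b}" lborel k] si by fastforce
  then show ?thesis by (simp add: h)
qed

lemma AC_continuous: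
  fixes k :: "real \<Rightarrow> real"
  assumes k: "integrable lborel k" and h: "\<And>t. h t = c + (LINT s:{..t}|lborel. k s)"
  shows "continuous_on UNIV h"
proof -
  have [measurable]: "k \<in> borel_measurable lborel" using k by auto
  have "isCont h x" for x
    unfolding continuous_at_sequentially comp_def
  proof (intro allI impI)
    fix X :: "nat \<Rightarrow> real" assume X: "X \<longlonglongrightarrow> x"
    have "(\<lambda>n. LINT s|lborel. indicator {..X n} s *\<^sub>R k s) \<longlonglongrightarrow> (LINT s|lborel. indicator {..x} s *\<^sub>R k s)"
    proof (rule integral_dominated_convergence[where w="\<lambda>s. \<bar>k s\<bar>"])
      show "AE s in lborel. (\<lambda>n. indicator {..X n} s *\<^sub>R k s) \<longlonglongrightarrow> indicator {..x} s *\<^sub>R k s"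
        using AE_lborel_singleton[of x]
      proof eventually_elim
        case (elim s)
        have "\<forall>\<^sub>F n in sequentially. indicator {..X n} s *\<^sub>R k s = indicator {..x} s *\<^sub>R k s"
        proof (cases "s < x")
          case True
          show ?thesis using order_tendstoD(1)[OF X True] by eventually_elim (use True in auto)
        next
          case False
          with elim have "x < s" by simp
          show ?thesis using order_tendstoD(2)[OF X \<open>x < s\<close>] by eventually_elim (use \<open>x < s\<close> in auto)
        qed
        then show ?case by (rule tendsto_eventually)
      qed
      show "AE s in lborel. norm (indicator {..X n} s *\<^sub>R k s) \<le> \<bar>k s\<bar>" for n
        by (auto split: split_indicator)
      show "integrable lborel (\<lambda>s. \<bar>k s\<bar>)" using k by simp
    qed measurable
    then show "(\<lambda>n. h (X n)) \<longlonglongrightarrow> h x"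
      unfolding h set_lebesgue_integral_def by (intro tendsto_add tendsto_const)
  qed
  then show ?thesis by (simp add: continuous_at_imp_continuous_on)
qed

text \<open>On short intervals the mean value theorem lets one replace \<open>\<eta>' (h t)\<close> by its value at an
  intermediate point, with an error controlled by the modulus of continuity of \<open>\<eta>' \<circ> h\<close>.\<close>

lemma AC_chain_rule:
  fixes k \<eta> \<eta>' :: "real \<Rightarrow> real"
  assumes k: "integrable lborel k" and h: "\<And>t. h t = c + (LINT s:{..t}|lborel. k s)"
    and \<eta>: "\<And>r. (\<eta> has_real_derivative \<eta>' r) (at r)" and \<eta>': "continuous_on UNIV \<eta>'"
    and ab: "a < b"
  shows "\<eta> (h b) - \<eta> (h a) = (LINT s:{a<..b}|lborel. \<eta>' (h s) * k s)"
proof -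
  have [measurable]: "k \<in> borel_measurable borel" using k by auto
  have hc: "continuous_on UNIV h" by (rule AC_continuous[OF k h])
  have \<eta>h: "continuous_on UNIV (\<lambda>s. \<eta>' (h s))"
    using continuous_on_compose2[OF \<eta>' hc] by auto
  then have [measurable]: "(\<lambda>s. \<eta>' (h s)) \<in> borel_measurable borel"
    by (rule borel_measurable_continuous_onI)
  have si: "set_integrable lborel A k" "set_integrable lborel A (\<lambda>s. \<bar>k s\<bar>)" if "A \<in> sets borel" for A
    using k that by (simp_all add: set_integrable_def integrable_mult_indicator del: real_scaleR_def)
  have "compact ((\<lambda>s. \<eta>' (h s)) ` {a..b})"
    by (intro compact_continuous_image continuous_on_subset[OF \<eta>h]) auto
  then obtain B where B: "\<And>s. s \<in> {a..b} \<Longrightarrow> \<bar>\<eta>' (h s)\<bar> \<le> B"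
    unfolding bounded_iff[of "(\<lambda>s. \<eta>' (h s)) ` {a..b}"] using compact_imp_bounded bounded_iff
    by (metis image_eqI real_norm_def)
  have sj: "set_integrable lborel A (\<lambda>s. \<eta>' (h s) * k s)" if "A \<in> sets borel" "A \<subseteq> {a..b}" for A
    unfolding set_integrable_def
  proof (rule Bochner_Integration.integrable_bound)
    show "integrable lborel (\<lambda>s. B * \<bar>k s\<bar>)" using k by simp
    show "AE x in lborel. norm (indicat_real A x *\<^sub>R (\<eta>' (h x) * k x)) \<le> norm (B * \<bar>k x\<bar>)"
    proof (rule AE_I2)
      fix x show "norm (indicat_real A x *\<^sub>R (\<eta>' (h x) * k x)) \<le> norm (B * \<bar>k x\<bar>)"
      proof (cases "x \<in> A")
        case True
        then have "\<bar>\<eta>' (h x)\<bar> \<le> B" using B that by auto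
        then show ?thesis using True by (auto simp: abs_mult intro!: mult_right_mono)
      qed auto
    qed
    show "(\<lambda>x. indicat_real A x *\<^sub>R (\<eta>' (h x) * k x)) \<in> borel_measurable lborel" using that by measurable
  qed
  \<comment> \<open>\<open>E\<close> is the defect in the chain rule and \<open>V\<close> the
    variation of \<open>h\<close>, both as functions of the right end point and both zero at
    \<open>a\<close>. The aim is to bound the increments of \<open>E\<close> by a small multiple of
    those of \<open>V\<close>.\<close>
  define E where "E t = \<eta> (h t) - \<eta> (h a) - (LINT s:{a<..t}|lborel. \<eta>' (h s) * k s)" for t
  define V where "V t = (LINT s:{a<..t}|lborel. \<bar>k s\<bar>)" for t
  have "\<bar>E b\<bar> \<le> \<epsilon> * V b" if "\<epsilon> > 0" for \<epsilon>
  proof -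
    have "uniformly_continuous_on {a..b} (\<lambda>s. \<eta>' (h s))"
      by (intro compact_uniformly_continuous continuous_on_subset[OF \<eta>h]) auto
    then obtain \<delta> where \<delta>: "\<delta> > 0"
      "\<And>s t. s \<in> {a..b} \<Longrightarrow> t \<in> {a..b} \<Longrightarrow> \<bar>s - t\<bar> < \<delta> \<Longrightarrow> \<bar>\<eta>' (h s) - \<eta>' (h t)\<bar> < \<epsilon>"
      using \<open>\<epsilon> > 0\<close> unfolding uniformly_continuous_on_def dist_real_def by metis
    have loc: "\<bar>E t - E s\<bar> \<le> \<epsilon> * (V t - V s)" if st: "a \<le> s" "s \<le> t" "t \<le> b" "t - s < \<delta>" for s t
    proof -
      have split: "{a<..t} = {a<..s} \<union> {s<..t}" using st by auto
      have Vd: "V t - V s = (LINT r:{s<..t}|lborel. \<bar>k r\<bar>)"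
        unfolding V_def split using set_integral_Un[of "{a<..s}" "{s<..t}" lborel "\<lambda>r. \<bar>k r\<bar>"] si by fastforce
      have Id: "(LINT r:{a<..t}|lborel. \<eta>' (h r) * k r) - (LINT r:{a<..s}|lborel. \<eta>' (h r) * k r)
          = (LINT r:{s<..t}|lborel. \<eta>' (h r) * k r)"
      proof -
        have "{a<..s} \<inter> {s<..t} = {}" by auto
        moreover have "set_integrable lborel {a<..s} (\<lambda>r. \<eta>' (h r) * k r)" by (rule sj) (use st in auto)
        moreover have "set_integrable lborel {s<..t} (\<lambda>r. \<eta>' (h r) * k r)" by (rule sj) (use st in auto)
        ultimately show ?thesis
          unfolding split using set_integral_Un[of "{a<..s}" "{s<..t}" lborel "\<lambda>r. \<eta>' (h r) * k r"] by simp
      qed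
      \<comment> \<open>The mean value theorem gives an intermediate value between
        \<open>h s\<close> and \<open>h t\<close>. Connectedness of the image pulls it back to a
        point of \<open>{s..t}\<close>, where the modulus of continuity of \<open>\<eta>'\<close>
        composed with \<open>h\<close> applies.\<close>
      have "\<exists>p\<in>{s..t}. \<eta> (h t) - \<eta> (h s) = \<eta>' (h p) * (h t - h s)"
      proof (cases "h s = h t")
        case True then show ?thesis using st by auto
      next
        case False
        have mvt: "\<exists>z. min (h s) (h t) < z \<and> z < max (h s) (h t) \<and> \<eta> (h t) - \<eta> (h s) = \<eta>' z * (h t - h s)"
        proof (cases "h s < h t")
          case True
          from MVT2[OF True, of \<eta> \<eta>'] \<eta> obtain z where "h s < z" "z < h t" "\<eta> (h t) - \<eta> (h s) = (h t - h s) * \<eta>' z" by auto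
          then show ?thesis by (auto simp: mult.commute intro!: exI[of _ z])
        next
          case F: False
          with False have "h t < h s" by simp
          from MVT2[OF this, of \<eta> \<eta>'] \<eta> obtain z where "h t < z" "z < h s" "\<eta> (h s) - \<eta> (h t) = (h s - h t) * \<eta>' z" by auto
          then show ?thesis by (auto simp: algebra_simps intro!: exI[of _ z])
        qed
        then obtain z where z: "min (h s) (h t) < z" "z < max (h s) (h t)"
          "\<eta> (h t) - \<eta> (h s) = \<eta>' z * (h t - h s)" by auto
        have "connected (h ` {s..t})"
          by (intro connected_continuous_image continuous_on_subset[OF hc]) auto
        then have "z \<in> h ` {s..t}"
          using connectedD_interval[of "h ` {s..t}" "min (h s) (h t)" "max (h s) (h t)" z] z st
          by (auto simp: min_def max_def split: if_splits)
        then show ?thesis using z(3) by auto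
      qed
      then obtain p where p: "p \<in> {s..t}" "\<eta> (h t) - \<eta> (h s) = \<eta>' (h p) * (h t - h s)" by auto
      have "E t - E s = \<eta>' (h p) * (h t - h s) - (LINT r:{s<..t}|lborel. \<eta>' (h r) * k r)"
        unfolding E_def using Id p(2) by linarith
      also have "\<dots> = (LINT r:{s<..t}|lborel. \<eta>' (h p) * k r) - (LINT r:{s<..t}|lborel. \<eta>' (h r) * k r)"
        using AC_increment[OF k h st(2)] by simp
      also have "\<dots> = (LINT r:{s<..t}|lborel. \<eta>' (h p) * k r - \<eta>' (h r) * k r)"
      proof (rule set_integral_diff(2)[symmetric])
        show "set_integrable lborel {s<..t} (\<lambda>r. \<eta>' (h p) * k r)" using si by simp
        show "set_integrable lborel {s<..t} (\<lambda>r. \<eta>' (h r) * k r)" by (rule sj) (use st in auto)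
      qed
      also have "\<bar>\<dots>\<bar> \<le> (LINT r:{s<..t}|lborel. \<epsilon> * \<bar>k r\<bar>)"
        unfolding set_lebesgue_integral_def real_norm_def[symmetric]
      proof (rule Bochner_Integration.integral_norm_bound_integral)
        show "integrable lborel (\<lambda>x. indicat_real {s<..t} x *\<^sub>R (\<epsilon> * norm (k x)))"
          using si(2)[of "{s<..t}"] unfolding set_integrable_def by (simp add: mult.left_commute)
        show "integrable lborel (\<lambda>x. indicat_real {s<..t} x *\<^sub>R (\<eta>' (h p) * k x - \<eta>' (h x) * k x))"
          unfolding set_integrable_def[symmetric]
          by (intro set_integral_diff(1) set_integrable_mult_right si(1) sj) (use st in auto)
        fix x
        show "norm (indicat_real {s<..t} x *\<^sub>R (\<eta>' (h p) * k x - \<eta>' (h x) * k x))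
            \<le> indicat_real {s<..t} x *\<^sub>R (\<epsilon> * norm (k x))"
        proof (cases "x \<in> {s<..t}")
          case True
          have "\<bar>\<eta>' (h p) - \<eta>' (h x)\<bar> \<le> \<epsilon>" using \<delta>(2)[of p x] True p st by (auto simp: less_imp_le)
          then show ?thesis using True
            by (auto simp: abs_mult left_diff_distrib[symmetric] intro!: mult_right_mono)
        qed auto
      qed
      also have "\<dots> = \<epsilon> * (V t - V s)" by (simp add: Vd)
      finally show ?thesis .
    qed
    \<comment> \<open>Equal steps of length below \<open>\<delta>\<close> reduce the global bound to
      the local one; the increments of \<open>V\<close> telescope.\<close>
    obtain n :: nat where n: "(b - a) / \<delta> < real n" using reals_Archimedean2 by blast
    have npos: "n > 0" using n ab \<delta> by (metis divide_pos_pos diff_gt_0_iff_gt less_trans of_nat_0_less_iff)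
    define r where "r = (b - a) / n"
    have r: "r > 0" "r < \<delta>" "real n * r = b - a"
      using npos ab n \<delta> by (auto simp: r_def field_simps)
    have "\<bar>E (a + real i * r)\<bar> \<le> \<epsilon> * V (a + real i * r)" if "i \<le> n" for i
      using that
    proof (induction i)
      case 0 show ?case by (simp add: E_def V_def set_lebesgue_integral_def)
    next
      case (Suc i)
      have "real (Suc i) * r \<le> real n * r" using Suc r by (intro mult_right_mono) auto
      then have "a + real (Suc i) * r \<le> b" using r by simp
      then have "\<bar>E (a + real (Suc i) * r) - E (a + real i * r)\<bar> \<le> \<epsilon> * (V (a + real (Suc i) * r) - V (a + real i * r))"
        using r by (intro loc) (auto simp: algebra_simps)
      then show ?case using Suc by (auto simp: algebra_simps)
    qed
    from this[of n] show ?thesis using r by simp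
  qed
  note bound = this
  have V0: "V b \<ge> 0" unfolding V_def set_lebesgue_integral_def by (intro integral_nonneg_AE) auto
  have "\<bar>E b\<bar> \<le> \<epsilon>" if e: "\<epsilon> > 0" for \<epsilon>
  proof -
    \<comment> \<open>The denominator is \<open>V b + 1\<close> because \<open>V b\<close> may be
      zero.\<close>
    have "\<bar>E b\<bar> \<le> \<epsilon> / (V b + 1) * V b" by (rule bound) (use V0 e in simp)
    also have "\<dots> = \<epsilon> * (V b / (V b + 1))" by simp
    also have "\<dots> \<le> \<epsilon> * 1" by (rule mult_left_mono) (use V0 e in auto)
    finally show ?thesis by simp
  qed
  then have "\<bar>E b\<bar> \<le> 0" by (rule field_le_epsilon) simp
  then have "E b = 0" by simp
  then show ?thesis by (simp add: E_def)
qed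

text \<open>The absolute value is approximated by sqrt(r^2 + e) with e tending to 0. The derivatives
  are bounded by 1 and converge pointwise to \<open>sgn r\<close>, with value 0 at r = 0, so
  dominated convergence passes to the limit in the smooth chain rule.\<close>

lemma AC_abs_chain_rule:
  fixes k :: "real \<Rightarrow> real"
  assumes k: "integrable lborel k" and h: "\<And>t. h t = c + (LINT s:{..t}|lborel. k s)"
    and ab: "a < b"
  shows "\<bar>h b\<bar> - \<bar>h a\<bar> = (LINT s:{a<..b}|lborel. sgn (h s) * k s)"
proof -
  have [measurable]: "k \<in> borel_measurable borel" using k by auto
  have hc: "continuous_on UNIV h" by (rule AC_continuous[OF k h])
  then have [measurable]: "h \<in> borel_measurable borel"
    by (rule borel_measurable_continuous_onI)
  define e where "e n = 1 / real (Suc n)" for n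
  have e: "e n > 0" "e \<longlonglongrightarrow> 0" for n
    unfolding e_def using lim_1_over_n[THEN LIMSEQ_Suc] by auto
  have pos: "r\<^sup>2 + e n > 0" for r n using e by (simp add: add_nonneg_pos)
  define D where "D n r = r / sqrt (r\<^sup>2 + e n)" for n r
  have eq: "sqrt ((h b)\<^sup>2 + e n) - sqrt ((h a)\<^sup>2 + e n) = (LINT s:{a<..b}|lborel. D n (h s) * k s)" for n
  proof (rule AC_chain_rule[OF k h _ _ ab])
    show "((\<lambda>r. sqrt (r\<^sup>2 + e n)) has_real_derivative D n r) (at r)" for r
      unfolding D_def using pos[of r n] by (auto intro!: derivative_eq_intros simp: field_simps)
    show "continuous_on UNIV (D n)"
      unfolding D_def
    proof (intro continuous_intros ballI)
      show "sqrt (r\<^sup>2 + e n) \<noteq> 0" for r using pos[of r n] by simp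
    qed
  qed
  have l1: "(\<lambda>n. sqrt ((h b)\<^sup>2 + e n) - sqrt ((h a)\<^sup>2 + e n)) \<longlonglongrightarrow> sqrt ((h b)\<^sup>2 + 0) - sqrt ((h a)\<^sup>2 + 0)"
    by (intro tendsto_intros e)
  have "(\<lambda>n. LINT s:{a<..b}|lborel. D n (h s) * k s) \<longlonglongrightarrow> (LINT s:{a<..b}|lborel. sgn (h s) * k s)"
    unfolding set_lebesgue_integral_def
  proof (rule integral_dominated_convergence[where w="\<lambda>s. \<bar>k s\<bar>"])
    show "integrable lborel (\<lambda>s. \<bar>k s\<bar>)" using k by simp
    show "AE x in lborel. (\<lambda>i. indicat_real {a<..b} x *\<^sub>R (D i (h x) * k x))
         \<longlonglongrightarrow> indicat_real {a<..b} x *\<^sub>R (sgn (h x) * k x)"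
    proof (intro AE_I2 tendsto_intros)
      fix x
      show "(\<lambda>i. D i (h x)) \<longlonglongrightarrow> sgn (h x)"
      proof (cases "h x = 0")
        case False
        have "(\<lambda>i. h x / sqrt ((h x)\<^sup>2 + e i)) \<longlonglongrightarrow> h x / sqrt ((h x)\<^sup>2 + 0)"
          by (intro tendsto_intros e) (use False in auto)
        moreover have "sgn (h x) = h x / sqrt ((h x)\<^sup>2 + 0)" using False by (simp add: sgn_real_def)
        ultimately show ?thesis unfolding D_def by simp
      qed (simp add: D_def)
    qed
    show "AE x in lborel. norm (indicat_real {a<..b} x *\<^sub>R (D i (h x) * k x)) \<le> \<bar>k x\<bar>" for i
    proof (rule AE_I2)
      fix x
      have "\<bar>h x\<bar> \<le> sqrt ((h x)\<^sup>2 + e i)" using e(1)[of i] by (intro real_le_rsqrt) auto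
      then have "\<bar>D i (h x)\<bar> \<le> 1" unfolding D_def using pos[of "h x" i]
        by (auto simp: abs_divide divide_le_eq)
      then have "\<bar>D i (h x)\<bar> * \<bar>k x\<bar> \<le> 1 * \<bar>k x\<bar>" by (intro mult_right_mono) auto
      then show "norm (indicat_real {a<..b} x *\<^sub>R (D i (h x) * k x)) \<le> \<bar>k x\<bar>"
        by (auto simp: abs_mult split: split_indicator)
    qed
    show "(\<lambda>x. indicat_real {a<..b} x *\<^sub>R (D i (h x) * k x)) \<in> borel_measurable lborel" for i
      unfolding D_def by measurable
  qed measurable
  then show ?thesis using l1 unfolding eq by (auto intro: LIMSEQ_unique)
qed

text \<open>Layer cake: the superlevel sets of \<open>\<kappa> - q\<close> are half-lines, on which \<open>\<mu>\<close> has nonnegative integral.\<close>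

lemma integral_antimono_mult_le:
  fixes q \<mu> :: "real \<Rightarrow> real"
  assumes \<mu>: "integrable lborel \<mu>" "\<And>x. x \<le> 0 \<Longrightarrow> \<mu> x = 0"
    and m: "\<And>x. x \<ge> 0 \<Longrightarrow> (LINT z:{x<..}|lborel. \<mu> z) \<ge> 0"
    and q: "antimono_on {0<..} q" "\<And>x. x > 0 \<Longrightarrow> q x \<le> \<kappa>"
    and qm: "q \<in> borel_measurable borel"
    and q\<mu>: "integrable lborel (\<lambda>x. q x * \<mu> x)"
  shows "(LINT x|lborel. q x * \<mu> x) \<le> \<kappa> * (LINT x|lborel. \<mu> x)"
proof -
  note [measurable] = qm
  have [measurable]: "\<mu> \<in> borel_measurable borel" using \<mu> by auto
  \<comment> \<open>Replacing \<open>\<kappa> - q\<close> by 0 on the nonpositive half-line, where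
    \<open>\<mu>\<close> vanishes, makes \<open>r\<close> nonnegative everywhere, so that
    \<open>r x\<close> is the length of \<open>{0<..<r x}\<close>.\<close>
  define r where "r x = (if x > 0 then \<kappa> - q x else 0)" for x
  have rm[measurable]: "r \<in> borel_measurable borel" unfolding r_def by measurable
  have r0: "r x \<ge> 0" for x using q(2) by (auto simp: r_def)
  have rmu: "r x * \<mu> x = \<kappa> * \<mu> x - q x * \<mu> x" for x using \<mu>(2)[of x] by (auto simp: r_def algebra_simps)
  have rint: "integrable lborel (\<lambda>x. r x * \<mu> x)" unfolding rmu using \<mu>(1) q\<mu> by auto
  define I where "I y x = (indicator {0<..<r x} y :: real) * \<mu> x" for y x
  have ind: "(LINT y|lborel. indicator {0<..<r x} y :: real) = r x" for x
    using r0[of x] by simp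
  have Im: "(\<lambda>(x, y). I y x) \<in> borel_measurable (lborel \<Otimes>\<^sub>M lborel)"
  proof -
    have "(\<lambda>(x, y). I y x) = (\<lambda>p. (if 0 < snd p \<and> snd p < r (fst p) then \<mu> (fst p) else 0))"
      by (auto simp: I_def fun_eq_iff)
    then show ?thesis by simp
  qed
  have Iint: "integrable (lborel \<Otimes>\<^sub>M lborel) (\<lambda>(x, y). I y x)"
  proof (rule lborel_pair.Fubini_integrable[OF Im])
    have "(\<lambda>x. LINT y|lborel. norm (I y x)) = (\<lambda>x. \<bar>r x * \<mu> x\<bar>)"
      unfolding I_def by (simp add: abs_mult ind r0 fun_eq_iff)
    then show "integrable lborel (\<lambda>x. LINT y|lborel. norm (case (x, y) of (x, y) \<Rightarrow> I y x))"
      using integrable_abs[OF rint] by simp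
    show "AE x in lborel. integrable lborel (\<lambda>y. case (x, y) of (x, y) \<Rightarrow> I y x)"
      unfolding I_def by (intro AE_I2) (simp add: integrable_real_indicator emeasure_lborel_Ioo r0)
  qed
  have "(LINT x|lborel. r x * \<mu> x) = (LINT x|lborel. LINT y|lborel. I y x)"
    unfolding I_def using ind by (subst Bochner_Integration.integral_mult_left_zero) simp
  also have "\<dots> = (LINT y|lborel. LINT x|lborel. I y x)"
    using lborel_pair.Fubini_integral[OF Iint] by simp
  also have "\<dots> \<ge> 0"
  proof (rule integral_nonneg_AE, rule AE_I2)
    fix y
    show "(LINT x|lborel. I y x) \<ge> 0"
    proof (cases "y > 0 \<and> (\<exists>x>0. y < r x)")
      case False
      then have "I y x = 0" for x using \<mu>(2)[of x] unfolding I_def r_def by (auto split: split_indicator)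
      then show ?thesis by simp
    next
      case True
      \<comment> \<open>As \<open>q\<close> decreases, this superlevel set contains everything to
        the right of each of its points. It is therefore a half-line starting at its infimum, open
        or closed; the end point is a null set.\<close>
      define U where "U = {x. 0 < x \<and> y < r x}"
      have up: "x' \<in> U" if "x \<in> U" "x \<le> x'" for x x'
        using that monotone_onD[OF q(1), of x x'] unfolding U_def r_def by auto
      define c where "c = Inf U"
      have ne: "U \<noteq> {}" "bdd_below U" using True by (auto simp: U_def intro!: bdd_belowI[of _ 0])
      have c0: "c \<ge> 0" unfolding c_def using ne by (intro cInf_greatest) (auto simp: U_def)
      have "(LINT x|lborel. I y x) = (LINT x:{c<..}|lborel. \<mu> x)"
        unfolding set_lebesgue_integral_def
      proof (rule integral_cong_AE)
        show "AE x in lborel. I y x = indicat_real {c<..} x *\<^sub>R \<mu> x"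
          using AE_lborel_singleton[of c]
        proof eventually_elim
          case (elim x)
          have "x \<in> U \<longleftrightarrow> x > c"
          proof
            assume "x \<in> U" then have "c \<le> x" unfolding c_def by (rule cInf_lower[OF _ ne(2)])
            with elim show "x > c" by simp
          next
            assume "x > c" then obtain z where "z \<in> U" "z < x" unfolding c_def using cInf_less_iff[OF ne] by auto
            with up show "x \<in> U" by auto
          qed
          moreover have "I y x = (if x \<in> U then \<mu> x else 0)"
            using True \<mu>(2)[of x] by (auto simp: I_def U_def split: split_indicator)
          ultimately show ?case by auto
        qed
        show "(\<lambda>x. I y x) \<in> borel_measurable lborel"
        proof -
          have "(\<lambda>x. I y x) = (\<lambda>x. (if 0 < y \<and> y < r x then \<mu> x else 0))"
            by (auto simp: I_def fun_eq_iff)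
          then show ?thesis by simp
        qed
      qed measurable
      also have "\<dots> \<ge> 0" by (rule m[OF c0])
      finally show ?thesis .
    qed
  qed
  finally have "0 \<le> (LINT x|lborel. \<kappa> * \<mu> x - q x * \<mu> x)" by (simp add: rmu)
  also have "\<dots> = \<kappa> * (LINT x|lborel. \<mu> x) - (LINT x|lborel. q x * \<mu> x)"
    using \<mu>(1) q\<mu> by simp
  finally show ?thesis by simp
qed

text \<open>If \<open>M\<close> is the supremum of \<open>H t / exp (2 C t)\<close>, the hypothesis gives \<open>M \<le> M / 2\<close>.\<close>

lemma Gronwall_zero:
  fixes H :: "real \<Rightarrow> real"
  assumes H: "\<And>t. t \<in> {0..S} \<Longrightarrow> 0 \<le> H t" "\<And>t. t \<in> {0..S} \<Longrightarrow> H t \<le> B"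
    and Hc: "continuous_on {0..S} H"
    and C: "C > 0" and le: "\<And>t. t \<in> {0..S} \<Longrightarrow> H t \<le> C * (LINT s:{0..t}|lborel. H s)"
    and t: "t \<in> {0..S}"
  shows "H t = 0"
proof -
  \<comment> \<open>The factor 2 in the exponent is what gains: integrating
    \<open>exp (2 * C * s)\<close> produces 1 / (2 C), and multiplication by \<open>C\<close> leaves
    one half.\<close>
  define W where "W = (\<lambda>t. H t * exp (- (2 * C * t))) ` {0..S}"
  define M where "M = Sup W"
  have ne: "W \<noteq> {}" using t by (auto simp: W_def)
  have bdd: "bdd_above W"
    unfolding W_def
  proof (rule bdd_aboveI2[of _ _ "max B 0"])
    fix s assume s: "s \<in> {0..S}"
    have "H s * exp (- (2 * C * s)) \<le> H s * 1" using H(1)[OF s] C s by (intro mult_left_mono) auto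
    then show "H s * exp (- (2 * C * s)) \<le> max B 0" using H(2)[OF s] by auto
  qed
  have HM: "H s \<le> M * exp (2 * C * s)" if "s \<in> {0..S}" for s
  proof -
    have "H s * exp (- (2 * C * s)) \<le> M" unfolding M_def
      by (rule cSup_upper[OF _ bdd]) (use that in \<open>auto simp: W_def\<close>)
    then have "H s * exp (- (2 * C * s)) * exp (2 * C * s) \<le> M * exp (2 * C * s)" by (intro mult_right_mono) auto
    then show ?thesis by (simp add: mult.assoc exp_add[symmetric])
  qed
  have M0: "M \<ge> 0"
  proof -
    have "0 \<le> H t * exp (- (2 * C * t))" using H(1)[OF t] by auto
    also have "\<dots> \<le> M" unfolding M_def by (rule cSup_upper[OF _ bdd]) (use t in \<open>auto simp: W_def\<close>)
    finally show ?thesis .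
  qed
  have half: "H s \<le> M / 2 * exp (2 * C * s)" if s: "s \<in> {0..S}" for s
  proof -
    have "H s \<le> C * (LINT r:{0..s}|lborel. H r)" by (rule le[OF s])
    also have "(LINT r:{0..s}|lborel. H r) \<le> (LINT r:{0..s}|lborel. M * exp (2 * C * r))"
    proof (rule set_integral_mono)
      show "set_integrable lborel {0..s} H"
        by (rule borel_integrable_atLeastAtMost') (rule continuous_on_subset[OF Hc], use s in auto)
      show "set_integrable lborel {0..s} (\<lambda>r. M * exp (2 * C * r))"
        by (rule borel_integrable_atLeastAtMost') (auto intro!: continuous_intros)
      show "H r \<le> M * exp (2 * C * r)" if "r \<in> {0..s}" for r using that s by (intro HM) auto
    qed
    also have "\<dots> = M / (2 * C) * exp (2 * C * s) - M / (2 * C) * exp (2 * C * 0)"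
      unfolding set_lebesgue_integral_def
    proof (rule integral_FTC_atLeastAtMost)
      show "((\<lambda>r. M / (2 * C) * exp (2 * C * r)) has_vector_derivative M * exp (2 * C * r)) (at r within {0..s})" for r
        unfolding has_real_derivative_iff_has_vector_derivative[symmetric]
        using C by (auto intro!: derivative_eq_intros simp: field_simps)
    qed (use s in \<open>auto intro!: continuous_intros\<close>)
    also have "C * \<dots> \<le> M / 2 * exp (2 * C * s)" using C M0 by (simp add: field_simps)
    finally show ?thesis using C by (simp add: mult_left_mono)
  qed
  have "M \<le> M / 2" unfolding M_def
  proof (rule cSup_least[OF ne], fold M_def)
    fix w assume "w \<in> W"
    then obtain s where s: "s \<in> {0..S}" "w = H s * exp (- (2 * C * s))" by (auto simp: W_def)
    have "w \<le> M / 2 * exp (2 * C * s) * exp (- (2 * C * s))" unfolding s(2)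
      by (intro mult_right_mono half s) auto
    then show "w \<le> M / 2" by (simp add: mult.assoc exp_add[symmetric])
  qed
  with M0 have "M = 0" by simp
  with HM[OF t] H(1)[OF t] show ?thesis by simp
qed

section \<open>Weak solutions of a linear transport problem\<close>

lemma integrable_tensor:
  fixes f g :: "real \<Rightarrow> real"
  assumes f: "integrable lborel f" and g: "integrable lborel g"
  shows "integrable (lborel \<Otimes>\<^sub>M lborel) (\<lambda>(x, y). f x * g y)"
proof (rule lborel_pair.Fubini_integrable)
  have [measurable]: "f \<in> borel_measurable borel" "g \<in> borel_measurable borel" using f g by auto
  show "(\<lambda>(x, y). f x * g y) \<in> borel_measurable (lborel \<Otimes>\<^sub>M lborel)" by measurable
  show "integrable lborel (\<lambda>x. LINT y|lborel. norm (case (x, y) of (x, y) \<Rightarrow> f x * g y))"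
    using f by (simp add: abs_mult)
  show "AE x in lborel. integrable lborel (\<lambda>y. case (x, y) of (x, y) \<Rightarrow> f x * g y)"
    using g by simp
qed

text \<open>Both sides are the integral of \<open>k t * \<zeta> s\<close> over the half-plane t <=
  s. This replaces integration by parts: it moves the test function's tail integral onto a primitive
  of the density.\<close>

lemma integral_tail_mult:
  fixes \<zeta> k :: "real \<Rightarrow> real"
  assumes \<zeta>: "integrable lborel \<zeta>" and k: "integrable lborel k"
  shows "(LINT t|lborel. (LINT s:{t..}|lborel. \<zeta> s) * k t) = (LINT s|lborel. \<zeta> s * (LINT t:{..s}|lborel. k t))"
proof -
  have [measurable]: "\<zeta> \<in> borel_measurable borel" "k \<in> borel_measurable borel" using assms by auto
  define I where "I t s = (if t \<le> s then k t * \<zeta> s else 0)" for t s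
  have "integrable (lborel \<Otimes>\<^sub>M lborel) (\<lambda>(t, s). I t s)"
    by (rule Bochner_Integration.integrable_bound[OF integrable_tensor[OF k \<zeta>]]) (auto simp: I_def)
  then have "(LINT s|lborel. LINT t|lborel. I t s) = (LINT t|lborel. LINT s|lborel. I t s)"
    by (rule lborel_pair.Fubini_integral)
  moreover have "(LINT t|lborel. I t s) = \<zeta> s * (LINT t:{..s}|lborel. k t)" for s
  proof -
    have "I t s = \<zeta> s * (indicator {..s} t *\<^sub>R k t)" for t by (auto simp: I_def)
    then show ?thesis unfolding set_lebesgue_integral_def by (simp only: integral_mult_right_zero)
  qed
  moreover have "(LINT s|lborel. I t s) = (LINT s:{t..}|lborel. \<zeta> s) * k t" for t
  proof -
    have "I t s = (indicator {t..} s *\<^sub>R \<zeta> s) * k t" for s by (auto simp: I_def)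
    then show ?thesis unfolding set_lebesgue_integral_def by (simp only: integral_mult_left_zero)
  qed
  ultimately show ?thesis by simp
qed

text \<open>For z > 0 the factor z is the length of (0,z), and Fubini exchanges the two
  integrations. It is applied to the difference of two solutions, to express u - v by tails, and to
  that difference multiplied by the sign of its tail.\<close>

lemma first_moment_eq_integral_tail:
  fixes \<mu> :: "real \<Rightarrow> real"
  assumes m: "\<mu> \<in> borel_measurable borel" and x\<mu>: "integrable lborel (\<lambda>x. x * \<mu> x)"
    and 0: "\<And>x. x \<le> 0 \<Longrightarrow> \<mu> x = 0"
  shows "integrable lborel (\<lambda>x. indicator {0<..} x * (LINT z:{x<..}|lborel. \<mu> z))"
    and "(LINT x|lborel. x * \<mu> x) = (LINT x|lborel. indicator {0<..} x * (LINT z:{x<..}|lborel. \<mu> z))"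
proof -
  note [measurable] = m
  define I where "I z x = (if 0 < x \<and> x < z then \<mu> z else 0)" for z x :: real
  have Iz: "I z x = indicator {0<..<z} x * \<mu> z" for z x by (auto simp: I_def)
  have mes: "(\<lambda>(z, x). I z x) \<in> borel_measurable (lborel \<Otimes>\<^sub>M lborel)" unfolding I_def by measurable
  have ind: "(LINT x|lborel. indicator {0<..<z} x * c) = z * c" if "z > 0" for z c :: real
    using that by simp
  have i1: "(LINT x|lborel. I z x) = z * \<mu> z" for z
    unfolding Iz using ind[of z "\<mu> z"] 0[of z] by (cases "z > 0") auto
  have i2: "(LINT x|lborel. norm (I z x)) = \<bar>z * \<mu> z\<bar>" for z
    using ind[of z "\<bar>\<mu> z\<bar>"] 0[of z] by (cases "z > 0") (auto simp: abs_mult Iz)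
  have i3: "integrable lborel (I z)" for z
    unfolding Iz by (cases "z > 0") (auto simp: integrable_real_indicator emeasure_lborel_Ioo)
  have Iint: "integrable (lborel \<Otimes>\<^sub>M lborel) (\<lambda>(z, x). I z x)"
    by (rule lborel_pair.Fubini_integrable[OF mes]) (use i2 i3 integrable_abs[OF x\<mu>] in auto)
  have i4: "(LINT z|lborel. I z x) = indicator {0<..} x * (LINT z:{x<..}|lborel. \<mu> z)" for x
  proof -
    have "I z x = indicator {0<..} x * (indicator {x<..} z *\<^sub>R \<mu> z)" for z by (auto simp: I_def)
    then show ?thesis unfolding set_lebesgue_integral_def by (simp only: integral_mult_right_zero)
  qed
  show "integrable lborel (\<lambda>x. indicator {0<..} x * (LINT z:{x<..}|lborel. \<mu> z))"
    using lborel_pair.integrable_snd[OF Iint] i4 by simp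
  show "(LINT x|lborel. x * \<mu> x) = (LINT x|lborel. indicator {0<..} x * (LINT z:{x<..}|lborel. \<mu> z))"
    using lborel_pair.Fubini_integral[OF Iint] i4 i1 by simp
qed

text \<open>Moving the variable half-line into a condition inside the integrand leaves a
  parametrized integral of a jointly measurable function.\<close>

lemma borel_measurable_partial_integrals:
  fixes d :: "real \<Rightarrow> real \<Rightarrow> real"
  assumes d: "(\<lambda>(t, x). d t x) \<in> borel_measurable (lborel \<Otimes>\<^sub>M lborel)"
  shows "(\<lambda>(t, x). LINT z:{..x}|lborel. d t z) \<in> borel_measurable (lborel \<Otimes>\<^sub>M lborel)"
    and "(\<lambda>(t, x). LINT z:{x<..}|lborel. d t z) \<in> borel_measurable (lborel \<Otimes>\<^sub>M lborel)"
    and "(\<lambda>(t, x). LINT s:{..t}|lborel. d s x) \<in> borel_measurable (lborel \<Otimes>\<^sub>M lborel)"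
proof -
  have [measurable]: "(\<lambda>(t, x). d t x) \<in> borel_measurable (borel \<Otimes>\<^sub>M borel)" using d by (simp cong: measurable_cong_sets)
  have 1: "(\<lambda>(t, x). LINT z:{..x}|lborel. d t z) = (\<lambda>(t, x). LINT z|lborel. (if z \<le> x then d t z else 0))"
    by (auto simp: set_lebesgue_integral_def fun_eq_iff intro!: Bochner_Integration.integral_cong)
  have 2: "(\<lambda>(t, x). LINT z:{x<..}|lborel. d t z) = (\<lambda>(t, x). LINT z|lborel. (if x < z then d t z else 0))"
    by (auto simp: set_lebesgue_integral_def fun_eq_iff intro!: Bochner_Integration.integral_cong)
  have 3: "(\<lambda>(t, x). LINT s:{..t}|lborel. d s x) = (\<lambda>(t, x). LINT s|lborel. (if s \<le> t then d s x else 0))"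
    by (auto simp: set_lebesgue_integral_def fun_eq_iff intro!: Bochner_Integration.integral_cong)
  show "(\<lambda>(t, x). LINT z:{..x}|lborel. d t z) \<in> borel_measurable (lborel \<Otimes>\<^sub>M lborel)" unfolding 1 by measurable
  show "(\<lambda>(t, x). LINT z:{x<..}|lborel. d t z) \<in> borel_measurable (lborel \<Otimes>\<^sub>M lborel)" unfolding 2 by measurable
  show "(\<lambda>(t, x). LINT s:{..t}|lborel. d s x) \<in> borel_measurable (lborel \<Otimes>\<^sub>M lborel)" unfolding 3 by measurable
qed

lemma abs_set_integral_le:
  fixes k :: "real \<Rightarrow> real"
  assumes "integrable lborel k" "A \<in> sets borel"
  shows "\<bar>LINT s:A|lborel. k s\<bar> \<le> (LINT s|lborel. \<bar>k s\<bar>)"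
proof -
  have "\<bar>LINT s:A|lborel. k s\<bar> \<le> (LINT s|lborel. \<bar>indicator A s *\<^sub>R k s\<bar>)"
    unfolding set_lebesgue_integral_def by (rule integral_abs_bound)
  also have "\<dots> \<le> (LINT s|lborel. \<bar>k s\<bar>)"
  proof (rule integral_mono)
    show "integrable lborel (\<lambda>s. \<bar>indicator A s *\<^sub>R k s\<bar>)"
      using assms by (intro integrable_abs integrable_mult_indicator) auto
  qed (use assms in \<open>auto split: split_indicator\<close>)
  finally show ?thesis .
qed

lemma set_integral_atMost_add_greaterThan:
  fixes k :: "real \<Rightarrow> real"
  assumes "integrable lborel k"
  shows "(LINT s|lborel. k s) = (LINT s:{..x}|lborel. k s) + (LINT s:{x<..}|lborel. k s)"
proof -
  have "set_integrable lborel A k" if "A \<in> sets borel" for A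
    using assms that by (simp add: set_integrable_def integrable_mult_indicator del: real_scaleR_def)
  moreover have "UNIV = {..x} \<union> {x<..}" by auto
  ultimately have "(LINT s:UNIV|lborel. k s) = (LINT s:{..x}|lborel. k s) + (LINT s:{x<..}|lborel. k s)"
    using set_integral_Un[of "{..x}" "{x<..}" lborel k] by fastforce
  then show ?thesis by (simp add: set_lebesgue_integral_def)
qed

section \<open>Approximation of indicators, and passage from almost every to every point\<close>

text \<open>A continuous trapezoid below the indicator of (p,q), converging to it as n grows. It is
  needed because the weak formulation admits only continuous \<open>\<zeta>\<close> and
  \<open>\<psi>\<close>, whereas vanishing is tested on boxes.\<close>

definition bump :: "nat \<Rightarrow> real \<Rightarrow> real \<Rightarrow> real \<Rightarrow> real" where
  "bump n p q t = max 0 (min 1 (real n * min (t - p) (q - t)))"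

lemma bump_continuous: "continuous_on UNIV (bump n p q)"
  unfolding bump_def by (intro continuous_intros)

lemma bump_bounds: "0 \<le> bump n p q t" "bump n p q t \<le> indicator {p<..<q} t"
proof -
  show "0 \<le> bump n p q t" by (simp add: bump_def)
  show "bump n p q t \<le> indicator {p<..<q} t"
  proof (cases "t \<in> {p<..<q}")
    case False
    then have "min (t - p) (q - t) \<le> 0" by auto
    then have "real n * min (t - p) (q - t) \<le> 0" by (simp add: mult_nonneg_nonpos)
    then show ?thesis using False by (simp add: bump_def)
  qed (simp add: bump_def)
qed

lemma bump_tendsto: "(\<lambda>n. bump n p q t) \<longlonglongrightarrow> indicator {p<..<q} t"
proof (cases "t \<in> {p<..<q}")
  case True
  define e where "e = min (t - p) (q - t)"
  have e: "e > 0" using True by (auto simp: e_def)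
  obtain N where N: "1 / e < real N" using reals_Archimedean2 by blast
  have "\<forall>\<^sub>F n in sequentially. bump n p q t = 1"
    using eventually_ge_at_top[of N]
  proof eventually_elim
    case (elim n)
    then have "1 / e \<le> real n" using N by linarith
    then have "real n * e \<ge> 1" using e by (simp add: field_simps)
    then show ?case by (simp add: bump_def e_def[symmetric])
  qed
  then show ?thesis using True by (simp add: tendsto_eventually)
next
  case False
  then have "bump n p q t = 0" for n using bump_bounds[of n p q t] by auto
  then show ?thesis using False by simp
qed

text \<open>The set where two continuous functions differ is open, so being null it is empty; the
  end points follow by closure. This upgrades identities known for almost every time to all times,
  including 0 and \<open>S\<close>.\<close>

lemma continuous_AE_eq_on_interval:
  fixes f g :: "real \<Rightarrow> real"
  assumes f: "continuous_on {a..b} f" and g: "continuous_on {a..b} g" and ab: "a < b"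
    and ae: "AE t in lborel. t \<in> {a<..<b} \<longrightarrow> f t = g t" and t: "t \<in> {a..b}"
  shows "f t = g t"
proof -
  \<comment> \<open>Clamping the argument to [a,b] extends the difference continuously to the whole
    line, so that \<open>U\<close> below is open.\<close>
  define F where "F s = f (max a (min b s)) - g (max a (min b s))" for s
  have cF: "continuous_on UNIV F" unfolding F_def
  proof (rule continuous_on_diff)
    have c: "continuous_on UNIV (\<lambda>s. max a (min b s))" by (intro continuous_intros)
    have r: "range (\<lambda>s. max a (min b s)) \<subseteq> {a..b}" using ab by auto
    show "continuous_on UNIV (\<lambda>s. f (max a (min b s)))" "continuous_on UNIV (\<lambda>s. g (max a (min b s)))"
      using continuous_on_compose2[OF f c r] continuous_on_compose2[OF g c r] by auto
  qed
  define U where "U = {s. F s \<noteq> 0} \<inter> {a<..<b}"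
  have oU: "open U" unfolding U_def
    by (intro open_Int open_Collect_neq cF continuous_on_const open_greaterThanLessThan)
  have "AE s in lborel. s \<notin> U" using ae
    by eventually_elim (use ab in \<open>auto simp: U_def F_def\<close>)
  then have "U \<in> null_sets lborel" using oU by (simp add: AE_iff_null_sets)
  then have "U = {}" using oU
    by (metis negligible_iff_null_sets open_not_negligible null_sets_completionI)
  then have z: "s \<in> {s. F s = 0}" if "s \<in> {a<..<b}" for s using that by (auto simp: U_def)
  have "closed {s. F s = 0}" by (intro closed_Collect_eq cF continuous_intros)
  then have "closure {a<..<b} \<subseteq> {s. F s = 0}" using z by (intro closure_minimal) auto
  then have "F t = 0" using t ab by auto
  then show ?thesis using t by (simp add: F_def)
qed

lemma not_integrable_indicator_Ioi: "\<not> integrable lborel (indicator {0::real<..} :: real \<Rightarrow> real)"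
proof
  assume "integrable lborel (indicator {0::real<..} :: real \<Rightarrow> real)"
  then have fin: "emeasure lborel {0::real<..} < \<infinity>" by (simp add: integrable_indicator_iff)
  have "ennreal (real n) \<le> emeasure lborel {0::real<..}" for n :: nat
  proof -
    have "emeasure lborel {0::real<..<real n} \<le> emeasure lborel {0::real<..}" by (rule emeasure_mono) auto
    then show ?thesis by (simp add: emeasure_lborel_Ioo)
  qed
  moreover obtain r where r: "emeasure lborel {0::real<..} = ennreal r" "r \<ge> 0"
    using fin by (cases "emeasure lborel {0::real<..}") auto
  ultimately have "real n \<le> r" for n :: nat by (metis ennreal_le_iff)
  then show False using reals_Archimedean2[of r] by (meson not_less)
qed

lemma integrable_bounded_interval:
  fixes f :: "real \<Rightarrow> real"
  assumes f: "f \<in> borel_measurable borel" "\<And>t. \<bar>f t\<bar> \<le> B * indicator {0<..<R} t"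
  shows "integrable lborel f"
proof (rule Bochner_Integration.integrable_bound)
  have "emeasure lborel {0..R} < \<infinity>" by (rule emeasure_lborel_cbox_finite[of 0 R, unfolded cbox_interval])
  then show "integrable lborel (\<lambda>t. \<bar>B\<bar> * indicator {0..R} t)"
    by (intro integrable_mult_right integrable_real_indicator) auto
  show "AE t in lborel. norm (f t) \<le> norm (\<bar>B\<bar> * indicator {0..R} t)"
  proof (rule AE_I2)
    fix t show "norm (f t) \<le> norm (\<bar>B\<bar> * indicator {0..R} t)"
      using f(2)[of t] by (cases "t \<in> {0<..<R}") auto
  qed
qed (use f in simp)

section \<open>The integrated equation for the tails of a weak solution\<close>

text \<open>In the application \<open>d\<close> is the difference of two solutions, \<open>g\<close>
  the difference of their fluxes and \<open>\<nu>\<close> that of their boundary rates; the common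
  initial datum has cancelled, so \<open>weak\<close> has no initial term. The test function is the
  product of the tail integrals of \<open>\<zeta>\<close> and \<open>\<psi>\<close>, so these two
  are minus the derivatives of its factors and may be merely continuous.\<close>

locale weak_difference =
  fixes S :: real and d g :: "real \<Rightarrow> real \<Rightarrow> real" and \<nu> :: "real \<Rightarrow> real"
  assumes S: "S > 0"
    and d_int: "integrable (lborel \<Otimes>\<^sub>M lborel) (\<lambda>(t, x). d t x)"
    and g_int: "integrable (lborel \<Otimes>\<^sub>M lborel) (\<lambda>(t, x). g t x)"
    and \<nu>_int: "integrable lborel \<nu>"
    and dt_int: "\<And>t. integrable lborel (d t)" "\<And>t. integrable lborel (\<lambda>x. x * d t x)"
    and d_supp: "\<And>t x. x \<le> 0 \<Longrightarrow> d t x = 0"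
    and tail_cont: "\<And>x. x > 0 \<Longrightarrow> continuous_on {0..S} (\<lambda>t. LINT z:{x<..}|lborel. d t z)"
    and weak: "\<And>\<zeta> \<psi> R. continuous_on UNIV \<zeta> \<Longrightarrow> continuous_on UNIV \<psi> \<Longrightarrow>
      (\<And>t. t \<notin> {0<..<S} \<Longrightarrow> \<zeta> t = 0) \<Longrightarrow> (\<And>x. x \<notin> {0<..<R} \<Longrightarrow> \<psi> x = 0) \<Longrightarrow>
      (LINT t|lborel. LINT x|lborel. \<zeta> t * (LINT z:{x..}|lborel. \<psi> z) * d t x
          + (LINT s:{t..}|lborel. \<zeta> s) * \<psi> x * g t x)
        = (LINT z:{0..}|lborel. \<psi> z) * (LINT t|lborel. (LINT s:{t..}|lborel. \<zeta> s) * \<nu> t)"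
begin

lemma meas[measurable]:
  "(\<lambda>(t, x). d t x) \<in> borel_measurable (borel \<Otimes>\<^sub>M borel)"
  "(\<lambda>(t, x). g t x) \<in> borel_measurable (borel \<Otimes>\<^sub>M borel)"
  "\<nu> \<in> borel_measurable borel"
  using d_int g_int \<nu>_int by (auto dest!: borel_measurable_integrable cong: measurable_cong_sets)

text \<open>\<open>Q\<close> is the density obtained from the weak formulation with test function \<open>\<theta>(t) \<phi>(x)\<close> after
  Fubini, where \<open>\<theta>\<close> and \<open>\<phi>\<close> are the tail integrals of \<open>\<zeta>\<close> and \<open>\<psi>\<close>.\<close>

definition "Q t x = (LINT z:{..x}|lborel. d t z) + (LINT s:{..t}|lborel. g s x) - (LINT s:{..t}|lborel. \<nu> s)"

lemma partial_meas[measurable]: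
  "(\<lambda>(t, x). LINT z:{..x}|lborel. d t z) \<in> borel_measurable (borel \<Otimes>\<^sub>M borel)"
  "(\<lambda>(t, x). LINT z:{x<..}|lborel. d t z) \<in> borel_measurable (borel \<Otimes>\<^sub>M borel)"
  "(\<lambda>(t, x). LINT s:{..t}|lborel. g s x) \<in> borel_measurable (borel \<Otimes>\<^sub>M borel)"
  "(\<lambda>t. LINT s:{..t}|lborel. \<nu> s) \<in> borel_measurable borel"
proof -
  have md: "(\<lambda>(t, x). d t x) \<in> borel_measurable (lborel \<Otimes>\<^sub>M lborel)"
    and mg: "(\<lambda>(t, x). g t x) \<in> borel_measurable (lborel \<Otimes>\<^sub>M lborel)"
    using d_int g_int by auto
  show "(\<lambda>(t, x). LINT z:{..x}|lborel. d t z) \<in> borel_measurable (borel \<Otimes>\<^sub>M borel)"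
    "(\<lambda>(t, x). LINT z:{x<..}|lborel. d t z) \<in> borel_measurable (borel \<Otimes>\<^sub>M borel)"
    "(\<lambda>(t, x). LINT s:{..t}|lborel. g s x) \<in> borel_measurable (borel \<Otimes>\<^sub>M borel)"
    using borel_measurable_partial_integrals[OF md] borel_measurable_partial_integrals[OF mg]
    by (simp_all cong: measurable_cong_sets)
  have "continuous_on UNIV (\<lambda>t. LINT s:{..t}|lborel. \<nu> s)"
    by (rule AC_continuous[OF \<nu>_int, of _ 0]) simp
  then show "(\<lambda>t. LINT s:{..t}|lborel. \<nu> s) \<in> borel_measurable borel"
    by (rule borel_measurable_continuous_onI)
qed

lemma Q_meas[measurable]: "(\<lambda>(t, x). Q t x) \<in> borel_measurable (borel \<Otimes>\<^sub>M borel)"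
  unfolding Q_def by measurable

text \<open>Each part of \<open>Q\<close> is dominated by a tensor product. The first is bounded in
  x by the mass of \<open>d t\<close>, the second in t by the time integral of the absolute flux at
  x, the third by a constant. The compactly supported factors provide integrability in the remaining
  variables.\<close>

lemma local_bounds:
  fixes \<zeta> \<psi> :: "real \<Rightarrow> real"
  assumes \<zeta>: "\<zeta> \<in> borel_measurable borel" "\<And>t. \<bar>\<zeta> t\<bar> \<le> B * indicator {0<..<S} t"
    and \<psi>: "\<psi> \<in> borel_measurable borel" "\<And>x. \<bar>\<psi> x\<bar> \<le> B' * indicator {0<..<R} x"
  shows "integrable (lborel \<Otimes>\<^sub>M lborel) (\<lambda>(t, x). \<zeta> t * \<psi> x * (LINT z:{..x}|lborel. d t z))"
    "integrable (lborel \<Otimes>\<^sub>M lborel) (\<lambda>(t, x). \<zeta> t * \<psi> x * (LINT s:{..t}|lborel. g s x))"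
    "integrable (lborel \<Otimes>\<^sub>M lborel) (\<lambda>(t, x). \<zeta> t * \<psi> x * (LINT s:{..t}|lborel. \<nu> s))"
proof -
  note [measurable] = \<zeta>(1) \<psi>(1)
  have i\<zeta>: "integrable lborel (\<lambda>t. \<bar>\<zeta> t\<bar>)" and i\<psi>: "integrable lborel (\<lambda>x. \<bar>\<psi> x\<bar>)"
    using integrable_bounded_interval[OF \<zeta>] integrable_bounded_interval[OF \<psi>] by auto
  have B\<zeta>: "\<bar>\<zeta> t\<bar> \<le> \<bar>B\<bar>" for t using \<zeta>(2)[of t] by (auto split: split_indicator_asm)
  have B\<psi>: "\<bar>\<psi> x\<bar> \<le> \<bar>B'\<bar>" for x using \<psi>(2)[of x] by (auto split: split_indicator_asm)
  have \<delta>: "integrable lborel (\<lambda>t. LINT z|lborel. \<bar>d t z\<bar>)"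
    using lborel_pair.integrable_fst[of "\<lambda>t z. \<bar>d t z\<bar>"] integrable_abs[OF d_int] by (simp add: case_prod_unfold)
  have abs_g: "integrable (lborel \<Otimes>\<^sub>M lborel) (\<lambda>(t, x). \<bar>g t x\<bar>)"
    using integrable_abs[OF g_int] by (simp add: case_prod_unfold)
  have \<gamma>: "integrable lborel (\<lambda>x. LINT s|lborel. \<bar>g s x\<bar>)"
    using lborel_pair.integrable_snd[OF abs_g] by simp
  show "integrable (lborel \<Otimes>\<^sub>M lborel) (\<lambda>(t, x). \<zeta> t * \<psi> x * (LINT z:{..x}|lborel. d t z))"
  proof (rule Bochner_Integration.integrable_bound[OF integrable_tensor[OF integrable_mult_right[OF \<delta>, of "\<bar>B\<bar>"] i\<psi>]])
    show "AE p in lborel \<Otimes>\<^sub>M lborel. norm (case p of (t, x) \<Rightarrow> \<zeta> t * \<psi> x * (LINT z:{..x}|lborel. d t z))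
        \<le> norm (case p of (t, x) \<Rightarrow> \<bar>B\<bar> * (LINT z|lborel. \<bar>d t z\<bar>) * \<bar>\<psi> x\<bar>)"
    proof (rule AE_I2, clarify)
      fix t x
      have "\<bar>\<zeta> t\<bar> * \<bar>\<psi> x\<bar> * \<bar>LINT z:{..x}|lborel. d t z\<bar> \<le> \<bar>B\<bar> * \<bar>\<psi> x\<bar> * (LINT z|lborel. \<bar>d t z\<bar>)"
        by (intro mult_mono B\<zeta> order_refl abs_set_integral_le dt_int) auto
      then show "norm (\<zeta> t * \<psi> x * (LINT z:{..x}|lborel. d t z)) \<le> norm (\<bar>B\<bar> * (LINT z|lborel. \<bar>d t z\<bar>) * \<bar>\<psi> x\<bar>)"
        by (simp add: abs_mult mult.commute mult.left_commute)
    qed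
  qed measurable
  have "AE x in lborel. integrable lborel (\<lambda>t. g t x)"
    using lborel_pair.AE_integrable_snd[OF g_int] .
  \<comment> \<open>The time section of \<open>g\<close> at x is integrable only for almost every x,
    so this bound has to be carried from iterated to product null sets.\<close>
  then have ae: "AE p in lborel \<Otimes>\<^sub>M lborel. \<bar>LINT s:{..fst p}|lborel. g s (snd p)\<bar> \<le> (LINT s|lborel. \<bar>g s (snd p)\<bar>)"
  proof -
    assume "AE x in lborel. integrable lborel (\<lambda>t. g t x)"
    then have "AE x in lborel. AE t in lborel. \<bar>LINT s:{..t}|lborel. g s x\<bar> \<le> (LINT s|lborel. \<bar>g s x\<bar>)"
      by eventually_elim (intro AE_I2 abs_set_integral_le, auto)
    moreover have P: "{p\<in>space (lborel \<Otimes>\<^sub>M lborel). \<bar>LINT s:{..fst p}|lborel. g s (snd p)\<bar> \<le> (LINT s|lborel. \<bar>g s (snd p)\<bar>)}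
        \<in> sets (lborel \<Otimes>\<^sub>M lborel)"
      by measurable
    ultimately show ?thesis
      using lborel_pair.AE_commute[OF P] lborel_pair.AE_pair_iff[OF P] by simp
  qed
  show "integrable (lborel \<Otimes>\<^sub>M lborel) (\<lambda>(t, x). \<zeta> t * \<psi> x * (LINT s:{..t}|lborel. g s x))"
  proof (rule Bochner_Integration.integrable_bound[OF integrable_tensor[OF i\<zeta> integrable_mult_right[OF \<gamma>, of "\<bar>B'\<bar>"]]])
    show "AE p in lborel \<Otimes>\<^sub>M lborel. norm (case p of (t, x) \<Rightarrow> \<zeta> t * \<psi> x * (LINT s:{..t}|lborel. g s x))
        \<le> norm (case p of (t, x) \<Rightarrow> \<bar>\<zeta> t\<bar> * (\<bar>B'\<bar> * (LINT s|lborel. \<bar>g s x\<bar>)))"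
      using ae
    proof (eventually_elim, clarify)
      fix t x
      assume "\<bar>LINT s:{..fst (t, x)}|lborel. g s (snd (t, x))\<bar> \<le> (LINT s|lborel. \<bar>g s (snd (t, x))\<bar>)"
      then have "\<bar>\<zeta> t\<bar> * \<bar>\<psi> x\<bar> * \<bar>LINT s:{..t}|lborel. g s x\<bar> \<le> \<bar>\<zeta> t\<bar> * \<bar>B'\<bar> * (LINT s|lborel. \<bar>g s x\<bar>)"
        by (intro mult_mono B\<psi> order_refl) auto
      then show "norm (\<zeta> t * \<psi> x * (LINT s:{..t}|lborel. g s x)) \<le> norm (\<bar>\<zeta> t\<bar> * (\<bar>B'\<bar> * (LINT s|lborel. \<bar>g s x\<bar>)))"
        by (simp add: abs_mult mult.assoc)
    qed
  qed measurable
  show "integrable (lborel \<Otimes>\<^sub>M lborel) (\<lambda>(t, x). \<zeta> t * \<psi> x * (LINT s:{..t}|lborel. \<nu> s))"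
  proof (rule Bochner_Integration.integrable_bound[OF integrable_tensor[OF integrable_mult_right[OF i\<zeta>, of "LINT s|lborel. \<bar>\<nu> s\<bar>"] i\<psi>]])
    show "AE p in lborel \<Otimes>\<^sub>M lborel. norm (case p of (t, x) \<Rightarrow> \<zeta> t * \<psi> x * (LINT s:{..t}|lborel. \<nu> s))
        \<le> norm (case p of (t, x) \<Rightarrow> (LINT s|lborel. \<bar>\<nu> s\<bar>) * \<bar>\<zeta> t\<bar> * \<bar>\<psi> x\<bar>)"
    proof (rule AE_I2, clarify)
      fix t x
      have "\<bar>\<zeta> t\<bar> * \<bar>\<psi> x\<bar> * \<bar>LINT s:{..t}|lborel. \<nu> s\<bar> \<le> \<bar>\<zeta> t\<bar> * \<bar>\<psi> x\<bar> * (LINT s|lborel. \<bar>\<nu> s\<bar>)"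
        by (intro mult_mono order_refl abs_set_integral_le \<nu>_int) auto
      then show "norm (\<zeta> t * \<psi> x * (LINT s:{..t}|lborel. \<nu> s)) \<le> norm ((LINT s|lborel. \<bar>\<nu> s\<bar>) * \<bar>\<zeta> t\<bar> * \<bar>\<psi> x\<bar>)"
        by (simp add: abs_mult mult.commute mult.left_commute)
    qed
  qed measurable
qed

text \<open>Fubini is applied to each term of \<open>weak\<close> separately: in x it trades the
  tail of \<open>\<psi>\<close> for a primitive of \<open>d t\<close>, in t it trades the tail of
  \<open>\<zeta>\<close> for primitives of \<open>g\<close> and \<open>\<nu>\<close>. All three
  terms then carry the same factor \<open>\<zeta> t * \<psi> x\<close>.\<close>

lemma tested_Q:
  assumes \<zeta>: "continuous_on UNIV \<zeta>" "\<And>t. \<bar>\<zeta> t\<bar> \<le> B * indicator {0<..<S} t"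
    and \<psi>: "continuous_on UNIV \<psi>" "\<And>x. \<bar>\<psi> x\<bar> \<le> B' * indicator {0<..<R} x"
  shows "integral\<^sup>L (lborel \<Otimes>\<^sub>M lborel) (\<lambda>(t, x). \<zeta> t * \<psi> x * Q t x) = 0"
proof -
  have [measurable]: "\<zeta> \<in> borel_measurable borel" "\<psi> \<in> borel_measurable borel"
    using \<zeta>(1) \<psi>(1) by (auto intro: borel_measurable_continuous_onI)
  note L = local_bounds[OF _ \<zeta>(2) _ \<psi>(2), simplified]
  have z: "\<zeta> t = 0" if "t \<notin> {0<..<S}" for t using \<zeta>(2)[of t] that by simp
  have p: "\<psi> x = 0" if "x \<notin> {0<..<R}" for x using \<psi>(2)[of x] that by simp
  have i\<zeta>: "integrable lborel \<zeta>" and i\<psi>: "integrable lborel \<psi>"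
    using integrable_bounded_interval[OF _ \<zeta>(2)] integrable_bounded_interval[OF _ \<psi>(2)] by auto
  define \<theta> where "\<theta> t = (LINT s:{t..}|lborel. \<zeta> s)" for t
  define \<phi> where "\<phi> x = (LINT z:{x..}|lborel. \<psi> z)" for x
  have "\<theta> = (\<lambda>t. LINT s|lborel. (if t \<le> s then \<zeta> s else 0))" "\<phi> = (\<lambda>t. LINT s|lborel. (if t \<le> s then \<psi> s else 0))"
    by (auto simp: \<theta>_def \<phi>_def set_lebesgue_integral_def fun_eq_iff intro!: Bochner_Integration.integral_cong)
  then have [measurable]: "\<theta> \<in> borel_measurable borel" "\<phi> \<in> borel_measurable borel" by simp_all
  have \<theta>b: "\<bar>\<theta> t\<bar> \<le> (LINT s|lborel. \<bar>\<zeta> s\<bar>)" for t unfolding \<theta>_def by (intro abs_set_integral_le i\<zeta>) auto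
  have \<phi>b: "\<bar>\<phi> t\<bar> \<le> (LINT s|lborel. \<bar>\<psi> s\<bar>)" for t unfolding \<phi>_def by (intro abs_set_integral_le i\<psi>) auto
  have \<zeta>b: "\<bar>\<zeta> t\<bar> \<le> \<bar>B\<bar>" for t using \<zeta>(2)[of t] by (auto split: split_indicator_asm)
  have \<psi>b: "\<bar>\<psi> x\<bar> \<le> \<bar>B'\<bar>" for x using \<psi>(2)[of x] by (auto split: split_indicator_asm)
  have A: "integrable (lborel \<Otimes>\<^sub>M lborel) (\<lambda>(t, x). \<zeta> t * \<phi> x * d t x)"
  proof (rule Bochner_Integration.integrable_bound[OF integrable_mult_right[OF integrable_abs[OF d_int], of "\<bar>B\<bar> * (LINT s|lborel. \<bar>\<psi> s\<bar>)"]])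
    show "AE p in lborel \<Otimes>\<^sub>M lborel. norm (case p of (t, x) \<Rightarrow> \<zeta> t * \<phi> x * d t x)
        \<le> norm (\<bar>B\<bar> * (LINT s|lborel. \<bar>\<psi> s\<bar>) * \<bar>case p of (t, x) \<Rightarrow> d t x\<bar>)"
      by (rule AE_I2) (auto simp: abs_mult intro!: mult_mono \<zeta>b \<phi>b)
  qed measurable
  have G: "integrable (lborel \<Otimes>\<^sub>M lborel) (\<lambda>(t, x). \<theta> t * \<psi> x * g t x)"
  proof (rule Bochner_Integration.integrable_bound[OF integrable_mult_right[OF integrable_abs[OF g_int], of "(LINT s|lborel. \<bar>\<zeta> s\<bar>) * \<bar>B'\<bar>"]])
    show "AE p in lborel \<Otimes>\<^sub>M lborel. norm (case p of (t, x) \<Rightarrow> \<theta> t * \<psi> x * g t x)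
        \<le> norm ((LINT s|lborel. \<bar>\<zeta> s\<bar>) * \<bar>B'\<bar> * \<bar>case p of (t, x) \<Rightarrow> g t x\<bar>)"
      by (rule AE_I2) (auto simp: abs_mult intro!: mult_mono \<theta>b \<psi>b)
  qed measurable
  have "integral\<^sup>L (lborel \<Otimes>\<^sub>M lborel) (\<lambda>(t, x). \<zeta> t * \<phi> x * d t x) = (LINT t|lborel. LINT x|lborel. \<zeta> t * \<phi> x * d t x)"
    using lborel_pair.integral_fst[OF A] by simp
  also have "\<dots> = (LINT t|lborel. LINT x|lborel. \<zeta> t * \<psi> x * (LINT z:{..x}|lborel. d t z))"
    unfolding mult.assoc integral_mult_right_zero \<phi>_def integral_tail_mult[OF i\<psi> dt_int(1)] ..
  also have "\<dots> = integral\<^sup>L (lborel \<Otimes>\<^sub>M lborel) (\<lambda>(t, x). \<zeta> t * \<psi> x * (LINT z:{..x}|lborel. d t z))"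
    using lborel_pair.integral_fst[OF L(1)] by simp
  finally have e1: "integral\<^sup>L (lborel \<Otimes>\<^sub>M lborel) (\<lambda>(t, x). \<zeta> t * \<phi> x * d t x) = \<dots>" .
  have "integral\<^sup>L (lborel \<Otimes>\<^sub>M lborel) (\<lambda>(t, x). \<theta> t * \<psi> x * g t x) = (LINT x|lborel. LINT t|lborel. \<theta> t * \<psi> x * g t x)"
    using lborel_pair.integral_snd[OF G] by simp
  also have "\<dots> = (LINT x|lborel. LINT t|lborel. \<zeta> t * \<psi> x * (LINT s:{..t}|lborel. g s x))"
  proof (rule integral_cong_AE)
    show "(\<lambda>x. LINT t|lborel. \<theta> t * \<psi> x * g t x) \<in> borel_measurable lborel"
      using lborel_pair.integrable_snd[OF G] by auto
    show "(\<lambda>x. LINT t|lborel. \<zeta> t * \<psi> x * (LINT s:{..t}|lborel. g s x)) \<in> borel_measurable lborel"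
      using lborel_pair.integrable_snd[OF L(2)] by auto
    show "AE x in lborel. (LINT t|lborel. \<theta> t * \<psi> x * g t x) = (LINT t|lborel. \<zeta> t * \<psi> x * (LINT s:{..t}|lborel. g s x))"
      using lborel_pair.AE_integrable_snd[OF g_int]
    proof eventually_elim
      case (elim x)
      have "(LINT t|lborel. \<theta> t * \<psi> x * g t x) = \<psi> x * (LINT t|lborel. \<theta> t * g t x)"
        by (subst integral_mult_right_zero[symmetric]) (simp add: mult.assoc mult.left_commute)
      also have "\<dots> = \<psi> x * (LINT t|lborel. \<zeta> t * (LINT s:{..t}|lborel. g s x))"
        unfolding \<theta>_def integral_tail_mult[OF i\<zeta> elim] ..
      also have "\<dots> = (LINT t|lborel. \<zeta> t * \<psi> x * (LINT s:{..t}|lborel. g s x))"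
        by (subst integral_mult_right_zero[symmetric]) (simp add: mult.assoc mult.left_commute)
      finally show ?case .
    qed
  qed
  also have "\<dots> = integral\<^sup>L (lborel \<Otimes>\<^sub>M lborel) (\<lambda>(t, x). \<zeta> t * \<psi> x * (LINT s:{..t}|lborel. g s x))"
    using lborel_pair.integral_snd[OF L(2)] by simp
  finally have e2: "integral\<^sup>L (lborel \<Otimes>\<^sub>M lborel) (\<lambda>(t, x). \<theta> t * \<psi> x * g t x) = \<dots>" .
  \<comment> \<open>Since \<open>\<psi>\<close> vanishes for x <= 0, the boundary value of the test
    function is the full integral of \<open>\<psi>\<close>, which brings the boundary term into
    product form.\<close>
  have "\<phi> 0 = (LINT x|lborel. \<psi> x)"
    unfolding \<phi>_def set_lebesgue_integral_def
    by (rule Bochner_Integration.integral_cong) (use p in \<open>auto split: split_indicator\<close>)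
  moreover have "(LINT t|lborel. \<theta> t * \<nu> t) = (LINT t|lborel. \<zeta> t * (LINT s:{..t}|lborel. \<nu> s))"
    unfolding \<theta>_def by (rule integral_tail_mult[OF i\<zeta> \<nu>_int])
  moreover have e: "(LINT x|lborel. \<zeta> t * \<psi> x * (LINT s:{..t}|lborel. \<nu> s)) = (LINT x|lborel. \<psi> x) * (\<zeta> t * (LINT s:{..t}|lborel. \<nu> s))" for t
    by (subst integral_mult_left_zero[symmetric]) (simp add: mult.assoc mult.left_commute)
  ultimately have "\<phi> 0 * (LINT t|lborel. \<theta> t * \<nu> t) = (LINT t|lborel. LINT x|lborel. \<zeta> t * \<psi> x * (LINT s:{..t}|lborel. \<nu> s))"
    unfolding e integral_mult_right_zero by simp
  also have "\<dots> = integral\<^sup>L (lborel \<Otimes>\<^sub>M lborel) (\<lambda>(t, x). \<zeta> t * \<psi> x * (LINT s:{..t}|lborel. \<nu> s))"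
    using lborel_pair.integral_fst[OF L(3)] by simp
  finally have e3: "\<phi> 0 * (LINT t|lborel. \<theta> t * \<nu> t) = \<dots>" .
  have AG: "integrable (lborel \<Otimes>\<^sub>M lborel) (\<lambda>(t, x). \<zeta> t * \<phi> x * d t x + \<theta> t * \<psi> x * g t x)"
    using Bochner_Integration.integrable_add[OF A G] by (simp add: case_prod_unfold)
  have "(LINT t|lborel. LINT x|lborel. \<zeta> t * \<phi> x * d t x + \<theta> t * \<psi> x * g t x) =
      integral\<^sup>L (lborel \<Otimes>\<^sub>M lborel) (\<lambda>(t, x). \<zeta> t * \<phi> x * d t x + \<theta> t * \<psi> x * g t x)"
    using lborel_pair.integral_fst[OF AG] by simp
  also have "\<dots> = integral\<^sup>L (lborel \<Otimes>\<^sub>M lborel) (\<lambda>(t, x). \<zeta> t * \<phi> x * d t x)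
     + integral\<^sup>L (lborel \<Otimes>\<^sub>M lborel) (\<lambda>(t, x). \<theta> t * \<psi> x * g t x)"
    using Bochner_Integration.integral_add[OF A G] by (simp add: case_prod_unfold)
  also have "(LINT t|lborel. LINT x|lborel. \<zeta> t * \<phi> x * d t x + \<theta> t * \<psi> x * g t x) = \<phi> 0 * (LINT t|lborel. \<theta> t * \<nu> t)"
    unfolding \<theta>_def \<phi>_def by (rule weak[OF \<zeta>(1) \<psi>(1) z p])
  finally have "integral\<^sup>L (lborel \<Otimes>\<^sub>M lborel) (\<lambda>(t, x). \<zeta> t * \<psi> x * (LINT z:{..x}|lborel. d t z))
     + integral\<^sup>L (lborel \<Otimes>\<^sub>M lborel) (\<lambda>(t, x). \<zeta> t * \<psi> x * (LINT s:{..t}|lborel. g s x))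
     - integral\<^sup>L (lborel \<Otimes>\<^sub>M lborel) (\<lambda>(t, x). \<zeta> t * \<psi> x * (LINT s:{..t}|lborel. \<nu> s)) = 0"
    unfolding e1 e2 e3 by simp
  then have "(LINT p|(lborel \<Otimes>\<^sub>M lborel). (case p of (t, x) \<Rightarrow> \<zeta> t * \<psi> x * (LINT z:{..x}|lborel. d t z))
     + (case p of (t, x) \<Rightarrow> \<zeta> t * \<psi> x * (LINT s:{..t}|lborel. g s x))
     - (case p of (t, x) \<Rightarrow> \<zeta> t * \<psi> x * (LINT s:{..t}|lborel. \<nu> s))) = 0"
    using L by simp
  then show ?thesis
    by (simp add: Q_def algebra_simps case_prod_unfold)
qed

text \<open>Products of bumps converge to indicators of boxes, so all box integrals of
  \<open>Q\<close> in the strip vanish. The cut at x < \<open>N\<close> is made because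
  \<open>Q\<close> has been shown integrable only on bounded sets of x.\<close>

lemma Q_AE_zero: "AE t in lborel. AE x in lborel. t \<in> {0<..<S} \<longrightarrow> x > 0 \<longrightarrow> Q t x = 0"
proof -
  have "AE p in lborel \<Otimes>\<^sub>M lborel. indicator {0<..<S} (fst p) * indicator {0<..<real N} (snd p) * Q (fst p) (snd p) = 0" for N
  proof -
    let ?Qc = "\<lambda>p. indicator {0<..<S} (fst p) * indicator {0<..<real N} (snd p) * Q (fst p) (snd p)"
    have int: "integrable (lborel \<Otimes>\<^sub>M lborel) (\<lambda>(t, x). indicator {p<..<q} t * indicator {p'<..<q'} x * Q t x)"
      if "p \<ge> 0" "q \<le> S" "p' \<ge> 0" "q' \<le> real N" for p q p' q'
    proof -
      have 1: "\<bar>indicator {p<..<q} t\<bar> \<le> 1 * (indicator {0<..<S} t :: real)" for t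
        using that by (auto split: split_indicator)
      have 2: "\<bar>indicator {p'<..<q'} t\<bar> \<le> 1 * (indicator {0<..<real N} t :: real)" for t
        using that by (auto split: split_indicator)
      have L: "integrable (lborel \<Otimes>\<^sub>M lborel) (\<lambda>(t, x). indicator {p<..<q} t * indicator {p'<..<q'} x * (LINT z:{..x}|lborel. d t z))"
        "integrable (lborel \<Otimes>\<^sub>M lborel) (\<lambda>(t, x). indicator {p<..<q} t * indicator {p'<..<q'} x * (LINT s:{..t}|lborel. g s x))"
        "integrable (lborel \<Otimes>\<^sub>M lborel) (\<lambda>(t, x). indicator {p<..<q} t * indicator {p'<..<q'} x * (LINT s:{..t}|lborel. \<nu> s))"
        by (rule local_bounds[OF _ 1 _ 2]; simp)+
      show ?thesis
        using Bochner_Integration.integrable_diff[OF Bochner_Integration.integrable_add[OF L(1,2)] L(3)]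
        by (simp add: Q_def case_prod_unfold algebra_simps)
    qed
    have "AE p in lborel. ?Qc p = 0"
    proof (rule AE_zero_if_box_integrals_zero)
      show "integrable lborel ?Qc"
        unfolding lborel_prod[symmetric] using int[of 0 S 0 "real N"] by (simp add: case_prod_unfold)
      fix a b :: "real \<times> real"
      define p q p' q' where "p = max (fst a) 0" and "q = min (fst b) S"
        and "p' = max (snd a) 0" and "q' = min (snd b) (real N)"
      have bd: "p \<ge> 0" "q \<le> S" "p' \<ge> 0" "q' \<le> real N" by (auto simp: p_def q_def p'_def q'_def)
      note [measurable] = borel_measurable_continuous_onI[OF bump_continuous]
      have "box a b = {fst a<..<fst b} \<times> {snd a<..<snd b}"
        by (auto simp: mem_box Basis_prod_def inner_prod_def)
      then have eq: "indicator (box a b) (t, x) *\<^sub>R ?Qc (t, x) = indicator {p<..<q} t * indicator {p'<..<q'} x * Q t x" for t x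
        by (auto simp: p_def q_def p'_def q'_def split: split_indicator)
      have "(LINT p:box a b|lborel. ?Qc p) = integral\<^sup>L (lborel \<Otimes>\<^sub>M lborel) (\<lambda>(t, x). indicator {p<..<q} t * indicator {p'<..<q'} x * Q t x)"
        unfolding set_lebesgue_integral_def lborel_prod[symmetric]
        by (rule Bochner_Integration.integral_cong) (use eq in auto)
      moreover have "(\<lambda>n. integral\<^sup>L (lborel \<Otimes>\<^sub>M lborel) (\<lambda>(t, x). bump n p q t * bump n p' q' x * Q t x))
        \<longlonglongrightarrow> integral\<^sup>L (lborel \<Otimes>\<^sub>M lborel) (\<lambda>(t, x). indicator {p<..<q} t * indicator {p'<..<q'} x * Q t x)"
      proof (rule integral_dominated_convergence[OF _ _ integrable_norm[OF int[OF bd]]])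
        show "AE z in lborel \<Otimes>\<^sub>M lborel. (\<lambda>n. case z of (t, x) \<Rightarrow> bump n p q t * bump n p' q' x * Q t x)
          \<longlonglongrightarrow> (case z of (t, x) \<Rightarrow> indicator {p<..<q} t * indicator {p'<..<q'} x * Q t x)"
          by (auto intro!: AE_I2 tendsto_intros bump_tendsto)
        show "AE z in lborel \<Otimes>\<^sub>M lborel. norm (case z of (t, x) \<Rightarrow> bump n p q t * bump n p' q' x * Q t x)
          \<le> norm (case z of (t, x) \<Rightarrow> indicator {p<..<q} t * indicator {p'<..<q'} x * Q t x)" for n
        proof (rule AE_I2, clarify)
          fix t x
          have "bump n p q t * bump n p' q' x * \<bar>Q t x\<bar> \<le> indicator {p<..<q} t * indicator {p'<..<q'} x * \<bar>Q t x\<bar>"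
            by (intro mult_mono bump_bounds) (auto intro: bump_bounds)
          then show "norm (bump n p q t * bump n p' q' x * Q t x) \<le> norm (indicator {p<..<q} t * indicator {p'<..<q'} x * Q t x)"
            using bump_bounds(1)[of n p q t] bump_bounds(1)[of n p' q' x] by (simp add: abs_mult)
        qed
      qed measurable
      moreover have "integral\<^sup>L (lborel \<Otimes>\<^sub>M lborel) (\<lambda>(t, x). bump n p q t * bump n p' q' x * Q t x) = 0" for n
      proof (rule tested_Q[of _ 1 _ 1 "real N"])
        show "\<bar>bump n p q t\<bar> \<le> 1 * indicator {0<..<S} t" for t
          using bump_bounds[of n p q t] bd by (auto split: split_indicator split_indicator_asm)
        show "\<bar>bump n p' q' t\<bar> \<le> 1 * indicator {0<..<real N} t" for t
          using bump_bounds[of n p' q' t] bd by (auto split: split_indicator split_indicator_asm)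
      qed (rule bump_continuous)+
      ultimately show "(LINT p:box a b|lborel. ?Qc p) = 0"
        by (simp add: LIMSEQ_const_iff)
    qed
    then show ?thesis unfolding lborel_prod .
  qed
  then have "AE p in lborel \<Otimes>\<^sub>M lborel. \<forall>N::nat. indicator {0<..<S} (fst p) * indicator {0<..<real N} (snd p) * Q (fst p) (snd p) = 0"
    unfolding AE_all_countable by blast
  from lborel_pair.AE_pair[OF this]
  have "AE t in lborel. AE x in lborel. \<forall>N::nat. indicator {0<..<S} t * indicator {0<..<real N} x * Q t x = 0"
    by (simp only: fst_conv snd_conv)
  then show ?thesis
  proof (eventually_elim)
    case (elim t)
    then show ?case
    proof eventually_elim
      case (elim x)
      obtain N :: nat where "x < real N" using reals_Archimedean2 by blast
      then show ?case using elim[rule_format, of N] by auto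
    qed
  qed
qed

text \<open>For fixed \<open>t\<close>, the identity \<open>Q t = 0\<close> exhibits the difference of the two sides of the boundary
  identity as a constant that is integrable over a half-line.\<close>

lemma AE_boundary_and_tail:
  "AE t in lborel. t \<in> {0<..<S} \<longrightarrow> (LINT x|lborel. d t x) = (LINT s:{..t}|lborel. \<nu> s) \<and>
     (AE x in lborel. x > 0 \<longrightarrow> (LINT z:{x<..}|lborel. d t z) = (LINT s:{..t}|lborel. g s x))"
  using Q_AE_zero
proof eventually_elim
  case (elim t)
  show ?case
  proof
    assume t: "t \<in> {0<..<S}"
    define c where "c = (LINT x|lborel. d t x) - (LINT s:{..t}|lborel. \<nu> s)"
    have abs_g: "integrable (lborel \<Otimes>\<^sub>M lborel) (\<lambda>(t, x). \<bar>g t x\<bar>)"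
      using integrable_abs[OF g_int] by (simp add: case_prod_unfold)
    \<comment> \<open>The tail is integrable in x because \<open>d t\<close> has a finite first
      moment, and the time-integrated flux below because \<open>g\<close> is integrable on the
      plane.\<close>
    have G: "integrable lborel (\<lambda>x. indicator {0<..} x * (LINT z:{x<..}|lborel. d t z))"
      by (rule first_moment_eq_integral_tail) (use dt_int d_supp in auto)
    have H: "integrable lborel (\<lambda>x. LINT s:{..t}|lborel. g s x)"
    proof (rule Bochner_Integration.integrable_bound[OF lborel_pair.integrable_snd[OF abs_g]])
      show "AE x in lborel. norm (LINT s:{..t}|lborel. g s x) \<le> norm (LINT s|lborel. \<bar>g s x\<bar>)"
        using lborel_pair.AE_integrable_snd[OF g_int]
        by eventually_elim (auto intro!: order_trans[OF abs_set_integral_le])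
    qed measurable
    \<comment> \<open>In \<open>Q t x = 0\<close> the integral over \<open>{..x}\<close> is replaced
      by total mass minus tail.\<close>
    have c: "AE x in lborel. indicator {0<..} x * c = indicator {0<..} x * (LINT z:{x<..}|lborel. d t z)
        - indicator {0<..} x * (LINT s:{..t}|lborel. g s x)"
      using elim
    proof eventually_elim
      case (elim x)
      then show ?case
        using t set_integral_atMost_add_greaterThan[OF dt_int(1), of t x]
        by (auto simp: Q_def c_def split: split_indicator)
    qed
    have "integrable lborel (\<lambda>x::real. indicator {0<..} x * c)"
    proof -
      have "integrable lborel (\<lambda>x. indicator {0<..} x * (LINT s:{..t}|lborel. g s x))"
        using integrable_mult_indicator[OF _ H, of "{0<..}"] by simp
      from Bochner_Integration.integrable_diff[OF G this] show ?thesis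
        by (rule Bochner_Integration.integrable_cong_AE_imp) (measurable, use c in eventually_elim, simp)
    qed
    then have "c = 0"
      using not_integrable_indicator_Ioi by (cases "c = 0") auto
    moreover have "AE x in lborel. x > 0 \<longrightarrow> (LINT z:{x<..}|lborel. d t z) = (LINT s:{..t}|lborel. g s x)"
      using c by eventually_elim (use \<open>c = 0\<close> in auto)
    ultimately show "(LINT x|lborel. d t x) = (LINT s:{..t}|lborel. \<nu> s) \<and>
     (AE x in lborel. x > 0 \<longrightarrow> (LINT z:{x<..}|lborel. d t z) = (LINT s:{..t}|lborel. g s x))"
      by (simp add: c_def)
  qed
qed

lemma AE_boundary: "AE t in lborel. t \<in> {0<..<S} \<longrightarrow> (LINT x|lborel. d t x) = (LINT s:{..t}|lborel. \<nu> s)"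
  using AE_boundary_and_tail by eventually_elim auto

text \<open>Exchanging the null sets gives, for almost every x, the identity at almost every time;
  both sides are continuous in t, which extends it to all of [0,S]. One null set of x thus serves
  all times, and for the other x the tail is absolutely continuous in time.\<close>

lemma AE_tail:
  "AE x in lborel. x > 0 \<longrightarrow> integrable lborel (\<lambda>t. g t x) \<and>
     (\<forall>t\<in>{0..S}. (LINT z:{x<..}|lborel. d t z) = (LINT s:{..t}|lborel. g s x))"
proof -
  have P: "{p\<in>space (lborel \<Otimes>\<^sub>M lborel). fst p \<in> {0<..<S} \<longrightarrow> snd p > 0 \<longrightarrow>
      (LINT z:{snd p<..}|lborel. d (fst p) z) = (LINT s:{..fst p}|lborel. g s (snd p))} \<in> sets (lborel \<Otimes>\<^sub>M lborel)"
    by measurable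
  have "AE t in lborel. AE x in lborel. t \<in> {0<..<S} \<longrightarrow> x > 0 \<longrightarrow>
      (LINT z:{x<..}|lborel. d t z) = (LINT s:{..t}|lborel. g s x)"
    using AE_boundary_and_tail by eventually_elim auto
  then have "AE x in lborel. AE t in lborel. t \<in> {0<..<S} \<longrightarrow> x > 0 \<longrightarrow>
      (LINT z:{x<..}|lborel. d t z) = (LINT s:{..t}|lborel. g s x)"
    using lborel_pair.AE_commute[OF P] by simp
  then show ?thesis
    using lborel_pair.AE_integrable_snd[OF g_int]
  proof eventually_elim
    case (elim x)
    show ?case
    proof (intro impI conjI ballI)
      fix t assume x: "x > 0" and t: "t \<in> {0..S}"
      have c: "continuous_on UNIV (\<lambda>t. LINT s:{..t}|lborel. g s x)"
        by (rule AC_continuous[OF elim(2), of _ 0]) simp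
      show "(LINT z:{x<..}|lborel. d t z) = (LINT s:{..t}|lborel. g s x)"
      proof (rule continuous_AE_eq_on_interval[OF tail_cont[OF x] _ S _ t])
        show "AE t in lborel. t \<in> {0<..<S} \<longrightarrow> (LINT z:{x<..}|lborel. d t z) = (LINT s:{..t}|lborel. g s x)"
          using elim(1) by eventually_elim (use x in auto)
      qed (rule continuous_on_subset[OF c], simp)
    qed (use elim in auto)
  qed
qed

end

section \<open>The weight\<close>

text \<open>The derivative may blow up only at 0: between \<open>x0\<close> and 1 it is bounded by
  compactness, beyond 1 by hypothesis.\<close>

lemma lipschitz_from_bounded_deriv:
  fixes a :: "real \<Rightarrow> real"
  assumes d: "\<forall>x>0. a differentiable (at x)" and c: "continuous_on {0<..} (deriv a)"
    and bd: "\<exists>M. \<forall>x>1. \<bar>deriv a x\<bar> \<le> M" and x0: "x0 > 0"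
  obtains M where "M \<ge> 0" "\<And>x y. x \<ge> x0 \<Longrightarrow> y \<ge> x0 \<Longrightarrow> \<bar>a y - a x\<bar> \<le> M * \<bar>y - x\<bar>"
proof -
  obtain M1 where M1: "\<And>x. x > 1 \<Longrightarrow> \<bar>deriv a x\<bar> \<le> M1" using bd by auto
  have "compact (deriv a ` {x0..1})"
    by (intro compact_continuous_image continuous_on_subset[OF c]) (use x0 in auto)
  then have "bounded (deriv a ` {x0..1})" by (rule compact_imp_bounded)
  then obtain M2 where M2: "\<And>x. x \<in> {x0..1} \<Longrightarrow> \<bar>deriv a x\<bar> \<le> M2"
    unfolding bounded_iff by (metis image_eqI real_norm_def)
  define M where "M = max 0 (max M1 M2)"
  have M: "\<bar>deriv a x\<bar> \<le> M" if "x \<ge> x0" for x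
    using M1[of x] M2[of x] that by (cases "x > 1") (auto simp: M_def)
  have le: "\<bar>a y - a x\<bar> \<le> M * \<bar>y - x\<bar>" if "x \<ge> x0" "y > x" for x y
  proof -
    have "\<exists>z. x < z \<and> z < y \<and> a y - a x = (y - x) * deriv a z"
    proof (rule MVT2[OF \<open>y > x\<close>])
      fix z assume "x \<le> z"
      then have "a differentiable (at z)" using d x0 that by auto
      then show "(a has_real_derivative deriv a z) (at z)"
        by (simp add: DERIV_deriv_iff_real_differentiable)
    qed
    then obtain z where z: "x < z" "z < y" "a y - a x = (y - x) * deriv a z" by blast
    have "\<bar>a y - a x\<bar> = \<bar>deriv a z\<bar> * \<bar>y - x\<bar>" by (simp add: z(3) abs_mult)
    also have "\<dots> \<le> M * \<bar>y - x\<bar>" by (intro mult_right_mono M) (use z that in auto)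
    finally show ?thesis .
  qed
  show thesis
  proof (rule that[of M])
    show "M \<ge> 0" by (simp add: M_def)
    fix x y assume "x \<ge> x0" "y \<ge> x0"
    then show "\<bar>a y - a x\<bar> \<le> M * \<bar>y - x\<bar>"
      using le[of x y] le[of y x] by (cases x y rule: linorder_cases) (auto simp: abs_minus_commute)
  qed
qed

text \<open>Beyond \<open>x0\<close> both rates are Lipschitz. With the weight frozen there,
  \<open>w x * (a x * u - b x)\<close> increases with at most a fixed slope, which the term
  \<open>C * x\<close> absorbs. The whole difficulty is thus confined to (0,x0], and all constants
  are uniform for u between \<open>K\<close> and \<open>rho\<close>.\<close>

lemma weight_from_local_weight:
  fixes a b w0 :: "real \<Rightarrow> real" and K rho :: real
  assumes a_nn: "\<forall>x\<ge>0. a x \<ge> 0" and b_nn: "\<forall>x\<ge>0. b x \<ge> 0"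
    and a_C1: "\<forall>x>0. a differentiable (at x)" "continuous_on {0<..} (deriv a)"
    and b_C1: "\<forall>x>0. b differentiable (at x)" "continuous_on {0<..} (deriv b)"
    and a'_bdd: "\<exists>M. \<forall>x>1. \<bar>deriv a x\<bar> \<le> M"
    and b'_bdd: "\<exists>M. \<forall>x>1. \<bar>deriv b x\<bar> \<le> M"
    and x0: "x0 > 0"
    and w0c: "continuous_on {0<..x0} w0"
    and w0: "c > 0" "\<And>x. 0 < x \<Longrightarrow> x \<le> x0 \<Longrightarrow> c \<le> w0 x"
    and w0a: "\<And>x. 0 < x \<Longrightarrow> x \<le> x0 \<Longrightarrow> w0 x * a x \<le> C1"
    and w0b: "\<And>x. 0 < x \<Longrightarrow> x \<le> x0 \<Longrightarrow> w0 x * b x \<le> C1"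
    and anti: "\<And>u x y. K \<le> u \<Longrightarrow> u \<le> rho \<Longrightarrow> 0 < x \<Longrightarrow> x \<le> y \<Longrightarrow> y \<le> x0 \<Longrightarrow>
       w0 y * (a y * u - b y) \<le> w0 x * (a x * u - b x)"
  shows "\<exists>w C. w \<in> borel_measurable borel \<and> C \<ge> 0 \<and> (\<forall>x>0. w x \<ge> c) \<and>
      (\<forall>x>0. w x * a x \<le> C * (1 + x)) \<and> (\<forall>x>0. w x * b x \<le> C * (1 + x)) \<and>
      (\<forall>u\<in>{K..rho}. antimono_on {0<..} (\<lambda>x. w x * (a x * u - b x) - C * x) \<and>
         (\<forall>x>0. w x * (a x * u - b x) - C * x \<le> C))"
proof -
  obtain Ma where Ma: "Ma \<ge> 0" "\<And>x y. x \<ge> x0 \<Longrightarrow> y \<ge> x0 \<Longrightarrow> \<bar>a y - a x\<bar> \<le> Ma * \<bar>y - x\<bar>"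
    using lipschitz_from_bounded_deriv[OF a_C1 a'_bdd x0] by blast
  obtain Mb where Mb: "Mb \<ge> 0" "\<And>x y. x \<ge> x0 \<Longrightarrow> y \<ge> x0 \<Longrightarrow> \<bar>b y - b x\<bar> \<le> Mb * \<bar>y - x\<bar>"
    using lipschitz_from_bounded_deriv[OF b_C1 b'_bdd x0] by blast
  \<comment> \<open>Taking the minimum with \<open>x0\<close> keeps the weight constant, equal to
    \<open>w0 x0\<close>, to the right of \<open>x0\<close>.\<close>
  define w where "w x = indicator {0<..} x *\<^sub>R w0 (min x x0)" for x
  define U where "U = \<bar>K\<bar> + \<bar>rho\<bar>"
  define W where "W = w0 x0"
  \<comment> \<open>The summands cover, in this order, the growth bounds near 0, the upper bound on
    the weighted speed, the linear growth of the weighted rates, and the slope of the weighted speed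
    beyond \<open>x0\<close>.\<close>
  define C where "C = C1 + C1 * U + W * Ma + W * Mb + W * (Ma * U + Mb)"
  have W: "W > 0" unfolding W_def using less_le_trans[OF w0(1) w0(2)[of x0]] x0 by simp
  have "0 \<le> W * a x0" using W a_nn x0 by simp
  then have C1: "C1 \<ge> 0" using w0a[of x0] x0 by (simp add: W_def)
  have U: "U \<ge> 0" by (simp add: U_def)
  have C_ge: "C1 \<le> C" "C1 * U \<le> C" "C1 + W * Ma \<le> C" "C1 + W * Mb \<le> C" "W * (Ma * U + Mb) \<le> C" "0 \<le> C"
    using C1 U W Ma Mb by (auto simp: C_def)
  have wx: "w x = (if x \<le> x0 then w0 x else W)" if "x > 0" for x
    using that x0 by (auto simp: w_def W_def min_def)
  have lin: "W * f x \<le> C * (1 + x)" if "W * f x0 \<le> C1" "\<And>x y. x \<ge> x0 \<Longrightarrow> y \<ge> x0 \<Longrightarrow> \<bar>f y - f x\<bar> \<le> M * \<bar>y - x\<bar>"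
      "C1 + W * M \<le> C" "M \<ge> 0" "x > x0" for f M x
  proof -
    have "f x - f x0 \<le> M * (x - x0)" using that(2)[of x0 x] that by auto
    then have "W * (f x - f x0) \<le> W * (M * (x - x0))" using W by (intro mult_left_mono) auto
    also have "\<dots> \<le> W * (M * x)" using W that x0 by (intro mult_left_mono) auto
    finally have "W * f x \<le> C1 + W * M * x" using that(1) by (simp add: algebra_simps)
    also have "\<dots> \<le> (C1 + W * M) * (1 + x)"
      using C1 W that x0 by (simp add: algebra_simps)
    also have "\<dots> \<le> C * (1 + x)" using that x0 by (intro mult_right_mono) auto
    finally show ?thesis .
  qed
  have loc: "C1 \<le> C * (1 + x)" if "x > 0" for x
  proof -
    have "C1 \<le> C * 1" using C_ge by simp
    also have "\<dots> \<le> C * (1 + x)" using C_ge that by (intro mult_left_mono) auto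
    finally show ?thesis .
  qed
  have p: "antimono_on {0<..} (\<lambda>x. w x * (a x * u - b x) - C * x)"
    "\<forall>x>0. w x * (a x * u - b x) - C * x \<le> C" if u: "u \<in> {K..rho}" for u
  proof -
    have uU: "\<bar>u\<bar> \<le> U" using u by (auto simp: U_def)
    let ?p = "\<lambda>x. w x * (a x * u - b x) - C * x"
    have l: "?p y \<le> ?p x" if "0 < x" "x \<le> y" "y \<le> x0" for x y
    proof -
      have "w y * (a y * u - b y) \<le> w x * (a x * u - b x)" using anti[of u x y] u that by (auto simp: wx)
      moreover have "C * x \<le> C * y" using C_ge that by (intro mult_left_mono) auto
      ultimately show ?thesis by simp
    qed
    have r: "?p y \<le> ?p x" if "x0 \<le> x" "x \<le> y" for x y
    proof -
      have "\<bar>a y - a x\<bar> * \<bar>u\<bar> \<le> Ma * \<bar>y - x\<bar> * U"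
        by (intro mult_mono Ma uU) (use that Ma in auto)
      then have "(a y - a x) * u \<le> Ma * \<bar>y - x\<bar> * U"
        using abs_ge_self[of "(a y - a x) * u"] by (simp add: abs_mult)
      moreover have "- (b y - b x) \<le> Mb * \<bar>y - x\<bar>" using Mb(2)[of x y] that by auto
      ultimately have "(a y - a x) * u - (b y - b x) \<le> (Ma * U + Mb) * (y - x)"
        using that by (simp add: algebra_simps)
      then have "W * ((a y - a x) * u - (b y - b x)) \<le> W * ((Ma * U + Mb) * (y - x))"
        using W by (intro mult_left_mono) auto
      also have "\<dots> = (W * (Ma * U + Mb)) * (y - x)" by (simp add: mult.assoc)
      also have "\<dots> \<le> C * (y - x)" using that by (intro mult_right_mono C_ge) auto
      moreover have "w z = W" if "x0 \<le> z" for z using that x0 wx[of z] by (cases "z = x0") (auto simp: W_def)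
      then have "w x = W" "w y = W" using that by auto
      ultimately show ?thesis by (simp add: algebra_simps)
    qed
    have anti': "?p y \<le> ?p x" if "0 < x" "x \<le> y" for x y
      using l[of x y] r[of x y] l[of x x0] r[of x0 y] that by (cases "y \<le> x0"; cases "x0 \<le> x") auto
    then show "antimono_on {0<..} ?p" by (auto intro!: monotone_onI)
    have b1: "?p x \<le> C" if "0 < x" "x \<le> x0" for x
    proof -
      have p1: "w0 x > 0" using less_le_trans[OF w0(1) w0(2)[OF that]] .
      have "w0 x * a x * u \<le> w0 x * a x * U" using a_nn p1 uU that by (intro mult_left_mono) auto
      also have "\<dots> \<le> C1 * U" using w0a that U by (intro mult_right_mono) auto
      finally have "w0 x * a x * u \<le> C" using C_ge by simp
      moreover have "w0 x * b x \<ge> 0" "C * x \<ge> 0" using p1 b_nn that C_ge by auto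
      ultimately show ?thesis using wx[of x] that by (simp add: algebra_simps)
    qed
    show "\<forall>x>0. ?p x \<le> C"
    proof (intro allI impI)
      fix x :: real assume "x > 0"
      then show "?p x \<le> C" using b1[of x] b1[of x0] r[of x0 x] x0 by (cases "x \<le> x0") auto
    qed
  qed
  have wm: "w \<in> borel_measurable borel"
    unfolding w_def
  proof (rule borel_measurable_continuous_on_indicator)
    show "continuous_on {0<..} (\<lambda>x. w0 (min x x0))"
      by (rule continuous_on_compose2[OF w0c]) (use x0 in \<open>auto intro!: continuous_intros\<close>)
  qed simp
  have "w x \<ge> c" if "x > 0" for x using w0(2) x0 that by (auto simp: wx W_def)
  moreover have "w x * a x \<le> C * (1 + x)" if "x > 0" for x
    using w0a[of x] w0a[of x0] loc[OF that] lin[of a Ma x, OF _ Ma(2)] Ma C_ge x0 that by (auto simp: wx W_def)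
  moreover have "w x * b x \<le> C * (1 + x)" if "x > 0" for x
    using w0b[of x] w0b[of x0] loc[OF that] lin[of b Mb x, OF _ Mb(2)] Mb C_ge x0 that by (auto simp: wx W_def)
  ultimately show ?thesis
    using wm p C_ge(6) by (intro exI[of _ w] exI[of _ C] conjI ballI allI impI) auto
qed

text \<open>Near \<open>0\<close> the weight is \<open>1 / a\<close> if \<open>\<Phi>\<close> increases, which turns \<open>w (a u - b)\<close> into \<open>u - \<Phi>\<close>, and
  \<open>1 / (a K - b)\<close> if \<open>\<Phi>\<close> decreases, which turns it into \<open>1 + (u - K) / (K - \<Phi>)\<close>.\<close>

lemma transport_weight:
  fixes a b :: "real \<Rightarrow> real" and K rho Phi0 :: real
  assumes a_nn: "\<forall>x\<ge>0. a x \<ge> 0" and b_nn: "\<forall>x\<ge>0. b x \<ge> 0"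
    and a_cont: "continuous_on {0..} a" and b_cont: "continuous_on {0..} b"
    and a_C1: "\<forall>x>0. a differentiable (at x)" "continuous_on {0<..} (deriv a)"
    and b_C1: "\<forall>x>0. b differentiable (at x)" "continuous_on {0<..} (deriv b)"
    and a'_bdd: "\<exists>M. \<forall>x>1. \<bar>deriv a x\<bar> \<le> M"
    and b'_bdd: "\<exists>M. \<forall>x>1. \<bar>deriv b x\<bar> \<le> M"
    and a_pos: "\<forall>x>0. a x > 0"
    and Phi_lim: "((\<lambda>x. b x / a x) \<longlongrightarrow> Phi0) (at_right 0)"
    and Phi_mono: "\<exists>xs>0. mono_on {0<..<xs} (\<lambda>x. b x / a x)
                     \<or> monotone_on {0<..<xs} (\<le>) (\<ge>) (\<lambda>x. b x / a x)"
    and K: "K > Phi0"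
  shows "\<exists>w C c. c > 0 \<and> w \<in> borel_measurable borel \<and> C \<ge> 0 \<and> (\<forall>x>0. w x \<ge> c) \<and>
      (\<forall>x>0. w x * a x \<le> C * (1 + x)) \<and> (\<forall>x>0. w x * b x \<le> C * (1 + x)) \<and>
      (\<forall>u\<in>{K..rho}. antimono_on {0<..} (\<lambda>x. w x * (a x * u - b x) - C * x) \<and>
         (\<forall>x>0. w x * (a x * u - b x) - C * x \<le> C))"
proof -
  obtain xs where xs: "xs > 0" "mono_on {0<..<xs} (\<lambda>x. b x / a x)
                     \<or> monotone_on {0<..<xs} (\<le>) (\<ge>) (\<lambda>x. b x / a x)" using Phi_mono by auto
  \<comment> \<open>The right end point must be included in the local interval, so \<open>x0\<close>
    is chosen strictly inside the range of monotonicity.\<close>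
  define x0 where "x0 = xs / 2"
  have x0: "x0 > 0" "x0 < xs" using xs by (auto simp: x0_def)
  have "compact (a ` {0..x0})"
    by (intro compact_continuous_image continuous_on_subset[OF a_cont]) auto
  then have "bounded (a ` {0..x0})" by (rule compact_imp_bounded)
  then obtain A where A: "\<And>x. x \<in> {0..x0} \<Longrightarrow> \<bar>a x\<bar> \<le> A"
    unfolding bounded_iff by (metis image_eqI real_norm_def)
  have Apos: "A > 0" using A[of x0] a_pos[rule_format, of x0] x0 by auto
  have ca: "continuous_on {0<..x0} a" and cb: "continuous_on {0<..x0} b"
    using a_cont b_cont by (auto intro: continuous_on_subset)
  note ext = weight_from_local_weight[OF a_nn b_nn a_C1 b_C1 a'_bdd b'_bdd x0(1)]
  have ap: "a x > 0" if "0 < x" for x using a_pos that by simp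
  have Aa: "a x \<le> A" if "0 < x" "x \<le> x0" for x using A[of x] that by auto
  from xs(2) show ?thesis
  proof
    assume m: "mono_on {0<..<xs} (\<lambda>x. b x / a x)"
    have Phi: "b x / a x \<le> b y / a y" if "0 < x" "x \<le> y" "y \<le> x0" for x y
      using mono_onD[OF m, of x y] that x0 by auto
    have "\<exists>w C. w \<in> borel_measurable borel \<and> C \<ge> 0 \<and> (\<forall>x>0. w x \<ge> 1 / A) \<and>
      (\<forall>x>0. w x * a x \<le> C * (1 + x)) \<and> (\<forall>x>0. w x * b x \<le> C * (1 + x)) \<and>
      (\<forall>u\<in>{K..rho}. antimono_on {0<..} (\<lambda>x. w x * (a x * u - b x) - C * x) \<and>
         (\<forall>x>0. w x * (a x * u - b x) - C * x \<le> C))"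
    proof (rule ext)
      show "continuous_on {0<..x0} (\<lambda>x. 1 / a x)"
        by (intro continuous_on_divide continuous_on_const ca) (simp add: ap less_imp_neq[OF ap, symmetric])
      show "1 / A > 0" using Apos by simp
      show "1 / A \<le> 1 / a x" if "0 < x" "x \<le> x0" for x
        using Aa ap that by (simp add: frac_le)
      show "1 / a x * a x \<le> max 1 (b x0 / a x0)" if "0 < x" "x \<le> x0" for x
        using ap[of x] that by simp
      show "1 / a x * b x \<le> max 1 (b x0 / a x0)" if "0 < x" "x \<le> x0" for x
        using Phi[of x x0] that by simp
      show "1 / a y * (a y * u - b y) \<le> 1 / a x * (a x * u - b x)" if "0 < x" "x \<le> y" "y \<le> x0" for u x y
        using Phi[of x y] that ap[of x] ap[of y] by (simp add: diff_divide_distrib)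
    qed
    moreover have "1 / A > 0" using Apos by simp
    ultimately show ?thesis by blast
  next
    assume m: "monotone_on {0<..<xs} (\<le>) (\<ge>) (\<lambda>x. b x / a x)"
    have Phi: "b y / a y \<le> b x / a x" if "0 < x" "x \<le> y" "y \<le> x0" for x y
      using monotone_onD[OF m, of x y] that x0 by auto
    \<comment> \<open>Here the ratio decreases away from 0, so its limit at 0 bounds it from above;
      hence \<open>K - b x / a x\<close> stays above \<open>K - Phi0\<close>, even though
      \<open>a\<close> itself may tend to 0.\<close>
    have Phi0: "b x / a x \<le> Phi0" if "0 < x" "x \<le> x0" for x
    proof (rule tendsto_lowerbound[OF Phi_lim])
      show "\<forall>\<^sub>F z in at_right 0. b x / a x \<le> b z / a z"
        by (rule eventually_at_rightI[of 0 x]) (use Phi that in auto)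
    qed simp
    have Phi_nn: "b x / a x \<ge> 0" if "0 < x" for x using b_nn ap[of x] that by simp
    \<comment> \<open>The ratio is nonnegative and at most \<open>Phi0\<close>, so \<open>K\<close>
      is positive and 1 / (A K) can serve as the lower bound of the weight.\<close>
    have Kp: "K > 0" using K Phi0[of x0] Phi_nn[of x0] x0 by linarith
    have den: "a x * K - b x = a x * (K - b x / a x)" if "0 < x" for x
      using ap[of x] that by (simp add: algebra_simps)
    have pos: "K - b x / a x \<ge> K - Phi0" "K - b x / a x > 0" if "0 < x" "x \<le> x0" for x
      using Phi0[OF that] K by auto
    have dpos: "a x * K - b x > 0" if "0 < x" "x \<le> x0" for x
      using den ap pos that by simp
    then have nz: "a x * K \<noteq> b x" if "0 < x" "x \<le> x0" for x
      using that by fastforce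
    have "\<exists>w C. w \<in> borel_measurable borel \<and> C \<ge> 0 \<and> (\<forall>x>0. w x \<ge> 1 / (A * K)) \<and>
      (\<forall>x>0. w x * a x \<le> C * (1 + x)) \<and> (\<forall>x>0. w x * b x \<le> C * (1 + x)) \<and>
      (\<forall>u\<in>{K..rho}. antimono_on {0<..} (\<lambda>x. w x * (a x * u - b x) - C * x) \<and>
         (\<forall>x>0. w x * (a x * u - b x) - C * x \<le> C))"
    proof (rule ext)
      show "continuous_on {0<..x0} (\<lambda>x. 1 / (a x * K - b x))"
        by (intro continuous_on_divide continuous_on_diff continuous_on_mult continuous_on_const ca cb)
          (use nz in auto)
      show "1 / (A * K) > 0" using Apos Kp by simp
      show "1 / (A * K) \<le> 1 / (a x * K - b x)" if "0 < x" "x \<le> x0" for x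
      proof (rule frac_le)
        have "a x * K \<le> A * K" using Aa that Kp by (intro mult_right_mono) auto
        moreover have "b x \<ge> 0" using b_nn that by simp
        ultimately show "a x * K - b x \<le> A * K" by linarith
      qed (use dpos that in auto)
      have q: "1 / (a x * K - b x) * a x = 1 / (K - b x / a x)" if "0 < x" "x \<le> x0" for x
        unfolding den[OF that(1)] using ap[of x] pos[OF that] that by (simp add: field_simps)
      show qa: "1 / (a x * K - b x) * a x \<le> max 1 Phi0 / (K - Phi0)" if "0 < x" "x \<le> x0" for x
        unfolding q[OF that] using pos[OF that] K by (intro frac_le) auto
      show "1 / (a x * K - b x) * b x \<le> max 1 Phi0 / (K - Phi0)" if "0 < x" "x \<le> x0" for x
      proof -
        have "1 / (a x * K - b x) * b x = (1 / (a x * K - b x) * a x) * (b x / a x)"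
          using ap[of x] that by simp
        also have "\<dots> = (b x / a x) / (K - b x / a x)" unfolding q[OF that] by simp
        also have "\<dots> \<le> max 1 Phi0 / (K - Phi0)"
          using pos[OF that] K Phi0[OF that] by (intro frac_le) auto
        finally show ?thesis .
      qed
      show "1 / (a y * K - b y) * (a y * u - b y) \<le> 1 / (a x * K - b x) * (a x * u - b x)"
        if "K \<le> u" "0 < x" "x \<le> y" "y \<le> x0" for u x y
      proof -
        have e: "1 / (a z * K - b z) * (a z * u - b z) = 1 + (u - K) / (K - b z / a z)" if "0 < z" "z \<le> x0" for z
        proof -
          have "1 / (a z * K - b z) * (a z * u - b z) = 1 / (a z * K - b z) * ((a z * K - b z) + a z * (u - K))"
            by (simp add: algebra_simps)
          also have "\<dots> = 1 + (1 / (a z * K - b z) * a z) * (u - K)"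
            using dpos[OF that] by (simp add: distrib_left)
          finally show ?thesis unfolding q[OF that] by simp
        qed
        \<comment> \<open>The sign of \<open>u - K\<close> decides the direction of this inequality,
          which is why \<open>K\<close> must not exceed any concentration that occurs.\<close>
        have "(u - K) / (K - b y / a y) \<le> (u - K) / (K - b x / a x)"
          using Phi[of x y] pos[of x] that by (intro divide_left_mono mult_pos_pos pos) auto
        then show ?thesis using e[of x] e[of y] that by simp
      qed
    qed
    moreover have "1 / (A * K) > 0" using Apos Kp by simp
    ultimately show ?thesis by blast
  qed
qed

section \<open>Test functions obtained as tail integrals\<close>

text \<open>Integrating from the right makes the test function vanish beyond the support of
  \<open>\<zeta>\<close> by construction, while continuity of \<open>\<zeta>\<close> makes it
  continuously differentiable.\<close>

lemma tail_integral_derivative: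
  fixes \<zeta> :: "real \<Rightarrow> real"
  assumes c: "continuous_on UNIV \<zeta>" and z: "\<And>t. t \<ge> R \<Longrightarrow> \<zeta> t = 0"
  shows "((\<lambda>t. LINT s:{t..}|lborel. \<zeta> s) has_real_derivative - \<zeta> t) (at t)"
    and "t \<ge> R \<Longrightarrow> (LINT s:{t..}|lborel. \<zeta> s) = 0"
proof -
  have "\<And>x. isCont \<zeta> x" using c by (simp add: continuous_on_eq_continuous_at)
  then obtain Z where Z: "\<And>x. (Z has_vector_derivative \<zeta> x) (at x)"
    using einterval_antiderivative[of "-\<infinity>" "\<infinity>" \<zeta>] by auto
  have FTC: "(LINT s:{p..q}|lborel. \<zeta> s) = Z q - Z p" if "p \<le> q" for p q
    unfolding set_lebesgue_integral_def
    by (rule integral_FTC_atLeastAtMost[OF that])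
      (auto intro: has_vector_derivative_at_within[OF Z] continuous_on_subset[OF c])
  have zero: "Z q = Z R" if "q \<ge> R" for q
  proof -
    have "(LINT s:{R..q}|lborel. \<zeta> s) = (LINT s:{R..q}|lborel. 0)"
      by (rule set_lebesgue_integral_cong) (use z in auto)
    with FTC[OF that] show ?thesis by simp
  qed
  have eq: "(LINT s:{t..}|lborel. \<zeta> s) = Z R - Z t" for t
  proof -
    have "(LINT s:{t..}|lborel. \<zeta> s) = (LINT s:{t..max t R}|lborel. \<zeta> s)"
      unfolding set_lebesgue_integral_def
      by (rule Bochner_Integration.integral_cong) (use z in \<open>auto split: split_indicator\<close>)
    also have "\<dots> = Z R - Z t" using FTC[of t "max t R"] zero[of "max t R"] by simp
    finally show ?thesis .
  qed
  show "((\<lambda>t. LINT s:{t..}|lborel. \<zeta> s) has_real_derivative - \<zeta> t) (at t)"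
    unfolding eq using Z[of t] by (auto intro!: derivative_eq_intros simp: has_real_derivative_iff_has_vector_derivative)
  show "t \<ge> R \<Longrightarrow> (LINT s:{t..}|lborel. \<zeta> s) = 0" using zero[of t] by (simp add: eq)
qed

section \<open>Restriction of a solution to a compact time interval\<close>

text \<open>The rates are regular only on the half-line and arbitrary at negative arguments.
  \<open>a'\<close> and \<open>b'\<close> are Borel functions on the whole line that agree with them
  for x > 0, so that integrands can be measurable without restriction to a set.\<close>

locale LS_restricted =
  fixes rho Phi0 :: real and a b nn fin :: "real \<Rightarrow> real" and T S :: real and f :: "real \<Rightarrow> real \<Rightarrow> real"
    and a' b' :: "real \<Rightarrow> real"
  assumes sol: "LS_solution rho Phi0 a b nn fin T f"
    and S: "0 < S" "S < T"
    and a': "a' \<in> borel_measurable borel" "\<And>x. x > 0 \<Longrightarrow> a' x = a x"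
    and b': "b' \<in> borel_measurable borel" "\<And>x. x > 0 \<Longrightarrow> b' x = b x"
begin

text \<open>A representative of the solution that is nonnegative everywhere and zero outside [0,S]
  and for x <= 0. At each time in [0,S] it coincides with \<open>f\<close> for almost every x > 0,
  and integrals over the whole line can be used in place of set integrals.\<close>

definition "h t x = (if 0 \<le> t \<and> t \<le> S \<and> 0 < x then max 0 (f t x) else 0)"

text \<open>Outside [0,S] the value is \<open>rho\<close>, which is still an admissible
  concentration; bounds on \<open>u\<close> can therefore be stated for all real t.\<close>

definition "u t = rho - (LINT x|lborel. x * h t x)"

lemma f_meas[measurable]: "(\<lambda>(t, x). f t x) \<in> borel_measurable (borel \<Otimes>\<^sub>M borel)"
  using sol unfolding LS_solution_def by (simp add: borel_prod case_prod_unfold)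

lemma h_meas[measurable]: "(\<lambda>(t, x). h t x) \<in> borel_measurable (borel \<Otimes>\<^sub>M borel)"
  unfolding h_def by measurable

lemma h_nonneg: "h t x \<ge> 0"
  by (simp add: h_def)

lemma h_supp: "x \<le> 0 \<Longrightarrow> h t x = 0" "t \<notin> {0..S} \<Longrightarrow> h t x = 0"
  by (auto simp: h_def)

lemma h_eq_AE: "t \<in> {0..S} \<Longrightarrow> AE x in lborel. x > 0 \<longrightarrow> h t x = f t x"
proof -
  assume t: "t \<in> {0..S}"
  then have "AE x in lborel. x \<in> {0<..} \<longrightarrow> f t x \<ge> 0"
    using sol S unfolding LS_solution_def by auto
  then show ?thesis by eventually_elim (use t in \<open>auto simp: h_def\<close>)
qed

lemma set_integral_f:
  assumes t: "t \<in> {0..S}" and p: "p \<in> borel_measurable borel"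
  shows "(LINT x:{0<..}|lborel. p x * f t x) = (LINT x|lborel. p x * h t x)"
    and "set_integrable lborel {0<..} (\<lambda>x. p x * f t x) \<longleftrightarrow> integrable lborel (\<lambda>x. p x * h t x)"
proof -
  note [measurable] = p
  have ae: "AE x in lborel. indicator {0<..} x *\<^sub>R (p x * f t x) = p x * h t x"
    using h_eq_AE[OF t] by eventually_elim (use h_supp in \<open>auto split: split_indicator\<close>)
  show "(LINT x:{0<..}|lborel. p x * f t x) = (LINT x|lborel. p x * h t x)"
    unfolding set_lebesgue_integral_def by (rule integral_cong_AE[OF _ _ ae]) measurable
  show "set_integrable lborel {0<..} (\<lambda>x. p x * f t x) \<longleftrightarrow> integrable lborel (\<lambda>x. p x * h t x)"
    unfolding set_integrable_def by (rule integrable_cong_AE[OF _ _ ae]) measurable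
qed

lemma xh_int: "integrable lborel (\<lambda>x. x * h t x)"
proof (cases "t \<in> {0..S}")
  case True
  then have "set_integrable lborel {0<..} (\<lambda>x. x * f t x)"
    using sol S unfolding LS_solution_def by auto
  then show ?thesis using set_integral_f(2)[OF True, of "\<lambda>x. x"] by simp
qed (simp add: h_supp)

lemma u_eq: "t \<in> {0..S} \<Longrightarrow> LS_u rho f t = u t"
  unfolding LS_u_def u_def using set_integral_f(1)[of t "\<lambda>x. x"] by simp

lemma weak_cont:
  assumes psi: "psi \<in> borel_measurable borel" "bounded (range psi)"
  shows "continuous_on {0..S} (\<lambda>t. LINT x|lborel. psi x * x * h t x)"
proof -
  have "continuous_on {0..<T} (\<lambda>t. set_lebesgue_integral lborel {0<..} (\<lambda>x. psi x * x * f t x))"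
    using sol psi unfolding LS_solution_def by blast
  then have "continuous_on {0..S} (\<lambda>t. set_lebesgue_integral lborel {0<..} (\<lambda>x. psi x * x * f t x))"
    by (rule continuous_on_subset) (use S in auto)
  then show ?thesis
    by (rule continuous_on_eq) (use set_integral_f(1)[of _ "\<lambda>x. psi x * x"] psi in auto)
qed

lemma u_cont: "continuous_on {0..S} u"
  using weak_cont[of "\<lambda>_. 1"] unfolding u_def by (auto intro!: continuous_intros)

lemma u_bounds: "t \<in> {0..S} \<Longrightarrow> u t > Phi0" "u t \<le> rho"
proof -
  show "u t > Phi0" if "t \<in> {0..S}"
  proof -
    have "LS_u rho f t > Phi0" using sol S that unfolding LS_solution_def by auto
    then show ?thesis by (simp add: u_eq[OF that])
  qed
  have "(LINT x|lborel. x * h t x) \<ge> 0"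
  proof (rule integral_nonneg_AE, rule AE_I2)
    fix x show "0 \<le> x * h t x" using h_nonneg[of t x] h_supp(1)[of x t] by (cases "x > 0") auto
  qed
  then show "u t \<le> rho" by (simp add: u_def)
qed

text \<open>The function equal to 1/z for z > x is bounded by 1/x, hence admissible in the weak
  continuity against x dx. The argument breaks down at x = 0.\<close>

lemma tail_cont:
  assumes "x > 0"
  shows "continuous_on {0..S} (\<lambda>t. LINT z:{x<..}|lborel. h t z)"
proof -
  define psi where "psi z = indicator {x<..} z / z" for z :: real
  have [measurable]: "psi \<in> borel_measurable borel" unfolding psi_def by measurable
  have "\<bar>psi z\<bar> \<le> 1 / x" for z
    using assms by (auto simp: psi_def field_simps split: split_indicator)
  then have "bounded (range psi)" by (auto simp: bounded_iff)
  then have "continuous_on {0..S} (\<lambda>t. LINT z|lborel. psi z * z * h t z)" by (intro weak_cont) auto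
  moreover have "psi z * z * h t z = indicator {x<..} z *\<^sub>R h t z" for z t
    using assms by (auto simp: psi_def split: split_indicator)
  ultimately show ?thesis by (simp add: set_lebesgue_integral_def)
qed

lemma h_set_int: "x > 0 \<Longrightarrow> set_integrable lborel {x<..} (h t)"
  unfolding set_integrable_def
proof (rule Bochner_Integration.integrable_bound[OF integrable_mult_right[OF xh_int[of t], of "1 / x"]])
  assume x: "x > 0"
  show "AE z in lborel. norm (indicator {x<..} z *\<^sub>R h t z) \<le> norm (1 / x * (z * h t z))"
  proof (rule AE_I2)
    fix z
    show "norm (indicator {x<..} z *\<^sub>R h t z) \<le> norm (1 / x * (z * h t z))"
    proof (cases "z > x")
      case True
      then have "1 * h t z \<le> (z / x) * h t z" using x h_nonneg by (intro mult_right_mono) auto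
      then show ?thesis using True x h_nonneg[of t z] by simp
    qed simp
  qed
qed measurable

text \<open>The definition of a solution bounds the L^1 norm only at almost every time. Tails above
  a positive x are continuous in t, so they inherit the bound at every time; monotone convergence as
  x decreases to 0 then bounds the full norm.\<close>

lemma h_L1_bound: "\<exists>C. \<forall>t. integrable lborel (h t) \<and> (LINT x|lborel. h t x) \<le> C"
proof -
  have "(S + T) / 2 < T" using S by simp
  then obtain C where C: "AE t in lborel. t \<in> {0<..<(S + T) / 2} \<longrightarrow>
        set_integrable lborel {0<..} (f t) \<and> set_lebesgue_integral lborel {0<..} (\<lambda>x. \<bar>f t x\<bar>) \<le> C"
    using sol unfolding LS_solution_def by blast
  let ?C = "max 0 C"
  have AEt: "AE t in lborel. t \<in> {0<..<S} \<longrightarrow> integrable lborel (h t) \<and> (LINT x|lborel. h t x) \<le> ?C"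
    using C
  proof eventually_elim
    case (elim t)
    show ?case
    proof
      assume t: "t \<in> {0<..<S}"
      then have t': "t \<in> {0..S}" "t \<in> {0<..<(S + T) / 2}" using S by auto
      have i: "integrable lborel (h t)"
        using elim t' set_integral_f(2)[OF t'(1), of "\<lambda>_. 1"] by simp
      have "(LINT x|lborel. h t x) = (LINT x:{0<..}|lborel. f t x)"
        using set_integral_f(1)[OF t'(1), of "\<lambda>_. 1"] by simp
      also have "\<dots> \<le> (LINT x:{0<..}|lborel. \<bar>f t x\<bar>)"
        using elim t' by (intro set_integral_mono set_integrable_abs) auto
      finally show "integrable lborel (h t) \<and> (LINT x|lborel. h t x) \<le> ?C" using i elim t' by auto
    qed
  qed
  have tail: "(LINT z:{x<..}|lborel. h t z) \<le> ?C" if "x > 0" "t \<in> {0..S}" for x t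
  proof -
    \<comment> \<open>Taking the maximum turns an inequality valid almost everywhere into an
      equality of continuous functions.\<close>
    have "max (LINT z:{x<..}|lborel. h t z) ?C = ?C"
    proof (rule continuous_AE_eq_on_interval[OF _ _ S(1) _ that(2)])
      show "continuous_on {0..S} (\<lambda>t. max (LINT z:{x<..}|lborel. h t z) ?C)"
        by (intro continuous_intros tail_cont that)
      show "AE t in lborel. t \<in> {0<..<S} \<longrightarrow> max (LINT z:{x<..}|lborel. h t z) ?C = ?C"
        using AEt
      proof eventually_elim
        case (elim t)
        show ?case
        proof
          assume "t \<in> {0<..<S}"
          with elim have e: "integrable lborel (h t)" "(LINT x|lborel. h t x) \<le> ?C" by auto
          have "(LINT z:{x<..}|lborel. h t z) \<le> (LINT x|lborel. \<bar>h t x\<bar>)"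
            using abs_set_integral_le[OF e(1), of "{x<..}"] by simp
          then have "(LINT z:{x<..}|lborel. h t z) \<le> (LINT x|lborel. h t x)" by (simp add: h_nonneg)
          with e(2) show "max (LINT z:{x<..}|lborel. h t z) ?C = ?C" by linarith
        qed
      qed
    qed simp
    then show ?thesis by linarith
  qed
  have nn: "(\<integral>\<^sup>+x. ennreal (h t x) \<partial>lborel) \<le> ennreal ?C" if t: "t \<in> {0..S}" for t
  proof -
    let ?g = "\<lambda>(n::nat) x. ennreal (indicator {1 / real (Suc n)<..} x *\<^sub>R h t x)"
    have "(\<integral>\<^sup>+x. ennreal (h t x) \<partial>lborel) = (\<integral>\<^sup>+x. (SUP n. ?g n x) \<partial>lborel)"
    proof (rule nn_integral_cong)
      fix x
      show "ennreal (h t x) = (SUP n. ?g n x)"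
      proof (cases "x > 0")
        case True
        then obtain n where n: "1 / real (Suc n) < x" using nat_approx_posE by blast
        show ?thesis
        proof (rule antisym)
          show "ennreal (h t x) \<le> (SUP n. ?g n x)"
            by (rule SUP_upper2[of n]) (use n in auto)
          show "(SUP n. ?g n x) \<le> ennreal (h t x)"
            by (rule SUP_least) (simp split: split_indicator)
        qed
      next
        case False
        then have "h t x = 0" using h_supp by auto
        then show ?thesis by simp
      qed
    qed
    also have "\<dots> = (SUP n. (\<integral>\<^sup>+x. ?g n x \<partial>lborel))"
    proof (rule nn_integral_monotone_convergence_SUP)
      show "incseq ?g"
      proof (intro incseq_SucI le_funI ennreal_leI)
        fix n x
        have "1 / real (Suc (Suc n)) \<le> 1 / real (Suc n)" by (intro divide_left_mono) auto
        then show "indicator {1 / real (Suc n)<..} x *\<^sub>R h t x \<le> indicator {1 / real (Suc (Suc n))<..} x *\<^sub>R h t x"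
          using h_nonneg by (auto split: split_indicator)
      qed
    qed measurable
    also have "\<dots> \<le> ennreal ?C"
    proof (rule SUP_least)
      fix n :: nat
      have "(\<integral>\<^sup>+x. ?g n x \<partial>lborel) = ennreal (LINT z:{1 / real (Suc n)<..}|lborel. h t z)"
        unfolding set_lebesgue_integral_def
        by (rule nn_integral_eq_integral)
          (use h_set_int[of "1 / real (Suc n)" t] h_nonneg in \<open>simp_all add: set_integrable_def\<close>)
      also have "\<dots> \<le> ennreal ?C" by (intro ennreal_leI tail) (use t in auto)
      finally show "(\<integral>\<^sup>+x. ?g n x \<partial>lborel) \<le> ennreal ?C" .
    qed
    finally show ?thesis .
  qed
  have "integrable lborel (h t) \<and> (LINT x|lborel. h t x) \<le> ?C" for t
  proof (cases "t \<in> {0..S}")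
    case True
    have fin: "(\<integral>\<^sup>+x. ennreal (h t x) \<partial>lborel) < \<infinity>"
      using nn[OF True] by (rule order.strict_trans1) simp
    have i: "integrable lborel (h t)"
      by (rule integrableI_nonneg[OF _ _ fin]) (simp_all add: h_nonneg)
    have "ennreal (LINT x|lborel. h t x) \<le> ennreal ?C"
      using nn[OF True] nn_integral_eq_integral[OF i] h_nonneg by simp
    then have "(LINT x|lborel. h t x) \<le> ?C" by (simp only: ennreal_le_iff max.cobounded1)
    then show ?thesis using i by blast
  next
    case False
    then have "h t = (\<lambda>_. 0)" by (auto simp: h_supp(2))
    then show ?thesis by simp
  qed
  then show ?thesis by blast
qed

lemma h_int: "integrable lborel (h t)"
  using h_L1_bound by blast

text \<open>The first moment is \<open>rho - u t\<close>, and the requirement that \<open>u\<close>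
  exceed \<open>Phi0\<close> bounds it by \<open>rho - Phi0\<close>.\<close>

lemma moment_bound: "\<exists>C. \<forall>t. integrable lborel (\<lambda>x. (1 + x) * h t x) \<and> (LINT x|lborel. (1 + x) * h t x) \<le> C"
proof -
  obtain C where C: "\<And>t. (LINT x|lborel. h t x) \<le> C" using h_L1_bound by blast
  have "integrable lborel (\<lambda>x. (1 + x) * h t x) \<and> (LINT x|lborel. (1 + x) * h t x) \<le> max 0 (C + (rho - Phi0))" for t
  proof (cases "t \<in> {0..S}")
    case True
    have "(LINT x|lborel. x * h t x) \<le> rho - Phi0" using u_bounds(1)[OF True] by (simp add: u_def)
    then show ?thesis using h_int[of t] xh_int[of t] C[of t] by (simp add: distrib_right)
  qed (simp add: h_supp)
  then show ?thesis by blast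
qed

lemma h_moment_int2: "integrable (lborel \<Otimes>\<^sub>M lborel) (\<lambda>(t, x). (1 + x) * h t x)"
proof (rule lborel_pair.Fubini_integrable)
  obtain C where C: "\<And>t. (LINT x|lborel. (1 + x) * h t x) \<le> C" "\<And>t. integrable lborel (\<lambda>x. (1 + x) * h t x)"
    using moment_bound by blast
  have n: "norm ((1 + x) * h t x) = (1 + x) * h t x" for t x
    using h_nonneg[of t x] h_supp(1)[of x t] by (cases "x > 0") auto
  have nonneg: "(LINT x|lborel. (1 + x) * h t x) \<ge> 0" for t
  proof (rule integral_nonneg_AE, rule AE_I2)
    fix x show "0 \<le> (1 + x) * h t x" using n[of x t] norm_ge_zero[of "(1 + x) * h t x"] by simp
  qed
  show "(\<lambda>(t, x). (1 + x) * h t x) \<in> borel_measurable (lborel \<Otimes>\<^sub>M lborel)" by measurable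
  have "integrable lborel (\<lambda>t. LINT x|lborel. (1 + x) * h t x)"
  proof (rule Bochner_Integration.integrable_bound)
    have "emeasure lborel {0..S} < \<infinity>" by (rule emeasure_lborel_cbox_finite[of 0 S, unfolded cbox_interval])
    then show "integrable lborel (\<lambda>t. C * indicator {0..S} t)"
      by (intro integrable_mult_right integrable_real_indicator) auto
    show "AE t in lborel. norm (LINT x|lborel. (1 + x) * h t x) \<le> norm (C * indicator {0..S} t)"
    proof (rule AE_I2)
      fix t show "norm (LINT x|lborel. (1 + x) * h t x) \<le> norm (C * indicator {0..S} t)"
        using C(1)[of t] nonneg[of t] by (cases "t \<in> {0..S}") (auto simp: h_supp)
    qed
  qed measurable
  then show "integrable lborel (\<lambda>t. LINT x|lborel. norm (case (t, x) of (t, x) \<Rightarrow> (1 + x) * h t x))"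
    unfolding prod.case n .
  show "AE t in lborel. integrable lborel (\<lambda>x. case (t, x) of (t, x) \<Rightarrow> (1 + x) * h t x)"
    using C by simp
qed

text \<open>The test function is \<open>\<theta> t * \<phi> x\<close>, whose partial derivatives are
  \<open>- \<zeta> t * \<phi> x\<close> and \<open>- \<theta> t * \<psi> x\<close>; this explains
  the change of sign. It vanishes for t >= S, so the time integral over (0,T) sees the solution on
  [0,S] only.\<close>

lemma weak_formulation:
  assumes \<zeta>: "continuous_on UNIV \<zeta>" "\<And>t. t \<notin> {0<..<S} \<Longrightarrow> \<zeta> t = 0"
    and \<psi>: "continuous_on UNIV \<psi>" "\<And>x. x \<notin> {0<..<R} \<Longrightarrow> \<psi> x = 0"
  defines "\<theta> \<equiv> \<lambda>t. LINT s:{t..}|lborel. \<zeta> s" and "\<phi> \<equiv> \<lambda>x. LINT z:{x..}|lborel. \<psi> z"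
  shows "(LINT t|lborel. LINT x|lborel. (\<zeta> t * \<phi> x + \<theta> t * \<psi> x * (a' x * u t - b' x)) * h t x)
    = \<phi> 0 * (LINT t|lborel. \<theta> t * (indicator {0..S} t * nn (u t)))
      + (LINT x:{0<..}|lborel. \<theta> 0 * \<phi> x * fin x)"
proof -
  have \<theta>': "(\<theta> has_real_derivative - \<zeta> t) (at t)" and \<theta>0: "t \<ge> S \<Longrightarrow> \<theta> t = 0" for t
    unfolding \<theta>_def by (rule tail_integral_derivative[OF \<zeta>(1), of S]; use \<zeta>(2) in simp)+
  have \<phi>': "(\<phi> has_real_derivative - \<psi> x) (at x)" and \<phi>0: "x \<ge> R \<Longrightarrow> \<phi> x = 0" for x
    unfolding \<phi>_def by (rule tail_integral_derivative[OF \<psi>(1), of R]; use \<psi>(2) in simp)+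
  have c\<theta>: "continuous_on UNIV \<theta>" and c\<phi>: "continuous_on UNIV \<phi>"
    using \<theta>' \<phi>' by (auto intro!: continuous_at_imp_continuous_on DERIV_isCont)
  note [measurable] = borel_measurable_continuous_onI[OF c\<theta>] borel_measurable_continuous_onI[OF c\<phi>]
    borel_measurable_continuous_onI[OF \<zeta>(1)] borel_measurable_continuous_onI[OF \<psi>(1)] a'(1) b'(1)
  have cc: "continuous_on A (\<lambda>p. g (fst p))" "continuous_on A (\<lambda>p. g (snd p))"
    if "continuous_on UNIV g" for g :: "real \<Rightarrow> real" and A :: "(real \<times> real) set"
    by (auto intro!: continuous_on_compose2[OF that] continuous_intros)
  have test: "C1c_test T (\<lambda>t x. \<theta> t * \<phi> x) (\<lambda>t x. - \<zeta> t * \<phi> x) (\<lambda>t x. \<theta> t * - \<psi> x)"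
    unfolding C1c_test_def
  proof (intro conjI ballI)
    show "continuous_on (LS_dom T) (\<lambda>p. - \<zeta> (fst p) * \<phi> (snd p))"
      by (intro continuous_on_mult continuous_on_minus cc \<zeta> c\<phi>)
    show "continuous_on (LS_dom T) (\<lambda>p. \<theta> (fst p) * - \<psi> (snd p))"
      by (intro continuous_on_mult continuous_on_minus cc \<psi> c\<theta>)
    show "\<exists>T' R. T' < T \<and> (\<forall>t x. (t, x) \<in> LS_dom T \<and> (T' \<le> t \<or> R \<le> x) \<longrightarrow> \<theta> t * \<phi> x = 0)"
      using S(2) \<theta>0 \<phi>0 by (intro exI[of _ S] exI[of _ R]) auto
    fix p
    have d1: "((\<lambda>q. \<theta> (fst q)) has_derivative (\<lambda>h. - \<zeta> (fst p) * fst h)) (at p within LS_dom T)"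
      using has_derivative_compose[OF has_derivative_fst[OF has_derivative_ident] \<theta>'[of "fst p", unfolded has_field_derivative_def]]
      by simp
    have d2: "((\<lambda>q. \<phi> (snd q)) has_derivative (\<lambda>h. - \<psi> (snd p) * snd h)) (at p within LS_dom T)"
      using has_derivative_compose[OF has_derivative_snd[OF has_derivative_ident] \<phi>'[of "snd p", unfolded has_field_derivative_def]]
      by simp
    show "((\<lambda>q. \<theta> (fst q) * \<phi> (snd q)) has_derivative
         (\<lambda>h. - \<zeta> (fst p) * \<phi> (snd p) * fst h + \<theta> (fst p) * - \<psi> (snd p) * snd h)) (at p within LS_dom T)"
      by (rule has_derivative_eq_rhs[OF has_derivative_mult[OF d1 d2]]) (auto simp: fun_eq_iff algebra_simps)
  qed
  let ?u = "LS_u rho f"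
  have main: "set_lebesgue_integral lborel {0<..<T} (\<lambda>t. set_lebesgue_integral lborel {0<..}
            (\<lambda>x. (- \<zeta> t * \<phi> x + (a x * ?u t - b x) * (\<theta> t * - \<psi> x)) * f t x))
        + set_lebesgue_integral lborel {0<..<T} (\<lambda>t. \<theta> t * \<phi> 0 * nn (?u t))
        + set_lebesgue_integral lborel {0<..} (\<lambda>x. \<theta> 0 * \<phi> x * fin x) = 0"
    using sol test unfolding LS_solution_def by blast
  have e1: "set_lebesgue_integral lborel {0<..<T} (\<lambda>t. set_lebesgue_integral lborel {0<..}
            (\<lambda>x. (- \<zeta> t * \<phi> x + (a x * ?u t - b x) * (\<theta> t * - \<psi> x)) * f t x))
     = - (LINT t|lborel. LINT x|lborel. (\<zeta> t * \<phi> x + \<theta> t * \<psi> x * (a' x * u t - b' x)) * h t x)"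
    unfolding set_lebesgue_integral_def[of lborel "{0<..<T}"] Bochner_Integration.integral_minus[symmetric]
  \<comment> \<open>Time 0 is excluded from \<open>{0<..<T}\<close> although \<open>h\<close> may be
    nonzero there; it is discarded as a null set.\<close>
  proof (rule integral_discrete_difference[of "{0}"])
    fix t :: real assume t: "t \<notin> {0}"
    show "indicator {0<..<T} t *\<^sub>R (set_lebesgue_integral lborel {0<..}
            (\<lambda>x. (- \<zeta> t * \<phi> x + (a x * ?u t - b x) * (\<theta> t * - \<psi> x)) * f t x))
       = (LINT x|lborel. - ((\<zeta> t * \<phi> x + \<theta> t * \<psi> x * (a' x * u t - b' x)) * h t x))"
    proof (cases "t \<in> {0<..S}")
      case True
      then have t': "t \<in> {0..S}" by auto
      have "set_lebesgue_integral lborel {0<..} (\<lambda>x. (- \<zeta> t * \<phi> x + (a x * ?u t - b x) * (\<theta> t * - \<psi> x)) * f t x)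
         = set_lebesgue_integral lborel {0<..} (\<lambda>x. (- \<zeta> t * \<phi> x + (a' x * u t - b' x) * (\<theta> t * - \<psi> x)) * f t x)"
        by (rule set_lebesgue_integral_cong) (use a'(2) b'(2) u_eq[OF t'] in auto)
      also have "\<dots> = (LINT x|lborel. (- \<zeta> t * \<phi> x + (a' x * u t - b' x) * (\<theta> t * - \<psi> x)) * h t x)"
        by (rule set_integral_f(1)[OF t']) measurable
      also have "\<dots> = (LINT x|lborel. - ((\<zeta> t * \<phi> x + \<theta> t * \<psi> x * (a' x * u t - b' x)) * h t x))"
        by (rule Bochner_Integration.integral_cong) (auto simp: algebra_simps)
      finally show ?thesis using True S by simp
    next
      case False
      show ?thesis
      proof (cases "t < 0")
        case True then show ?thesis by (simp add: h_supp(2))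
      next
        case f: False
        with False t have "t > S" by auto
        then have "\<zeta> t = 0" "\<theta> t = 0" using \<zeta>(2) \<theta>0 by auto
        then show ?thesis by (simp add: set_lebesgue_integral_def)
      qed
    qed
  qed auto
  have e2: "set_lebesgue_integral lborel {0<..<T} (\<lambda>t. \<theta> t * \<phi> 0 * nn (?u t))
    = (LINT t|lborel. \<phi> 0 * (\<theta> t * (indicator {0..S} t * nn (u t))))"
    unfolding set_lebesgue_integral_def
  proof (rule integral_discrete_difference[of "{0}"])
    fix t :: real assume t: "t \<notin> {0}"
    show "indicator {0<..<T} t *\<^sub>R (\<theta> t * \<phi> 0 * nn (?u t)) = \<phi> 0 * (\<theta> t * (indicator {0..S} t * nn (u t)))"
    proof (cases "t \<in> {0..S}")
      case True
      then show ?thesis using t S u_eq[OF True] by auto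
    next
      case False
      then show ?thesis using \<theta>0[of t] by (cases "t > S") auto
    qed
  qed auto
  show ?thesis using main unfolding e1 e2 integral_mult_right_zero by simp
qed

end

section \<open>The weighted estimate for two solutions\<close>

text \<open>The chain rule for the absolute value is applied on (x, x + n + 1], and the tail at the
  right end tends to 0 by dominated convergence. Consequently \<open>k\<close> times the sign of its
  tail has nonnegative tails, which is the condition the layer-cake inequality asks for.\<close>

lemma abs_tail_integral:
  fixes k :: "real \<Rightarrow> real"
  assumes k: "integrable lborel k"
  shows "\<bar>LINT z:{x<..}|lborel. k z\<bar> = (LINT z:{x<..}|lborel. sgn (LINT y:{z<..}|lborel. k y) * k z)"
proof -
  define h where "h t = (LINT z:{t<..}|lborel. k z)" for t
  have heq: "h t = (LINT s|lborel. k s) + (LINT s:{..t}|lborel. - k s)" for t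
    using set_integral_atMost_add_greaterThan[OF k, of t] by (simp add: h_def set_lebesgue_integral_def)
  have mk: "integrable lborel (\<lambda>s. - k s)" using k by simp
  have [measurable]: "k \<in> borel_measurable borel" using k by auto
  have [measurable]: "h \<in> borel_measurable borel"
    by (rule borel_measurable_continuous_onI[OF AC_continuous[OF mk heq]])
  let ?X = "\<lambda>n. x + real (Suc n)"
  have in_set: "\<forall>\<^sub>F n in sequentially. z < ?X n" for z
  proof -
    obtain N :: nat where "z - x < real N" using reals_Archimedean2 by blast
    then show ?thesis by (intro eventually_sequentiallyI[of N]) auto
  qed
  have eq: "\<bar>h (?X n)\<bar> - \<bar>h x\<bar> = (LINT s:{x<..?X n}|lborel. sgn (h s) * - k s)" for n
    by (rule AC_abs_chain_rule[OF mk heq]) simp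
  have l1: "(\<lambda>n. h (?X n)) \<longlonglongrightarrow> (LINT s::real|lborel. (0::real))"
    unfolding h_def set_lebesgue_integral_def
  proof (rule integral_dominated_convergence[where w="\<lambda>s. \<bar>k s\<bar>"])
    show "AE s in lborel. (\<lambda>n. indicator {?X n<..} s *\<^sub>R k s) \<longlonglongrightarrow> 0"
    proof (rule AE_I2)
      fix s
      show "(\<lambda>n. indicator {?X n<..} s *\<^sub>R k s) \<longlonglongrightarrow> 0"
        by (rule tendsto_eventually) (use in_set[of s] in eventually_elim, auto)
    qed
  qed (use k in \<open>auto split: split_indicator\<close>)
  have l2: "(\<lambda>n. LINT s:{x<..?X n}|lborel. sgn (h s) * - k s) \<longlonglongrightarrow> (LINT s:{x<..}|lborel. sgn (h s) * - k s)"
    unfolding set_lebesgue_integral_def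
  proof (rule integral_dominated_convergence[where w="\<lambda>s. \<bar>k s\<bar>"])
    show "AE s in lborel. (\<lambda>n. indicator {x<..?X n} s *\<^sub>R (sgn (h s) * - k s)) \<longlonglongrightarrow> indicator {x<..} s *\<^sub>R (sgn (h s) * - k s)"
    proof (rule AE_I2)
      fix s
      show "(\<lambda>n. indicator {x<..?X n} s *\<^sub>R (sgn (h s) * - k s)) \<longlonglongrightarrow> indicator {x<..} s *\<^sub>R (sgn (h s) * - k s)"
        by (rule tendsto_eventually) (use in_set[of s] in eventually_elim, auto split: split_indicator)
    qed
    show "AE s in lborel. norm (indicator {x<..?X n} s *\<^sub>R (sgn (h s) * - k s)) \<le> \<bar>k s\<bar>" for n
      by (auto simp: abs_mult sgn_real_def split: split_indicator)
    show "integrable lborel (\<lambda>s. \<bar>k s\<bar>)" using k by simp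
  qed measurable
  have "(\<lambda>n. \<bar>h (?X n)\<bar> - \<bar>h x\<bar>) \<longlonglongrightarrow> \<bar>0\<bar> - \<bar>h x\<bar>"
    using l1 by (intro tendsto_intros) simp
  with l2 have "- \<bar>h x\<bar> = (LINT s:{x<..}|lborel. sgn (h s) * - k s)"
    unfolding eq using LIMSEQ_unique by fastforce
  then show ?thesis by (simp add: h_def set_lebesgue_integral_def)
qed

lemma tail_integral_continuous:
  fixes k :: "real \<Rightarrow> real"
  assumes k: "integrable lborel k"
  shows "continuous_on UNIV (\<lambda>x. LINT z:{x<..}|lborel. k z)"
proof -
  have heq: "(LINT z:{t<..}|lborel. k z) = (LINT s|lborel. k s) + (LINT s:{..t}|lborel. - k s)" for t
    using set_integral_atMost_add_greaterThan[OF k, of t] by (simp add: set_lebesgue_integral_def)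
  show ?thesis by (rule AC_continuous[OF _ heq]) (use k in simp)
qed

text \<open>Continuity makes the tail vanish for every x >= 0, and the support condition extends
  this to x < 0. Integrals over intervals are differences of tails.\<close>

lemma AE_zero_if_tail_integrals_zero:
  fixes k :: "real \<Rightarrow> real"
  assumes k: "integrable lborel k" and 0: "\<And>x. x \<le> 0 \<Longrightarrow> k x = 0"
    and tail: "AE x in lborel. x > 0 \<longrightarrow> (LINT z:{x<..}|lborel. k z) = 0"
  shows "AE x in lborel. k x = 0"
proof (rule AE_zero_if_box_integrals_zero[OF k])
  let ?h = "\<lambda>x. LINT z:{x<..}|lborel. k z"
  have pos: "?h x = 0" if "x \<ge> 0" for x
  proof (rule continuous_AE_eq_on_interval[of 0 "x + 1" ?h "\<lambda>_. 0"])
    show "continuous_on {0..x + 1} ?h"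
      by (rule continuous_on_subset[OF tail_integral_continuous[OF k]]) simp
    show "AE t in lborel. t \<in> {0<..<x + 1} \<longrightarrow> ?h t = 0"
      using tail by eventually_elim auto
  qed (use that in auto)
  have h0: "?h x = 0" for x
  proof (cases "x \<ge> 0")
    case False
    have "?h x = ?h 0"
      unfolding set_lebesgue_integral_def
      by (rule Bochner_Integration.integral_cong) (use 0 False in \<open>auto split: split_indicator\<close>)
    then show ?thesis using pos[of 0] by simp
  qed (rule pos)
  fix p q :: real
  show "(LINT x:box p q|lborel. k x) = 0"
  proof (cases "p < q")
    case True
    have heq: "(LINT z:{t<..}|lborel. k z) = (LINT s|lborel. k s) + (LINT s:{..t}|lborel. - k s)" for t
      using set_integral_atMost_add_greaterThan[OF k, of t] by (simp add: set_lebesgue_integral_def)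
    have "?h q - ?h p = (LINT s:{p<..q}|lborel. - k s)"
      by (rule AC_increment[OF _ heq]) (use k True in auto)
    then have "(LINT s:{p<..q}|lborel. k s) = 0"
      unfolding h0 by (simp add: set_lebesgue_integral_def)
    moreover have "(LINT s:box p q|lborel. k s) = (LINT s:{p<..q}|lborel. k s)"
      unfolding set_lebesgue_integral_def box_real
      by (rule integral_discrete_difference[of "{q}"]) (auto split: split_indicator)
    ultimately show ?thesis by simp
  qed (simp add: set_lebesgue_integral_def)
qed

lemma bounded_of_compact_support:
  fixes \<zeta> :: "real \<Rightarrow> real"
  assumes "continuous_on UNIV \<zeta>" "\<And>t. t \<notin> {0<..<R} \<Longrightarrow> \<zeta> t = 0"
  obtains B where "B \<ge> 0" "\<And>t. \<bar>\<zeta> t\<bar> \<le> B * indicator {0<..<R} t"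
proof -
  have "compact (\<zeta> ` {0..R})"
    by (intro compact_continuous_image continuous_on_subset[OF assms(1)]) auto
  then have "bounded (\<zeta> ` {0..R})" by (rule compact_imp_bounded)
  then obtain B where B: "\<And>t. t \<in> {0..R} \<Longrightarrow> \<bar>\<zeta> t\<bar> \<le> B"
    unfolding bounded_iff by (metis image_eqI real_norm_def)
  show thesis
  proof (rule that[of "max 0 B"])
    fix t show "\<bar>\<zeta> t\<bar> \<le> max 0 B * indicator {0<..<R} t"
      using B[of t] assms(2)[of t] by (cases "t \<in> {0<..<R}") (auto simp: max_def)
  qed simp
qed

context LS_restricted
begin

lemma mult_h_integrable:
  assumes p: "(\<lambda>(t, x). p t x) \<in> borel_measurable (borel \<Otimes>\<^sub>M borel)"
    and bd: "\<And>t x. x > 0 \<Longrightarrow> \<bar>p t x\<bar> \<le> B * (1 + x)"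
  shows "integrable (lborel \<Otimes>\<^sub>M lborel) (\<lambda>(t, x). p t x * h t x)" "integrable lborel (\<lambda>x. p t x * h t x)"
proof -
  note [measurable] = p
  have le: "norm (p t x * h t x) \<le> norm (B * ((1 + x) * h t x))" for t x
  proof (cases "x > 0")
    case True
    have "\<bar>p t x\<bar> * h t x \<le> B * (1 + x) * h t x" by (intro mult_right_mono bd True h_nonneg)
    also have "\<dots> \<le> \<bar>B * ((1 + x) * h t x)\<bar>" by (simp add: mult.assoc)
    finally show ?thesis using h_nonneg[of t x] by (simp add: abs_mult)
  qed (simp add: h_supp)
  show "integrable (lborel \<Otimes>\<^sub>M lborel) (\<lambda>(t, x). p t x * h t x)"
  proof (rule Bochner_Integration.integrable_bound[OF integrable_mult_right[OF h_moment_int2, of B]])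
    show "AE z in lborel \<Otimes>\<^sub>M lborel. norm (case z of (t, x) \<Rightarrow> p t x * h t x) \<le> norm (B * (case z of (t, x) \<Rightarrow> (1 + x) * h t x))"
      using le by (auto intro!: AE_I2)
  qed measurable
  have "integrable lborel (\<lambda>x. (1 + x) * h t x)" using moment_bound by blast
  from integrable_mult_right[OF this, of B]
  show "integrable lborel (\<lambda>x. p t x * h t x)"
  proof (rule Bochner_Integration.integrable_bound)
    show "AE x in lborel. norm (p t x * h t x) \<le> norm (B * ((1 + x) * h t x))" using le by (intro AE_I2)
  qed measurable
qed

lemma u_meas[measurable]: "u \<in> borel_measurable borel"
  unfolding u_def[abs_def] by measurable

lemma u_outside: "t \<notin> {0..S} \<Longrightarrow> u t = rho"
  by (simp add: u_def h_supp(2))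

end

section \<open>The difference of two solutions as a weak transport problem\<close>

text \<open>The weight \<open>w\<close> and its constants do not depend on time: \<open>K\<close>
  bounds both concentrations from below, and every property of \<open>w\<close> is uniform over
  concentrations in [K,rho]. This allows one weighted norm to be followed through the whole
  interval.\<close>

locale LS_pair = F: LS_restricted rho Phi0 a b nn fin T S f a' b' + G: LS_restricted rho Phi0 a b nn fin T S g a' b'
  for rho Phi0 a b nn fin T S f g a' b' +
  fixes w :: "real \<Rightarrow> real" and K C c L :: real
  assumes K: "Phi0 < K" "\<And>t. K \<le> F.u t" "\<And>t. K \<le> G.u t"
    and c: "c > 0" and C: "C \<ge> 0" and L: "L \<ge> 0"
    and wm: "w \<in> borel_measurable borel" and wc: "\<And>x. x > 0 \<Longrightarrow> c \<le> w x"
    and a'_nn: "\<And>x. x > 0 \<Longrightarrow> a' x \<ge> 0" and b'_nn: "\<And>x. x > 0 \<Longrightarrow> b' x \<ge> 0"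
    and wa: "\<And>x. x > 0 \<Longrightarrow> w x * a' x \<le> C * (1 + x)" and wb: "\<And>x. x > 0 \<Longrightarrow> w x * b' x \<le> C * (1 + x)"
    and w_anti: "\<And>v. v \<in> {K..rho} \<Longrightarrow> antimono_on {0<..} (\<lambda>x. w x * (a' x * v - b' x) - C * x)"
    and w_le: "\<And>v x. v \<in> {K..rho} \<Longrightarrow> x > 0 \<Longrightarrow> w x * (a' x * v - b' x) - C * x \<le> C"
    and nn_lip: "\<And>u v. u \<in> {Phi0..rho} \<Longrightarrow> v \<in> {Phi0..rho} \<Longrightarrow> \<bar>nn u - nn v\<bar> \<le> L * \<bar>u - v\<bar>"
begin

definition "d t x = F.h t x - G.h t x"
definition "flux t x = (a' x * F.u t - b' x) * F.h t x - (a' x * G.u t - b' x) * G.h t x"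
definition "\<nu> t = indicator {0..S} t * nn (F.u t) - indicator {0..S} t * nn (G.u t)"
definition "U = \<bar>K\<bar> + \<bar>rho\<bar>"

lemmas [measurable] = F.a'(1) F.b'(1) wm

lemma u_abs: "\<bar>F.u t\<bar> \<le> U" "\<bar>G.u t\<bar> \<le> U"
  using K(2,3)[of t] F.u_bounds(2)[of t] G.u_bounds(2)[of t] by (auto simp: U_def)

lemma w_speed: "x > 0 \<Longrightarrow> \<bar>v\<bar> \<le> U \<Longrightarrow> \<bar>w x * (a' x * v - b' x)\<bar> \<le> C * (U + 1) * (1 + x)"
proof -
  assume x: "x > 0" and v: "\<bar>v\<bar> \<le> U"
  have w0: "w x > 0" using wc[OF x] c by simp
  have "\<bar>w x * (a' x * v - b' x)\<bar> \<le> \<bar>w x * a' x * v\<bar> + \<bar>w x * b' x\<bar>"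
    using abs_triangle_ineq4[of "w x * a' x * v" "w x * b' x"] by (simp add: algebra_simps)
  also have "\<dots> = w x * a' x * \<bar>v\<bar> + w x * b' x"
    using w0 a'_nn[OF x] b'_nn[OF x] by (simp add: abs_mult)
  also have "\<dots> \<le> C * (1 + x) * U + C * (1 + x)"
    by (rule add_mono[OF mult_mono[OF wa[OF x] v] wb[OF x]]) (use C x in auto)
  finally show ?thesis by (simp add: algebra_simps)
qed

lemma speed: "x > 0 \<Longrightarrow> \<bar>v\<bar> \<le> U \<Longrightarrow> \<bar>a' x * v - b' x\<bar> \<le> C * (U + 1) / c * (1 + x)"
proof -
  assume x: "x > 0" and v: "\<bar>v\<bar> \<le> U"
  have "c * \<bar>a' x * v - b' x\<bar> \<le> w x * \<bar>a' x * v - b' x\<bar>" using wc[OF x] by (intro mult_right_mono) auto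
  also have "\<dots> = \<bar>w x * (a' x * v - b' x)\<bar>" using wc[OF x] c by (simp add: abs_mult)
  also have "\<dots> \<le> C * (U + 1) * (1 + x)" by (rule w_speed[OF x v])
  finally show ?thesis using c by (simp add: field_simps)
qed

lemma nn_u_cont: "continuous_on {0..S} (\<lambda>t. nn (F.u t))" "continuous_on {0..S} (\<lambda>t. nn (G.u t))"
proof -
  have nnc: "continuous_on {Phi0..rho} nn"
    by (rule lipschitz_on_continuous_on[of L]) (auto intro!: lipschitz_onI nn_lip L simp: dist_real_def)
  show "continuous_on {0..S} (\<lambda>t. nn (F.u t))"
    by (rule continuous_on_compose2[OF nnc F.u_cont]) (use F.u_bounds in \<open>auto simp: less_imp_le\<close>)
  show "continuous_on {0..S} (\<lambda>t. nn (G.u t))"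
    by (rule continuous_on_compose2[OF nnc G.u_cont]) (use G.u_bounds in \<open>auto simp: less_imp_le\<close>)
qed

lemma nn_u_int: "integrable lborel (\<lambda>t. indicator {0..S} t * nn (F.u t))" "integrable lborel (\<lambda>t. indicator {0..S} t * nn (G.u t))"
  using borel_integrable_atLeastAtMost'[OF nn_u_cont(1)] borel_integrable_atLeastAtMost'[OF nn_u_cont(2)]
  by (simp_all add: set_integrable_def)

text \<open>The two weak formulations are tested with the same function and subtracted; the linear
  growth of the speed, paired with the moment bound, makes all double integrals finite, so the
  subtraction is legitimate.\<close>

lemma weak_difference: "weak_difference S d flux \<nu>"
proof
  show "S > 0" by (rule F.S)
  show "integrable (lborel \<Otimes>\<^sub>M lborel) (\<lambda>(t, x). d t x)"
    using Bochner_Integration.integrable_diff[OF F.mult_h_integrable(1)[of "\<lambda>_ _. 1" 1] G.mult_h_integrable(1)[of "\<lambda>_ _. 1" 1]]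
    by (simp add: d_def case_prod_unfold)
  show "integrable (lborel \<Otimes>\<^sub>M lborel) (\<lambda>(t, x). flux t x)"
  proof -
    have "integrable (lborel \<Otimes>\<^sub>M lborel) (\<lambda>(t, x). (a' x * F.u t - b' x) * F.h t x)"
      by (rule F.mult_h_integrable) (measurable, rule speed, auto intro: u_abs)
    moreover have "integrable (lborel \<Otimes>\<^sub>M lborel) (\<lambda>(t, x). (a' x * G.u t - b' x) * G.h t x)"
      by (rule G.mult_h_integrable) (measurable, rule speed, auto intro: u_abs)
    ultimately show ?thesis
      using Bochner_Integration.integrable_diff by (fastforce simp add: flux_def case_prod_unfold)
  qed
  show "integrable lborel \<nu>"
    unfolding \<nu>_def[abs_def] by (intro Bochner_Integration.integrable_diff nn_u_int)
  show "integrable lborel (d t)" for t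
    unfolding d_def[abs_def] by (intro Bochner_Integration.integrable_diff F.h_int G.h_int)
  show "integrable lborel (\<lambda>x. x * d t x)" for t
    unfolding d_def right_diff_distrib by (intro Bochner_Integration.integrable_diff F.xh_int G.xh_int)
  show "x \<le> 0 \<Longrightarrow> d t x = 0" for t x by (simp add: d_def F.h_supp G.h_supp)
  show "continuous_on {0..S} (\<lambda>t. LINT z:{x<..}|lborel. d t z)" if "x > 0" for x
  proof -
    have "(LINT z:{x<..}|lborel. d t z) = (LINT z:{x<..}|lborel. F.h t z) - (LINT z:{x<..}|lborel. G.h t z)" for t
      unfolding d_def by (rule set_integral_diff(2)[OF F.h_set_int[OF that] G.h_set_int[OF that]])
    then show ?thesis by (simp add: continuous_on_diff F.tail_cont G.tail_cont that)
  qed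
  fix \<zeta> \<psi> :: "real \<Rightarrow> real" and R :: real
  assume \<zeta>: "continuous_on UNIV \<zeta>" and \<psi>: "continuous_on UNIV \<psi>"
    and \<zeta>0: "\<And>t. t \<notin> {0<..<S} \<Longrightarrow> \<zeta> t = 0" and \<psi>0: "\<And>x. x \<notin> {0<..<R} \<Longrightarrow> \<psi> x = 0"
  obtain B where B: "B \<ge> 0" "\<And>t. \<bar>\<zeta> t\<bar> \<le> B * indicator {0<..<S} t"
    using bounded_of_compact_support[OF \<zeta> \<zeta>0] by blast
  obtain B' where B': "B' \<ge> 0" "\<And>t. \<bar>\<psi> t\<bar> \<le> B' * indicator {0<..<R} t"
    using bounded_of_compact_support[OF \<psi> \<psi>0] by blast
  note [measurable] = borel_measurable_continuous_onI[OF \<zeta>] borel_measurable_continuous_onI[OF \<psi>]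
  have i\<zeta>: "integrable lborel \<zeta>" and i\<psi>: "integrable lborel \<psi>"
    using integrable_bounded_interval[OF _ B(2)] integrable_bounded_interval[OF _ B'(2)] by auto
  define \<theta> where "\<theta> t = (LINT s:{t..}|lborel. \<zeta> s)" for t
  define \<phi> where "\<phi> x = (LINT z:{x..}|lborel. \<psi> z)" for x
  have c\<theta>: "continuous_on UNIV \<theta>" and c\<phi>: "continuous_on UNIV \<phi>"
    unfolding \<theta>_def[abs_def] \<phi>_def[abs_def]
    by (intro continuous_at_imp_continuous_on ballI DERIV_isCont[OF tail_integral_derivative(1)[OF \<zeta>, of S]], use \<zeta>0 in simp)
      (intro continuous_at_imp_continuous_on ballI DERIV_isCont[OF tail_integral_derivative(1)[OF \<psi>, of R]], use \<psi>0 in simp)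
  note [measurable] = borel_measurable_continuous_onI[OF c\<theta>] borel_measurable_continuous_onI[OF c\<phi>]
  define B1 B2 where "B1 = (LINT s|lborel. \<bar>\<zeta> s\<bar>)" and "B2 = (LINT s|lborel. \<bar>\<psi> s\<bar>)"
  have \<theta>b: "\<bar>\<theta> t\<bar> \<le> B1" for t unfolding \<theta>_def B1_def by (intro abs_set_integral_le i\<zeta>) auto
  have \<phi>b: "\<bar>\<phi> t\<bar> \<le> B2" for t unfolding \<phi>_def B2_def by (intro abs_set_integral_le i\<psi>) auto
  have \<zeta>b: "\<bar>\<zeta> t\<bar> \<le> B" for t using B(1) B(2)[of t] by (cases "t \<in> {0<..<S}") auto
  have \<psi>b: "\<bar>\<psi> t\<bar> \<le> B'" for t using B'(1) B'(2)[of t] by (cases "t \<in> {0<..<R}") auto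
  have B12: "B1 \<ge> 0" "B2 \<ge> 0" unfolding B1_def B2_def by (auto intro!: integral_nonneg_AE)
  let ?p = "\<lambda>v t x. \<zeta> t * \<phi> x + \<theta> t * \<psi> x * (a' x * v t - b' x)"
  have pb: "\<bar>?p v t x\<bar> \<le> (B * B2 + B1 * B' * (C * (U + 1) / c)) * (1 + x)" if "x > 0" "\<And>t. \<bar>v t\<bar> \<le> U" for v t x
  proof -
    have "\<bar>?p v t x\<bar> \<le> \<bar>\<zeta> t\<bar> * \<bar>\<phi> x\<bar> + \<bar>\<theta> t\<bar> * \<bar>\<psi> x\<bar> * \<bar>a' x * v t - b' x\<bar>"
      using abs_triangle_ineq[of "\<zeta> t * \<phi> x" "\<theta> t * \<psi> x * (a' x * v t - b' x)"] by (simp add: abs_mult)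
    also have "\<dots> \<le> B * B2 + B1 * B' * (C * (U + 1) / c * (1 + x))"
      by (intro add_mono mult_mono \<zeta>b \<phi>b \<theta>b \<psi>b speed that mult_nonneg_nonneg B B' B12) auto
    also have "\<dots> \<le> (B * B2 + B1 * B' * (C * (U + 1) / c)) * (1 + x)"
      using B B12 that by (simp add: algebra_simps)
    finally show ?thesis .
  qed
  have m: "(\<lambda>(t, x). ?p F.u t x) \<in> borel_measurable (borel \<Otimes>\<^sub>M borel)"
    "(\<lambda>(t, x). ?p G.u t x) \<in> borel_measurable (borel \<Otimes>\<^sub>M borel)"
    by measurable
  note F2 = F.mult_h_integrable[OF m(1) pb[where v=F.u, OF _ u_abs(1)]]
  note G2 = G.mult_h_integrable[OF m(2) pb[where v=G.u, OF _ u_abs(2)]]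
  have "(LINT t|lborel. LINT x|lborel. \<zeta> t * \<phi> x * d t x + \<theta> t * \<psi> x * flux t x)
     = (LINT t|lborel. (LINT x|lborel. ?p F.u t x * F.h t x) - (LINT x|lborel. ?p G.u t x * G.h t x))"
  proof -
    have "\<zeta> t * \<phi> x * d t x + \<theta> t * \<psi> x * flux t x = ?p F.u t x * F.h t x - ?p G.u t x * G.h t x" for t x
      by (simp add: d_def flux_def algebra_simps)
    then show ?thesis by (simp only: Bochner_Integration.integral_diff[OF F2(2) G2(2)])
  qed
  also have "\<dots> = (LINT t|lborel. LINT x|lborel. ?p F.u t x * F.h t x) - (LINT t|lborel. LINT x|lborel. ?p G.u t x * G.h t x)"
    using lborel_pair.integrable_fst[OF F2(1)] lborel_pair.integrable_fst[OF G2(1)]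
    by (intro Bochner_Integration.integral_diff) simp_all
  \<comment> \<open>The initial terms of both solutions involve the same \<open>fin\<close> and
    cancel here.\<close>
  also have "\<dots> = \<phi> 0 * (LINT t|lborel. \<theta> t * (indicator {0..S} t * nn (F.u t)))
      - \<phi> 0 * (LINT t|lborel. \<theta> t * (indicator {0..S} t * nn (G.u t)))"
    using F.weak_formulation[OF \<zeta> \<zeta>0 \<psi> \<psi>0] G.weak_formulation[OF \<zeta> \<zeta>0 \<psi> \<psi>0]
    unfolding \<theta>_def[symmetric] \<phi>_def[symmetric] by simp
  also have "\<dots> = \<phi> 0 * (LINT t|lborel. \<theta> t * \<nu> t)"
  proof -
    have i: "integrable lborel (\<lambda>t. \<theta> t * k t)" if "integrable lborel k" for k :: "real \<Rightarrow> real"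
    proof (rule Bochner_Integration.integrable_bound[OF integrable_mult_right[OF that, of B1]])
      have [measurable]: "k \<in> borel_measurable borel" using that by auto
      show "(\<lambda>t. \<theta> t * k t) \<in> borel_measurable lborel" by measurable
      show "AE t in lborel. norm (\<theta> t * k t) \<le> norm (B1 * k t)"
        using \<theta>b B12 by (intro AE_I2) (auto simp: abs_mult intro!: mult_right_mono)
    qed
    show ?thesis
      using Bochner_Integration.integral_diff[OF i[OF nn_u_int(1)] i[OF nn_u_int(2)]]
      by (simp add: \<nu>_def right_diff_distrib)
  qed
  finally show "(LINT t|lborel. LINT x|lborel. \<zeta> t * (LINT z:{x..}|lborel. \<psi> z) * d t x
          + (LINT s:{t..}|lborel. \<zeta> s) * \<psi> x * flux t x)
        = (LINT z:{0..}|lborel. \<psi> z) * (LINT t|lborel. (LINT s:{t..}|lborel. \<zeta> s) * \<nu> t)"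
    unfolding \<theta>_def \<phi>_def .
qed


sublocale W: weak_difference S d flux \<nu>
  by (rule weak_difference)

section \<open>The weighted norm of the tail and its evolution in time\<close>

definition "tail t x = (LINT z:{x<..}|lborel. d t z)"
text \<open>By the chain rule this is the time derivative of
  \<open>w x * \<bar>tail t x\<bar>\<close> for almost every x > 0.\<close>

definition "J t x = indicator {0<..} x * w x * sgn (tail t x) * flux t x"
definition "H t = (LINT x|lborel. indicator {0<..} x * w x * \<bar>tail t x\<bar>)"
text \<open>The unweighted norm of the tail: it controls the difference of the concentrations and is
  itself controlled by \<open>H\<close>, because \<open>w\<close> is at least
  \<open>c\<close>.\<close>

definition "A t = (LINT x|lborel. indicator {0<..} x * \<bar>tail t x\<bar>)"

lemma tail_meas[measurable]: "(\<lambda>(t, x). tail t x) \<in> borel_measurable (borel \<Otimes>\<^sub>M borel)"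
  unfolding tail_def by (rule W.partial_meas)

text \<open>The weight alone may be unbounded near 0, but its product with the speed grows at most
  linearly in x, and both solutions have bounded moments.\<close>

lemma J_int: "integrable (lborel \<Otimes>\<^sub>M lborel) (\<lambda>(t, x). J t x)" "integrable lborel (\<lambda>x. J t x)"
proof -
  let ?p = "\<lambda>v t x. indicator {0<..} x * w x * sgn (tail t x) * (a' x * v t - b' x)"
  have pb: "\<bar>?p v t x\<bar> \<le> C * (U + 1) * (1 + x)" if "x > 0" "\<And>t. \<bar>v t\<bar> \<le> U" for v t x
  proof -
    have "\<bar>?p v t x\<bar> = \<bar>sgn (tail t x)\<bar> * \<bar>w x * (a' x * v t - b' x)\<bar>"
      using that by (simp add: abs_mult)
    also have "\<dots> \<le> 1 * \<bar>w x * (a' x * v t - b' x)\<bar>"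
      by (intro mult_right_mono) (auto simp: sgn_real_def)
    also have "\<dots> \<le> C * (U + 1) * (1 + x)" using w_speed[OF that(1,2)] by simp
    finally show ?thesis .
  qed
  have m: "(\<lambda>(t, x). ?p F.u t x) \<in> borel_measurable (borel \<Otimes>\<^sub>M borel)"
    "(\<lambda>(t, x). ?p G.u t x) \<in> borel_measurable (borel \<Otimes>\<^sub>M borel)"
    by measurable
  note F2 = F.mult_h_integrable[OF m(1) pb[where v=F.u, OF _ u_abs(1)]]
  note G2 = G.mult_h_integrable[OF m(2) pb[where v=G.u, OF _ u_abs(2)]]
  have J: "J t x = ?p F.u t x * F.h t x - ?p G.u t x * G.h t x" for t x
    by (simp add: J_def flux_def algebra_simps)
  show "integrable lborel (\<lambda>x. J t x)"
    unfolding J by (rule Bochner_Integration.integrable_diff[OF F2(2) G2(2)])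
  show "integrable (lborel \<Otimes>\<^sub>M lborel) (\<lambda>(t, x). J t x)"
    using Bochner_Integration.integrable_diff[OF F2(1) G2(1)] by (simp add: J case_prod_unfold)
qed

lemma flux_outside: "t \<notin> {0..S} \<Longrightarrow> flux t x = 0"
  by (simp add: flux_def F.h_supp(2) G.h_supp(2))

text \<open>For almost every x the tail is the time integral of the flux, hence absolutely
  continuous in t, and the chain rule for the absolute value applies with x fixed.\<close>

lemma weighted_tail_AE:
  "AE x in lborel. \<forall>t\<in>{0..S}. indicator {0<..} x * w x * \<bar>tail t x\<bar> = (LINT s:{..t}|lborel. J s x)"
  using W.AE_tail
proof eventually_elim
  case (elim x)
  show ?case
  proof (intro ballI)
    fix t assume t: "t \<in> {0..S}"
    show "indicator {0<..} x * w x * \<bar>tail t x\<bar> = (LINT s:{..t}|lborel. J s x)"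
    proof (cases "x > 0")
      case False
      then show ?thesis by (simp add: J_def set_lebesgue_integral_def)
    next
      case True
      with elim have gi: "integrable lborel (\<lambda>t. flux t x)"
        and ta: "\<And>t. t \<in> {0..S} \<Longrightarrow> tail t x = (LINT s:{..t}|lborel. flux s x)" by (auto simp: tail_def)
      define h where "h t = 0 + (LINT s:{..t}|lborel. flux s x)" for t
      \<comment> \<open>The flux vanishes at negative times. Starting at -1 rather than 0 keeps the
        interval nondegenerate even for t = 0.\<close>
      have "h (- 1) = 0"
        unfolding h_def set_lebesgue_integral_def
        by (subst Bochner_Integration.integral_cong[where g="\<lambda>_. 0"]) (auto simp: flux_outside split: split_indicator)
      moreover have "\<bar>h t\<bar> - \<bar>h (- 1)\<bar> = (LINT s:{- 1<..t}|lborel. sgn (h s) * flux s x)"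
        by (rule AC_abs_chain_rule[OF gi h_def]) (use t in auto)
      moreover have "h t = tail t x" using ta[OF t] by (simp add: h_def)
      \<comment> \<open>\<open>h\<close> and the tail are known to agree only on [0,S]; elsewhere
        the flux is zero, so the sign in front of it does not matter.\<close>
      moreover have "indicator {- 1<..t} s *\<^sub>R (sgn (h s) * flux s x) = indicator {..t} s *\<^sub>R (sgn (tail s x) * flux s x)" for s
      proof (cases "s \<in> {0..S}")
        case True
        then show ?thesis using ta[OF True] by (auto simp: h_def split: split_indicator)
      qed (simp add: flux_outside)
      then have "(LINT s:{- 1<..t}|lborel. sgn (h s) * flux s x) = (LINT s:{..t}|lborel. sgn (tail s x) * flux s x)"
        unfolding set_lebesgue_integral_def by (rule Bochner_Integration.integral_cong[OF refl])
      ultimately have "\<bar>tail t x\<bar> = (LINT s:{..t}|lborel. sgn (tail s x) * flux s x)"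
        by simp
      then have "w x * \<bar>tail t x\<bar> = (LINT s:{..t}|lborel. w x * (sgn (tail s x) * flux s x))"
        by simp
      then show ?thesis using True by (simp add: J_def mult.assoc)
    qed
  qed
qed

definition "I s = (LINT x|lborel. J s x)"

lemma I_int: "integrable lborel I"
  unfolding I_def[abs_def] using lborel_pair.integrable_fst[OF J_int(1)] by simp

text \<open>Fubini in the pointwise identity for \<open>J\<close>. Integrability of the weighted
  tail is obtained from that of \<open>J\<close>, since a possibly unbounded weight prevents a
  direct comparison with the unweighted tail. Thus \<open>I\<close> is the time derivative of
  \<open>H\<close> in integrated form.\<close>

lemma H_eq:
  assumes t: "t \<in> {0..S}"
  shows "integrable lborel (\<lambda>x. indicator {0<..} x * w x * \<bar>tail t x\<bar>)" "H t = (LINT s:{..t}|lborel. I s)"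
proof -
  have i: "integrable (lborel \<Otimes>\<^sub>M lborel) (\<lambda>(s, x). indicator {..t} s *\<^sub>R J s x)"
  proof (rule Bochner_Integration.integrable_bound[OF J_int(1)])
    have [measurable]: "(\<lambda>(t, x). J t x) \<in> borel_measurable (borel \<Otimes>\<^sub>M borel)"
      using borel_measurable_integrable[OF J_int(1)] by (simp cong: measurable_cong_sets)
    show "(\<lambda>(s, x). indicator {..t} s *\<^sub>R J s x) \<in> borel_measurable (lborel \<Otimes>\<^sub>M lborel)"
      by measurable
  qed (auto split: split_indicator)
  have ae: "AE x in lborel. (LINT s:{..t}|lborel. J s x) = indicator {0<..} x * w x * \<bar>tail t x\<bar>"
    using weighted_tail_AE by eventually_elim (use t in simp)
  have m: "(\<lambda>x. indicator {0<..} x * w x * \<bar>tail t x\<bar>) \<in> borel_measurable lborel" by measurable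
  have i2: "integrable lborel (\<lambda>x. (LINT s:{..t}|lborel. J s x))"
    unfolding set_lebesgue_integral_def using lborel_pair.integrable_snd[OF i] .
  show "integrable lborel (\<lambda>x. indicator {0<..} x * w x * \<bar>tail t x\<bar>)"
    by (rule Bochner_Integration.integrable_cong_AE_imp[OF i2 m ae])
  have "H t = (LINT x|lborel. (LINT s:{..t}|lborel. J s x))"
    unfolding H_def using integral_cong_AE[OF borel_measurable_integrable[OF i2] m ae] by simp
  also have "\<dots> = (LINT s|lborel. LINT x|lborel. indicator {..t} s *\<^sub>R J s x)"
    unfolding set_lebesgue_integral_def by (rule lborel_pair.Fubini_integral[OF i])
  also have "\<dots> = (LINT s:{..t}|lborel. I s)"
    by (simp add: set_lebesgue_integral_def I_def)
  finally show "H t = (LINT s:{..t}|lborel. I s)" .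
qed

lemma A_int: "integrable lborel (\<lambda>x. indicator {0<..} x * tail t x)"
  and u_diff_le: "\<bar>F.u t - G.u t\<bar> \<le> A t"
proof -
  have m: "d t \<in> borel_measurable borel" using W.dt_int(1) by auto
  note fm = first_moment_eq_integral_tail[OF m W.dt_int(2) W.d_supp, folded tail_def]
  show "integrable lborel (\<lambda>x. indicator {0<..} x * tail t x)" by (rule fm(1))
  have "G.u t - F.u t = (LINT x|lborel. x * d t x)"
    using F.xh_int[of t] G.xh_int[of t] by (simp add: F.u_def G.u_def d_def right_diff_distrib)
  also have "\<dots> = (LINT x|lborel. indicator {0<..} x * tail t x)" by (rule fm(2))
  finally have "\<bar>F.u t - G.u t\<bar> = \<bar>LINT x|lborel. indicator {0<..} x * tail t x\<bar>"
    by (simp add: abs_minus_commute)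
  also have "\<dots> \<le> (LINT x|lborel. \<bar>indicator {0<..} x * tail t x\<bar>)" by (rule integral_abs_bound)
  also have "\<dots> = A t" by (simp add: A_def abs_mult)
  finally show "\<bar>F.u t - G.u t\<bar> \<le> A t" .
qed

lemma A_le_H:
  assumes t: "t \<in> {0..S}"
  shows "c * A t \<le> H t"
proof -
  have "c * A t = (LINT x|lborel. c * (indicator {0<..} x * \<bar>tail t x\<bar>))" by (simp add: A_def)
  also have "\<dots> \<le> H t" unfolding H_def
  proof (rule integral_mono)
    have "integrable lborel (\<lambda>x. indicator {0<..} x * \<bar>tail t x\<bar>)"
      using integrable_abs[OF A_int[of t]] by (simp add: abs_mult)
    then show "integrable lborel (\<lambda>x. c * (indicator {0<..} x * \<bar>tail t x\<bar>))" by simp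
    show "integrable lborel (\<lambda>x. indicator {0<..} x * w x * \<bar>tail t x\<bar>)" by (rule H_eq(1)[OF t])
    fix x :: real
    show "c * (indicator {0<..} x * \<bar>tail t x\<bar>) \<le> indicator {0<..} x * w x * \<bar>tail t x\<bar>"
      using wc[of x] by (cases "x > 0") (auto intro: mult_right_mono)
  qed
  finally show ?thesis .
qed

lemma H_nonneg: "H t \<ge> 0"
  unfolding H_def
proof (rule integral_nonneg_AE, rule AE_I2)
  fix x show "0 \<le> indicator {0<..} x * w x * \<bar>tail t x\<bar>"
    using wc[of x] c by (cases "x > 0") auto
qed

text \<open>The transport term is handled by comparing \<open>w (a u - b) - C x\<close>, which is nonincreasing, with its
  bound at the boundary; the remaining \<open>C x\<close> contributes the first moment of \<open>sgn G d\<close>, that is \<open>A\<close>.\<close>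

lemma I_le:
  fixes Cm :: real
  assumes Cm: "\<And>t. (LINT x|lborel. (1 + x) * G.h t x) \<le> Cm"
  shows "I t \<le> C * \<bar>LINT x|lborel. d t x\<bar> + C * (1 + Cm) * A t"
proof -
  \<comment> \<open>The tails of \<open>\<mu>\<close> are the absolute values of the tails of
    \<open>d t\<close>. Hence they are nonnegative, the total mass of \<open>\<mu>\<close> is the
    boundary term, and its first moment is \<open>A t\<close>.\<close>
  define \<mu> where "\<mu> x = sgn (tail t x) * d t x" for x
  have dm[measurable]: "d t \<in> borel_measurable borel" using W.dt_int(1) by auto
  have \<mu>m[measurable]: "\<mu> \<in> borel_measurable borel" unfolding \<mu>_def by measurable
  have sg: "\<bar>sgn r\<bar> \<le> 1" for r :: real by (simp add: sgn_real_def)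
  have \<mu>i: "integrable lborel \<mu>"
    by (rule Bochner_Integration.integrable_bound[OF W.dt_int(1)[of t]])
      (auto simp: \<mu>_def abs_mult sgn_real_def)
  have x\<mu>i: "integrable lborel (\<lambda>x. x * \<mu> x)"
    by (rule Bochner_Integration.integrable_bound[OF W.dt_int(2)[of t]])
      (auto simp: \<mu>_def abs_mult sgn_real_def)
  have \<mu>0: "\<mu> x = 0" if "x \<le> 0" for x using W.d_supp[OF that] by (simp add: \<mu>_def)
  have t\<mu>: "(LINT z:{x<..}|lborel. \<mu> z) = \<bar>tail t x\<bar>" for x
    using abs_tail_integral[OF W.dt_int(1)[of t], of x] by (simp add: \<mu>_def tail_def)
  have x\<mu>: "(LINT x|lborel. x * \<mu> x) = A t"
    using first_moment_eq_integral_tail(2)[OF \<mu>m x\<mu>i \<mu>0] by (simp add: t\<mu> A_def)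
  have tot: "(LINT x|lborel. \<mu> x) = \<bar>LINT x|lborel. d t x\<bar>"
  proof -
    have full: "(LINT x|lborel. k x) = (LINT z:{0<..}|lborel. k z)" if "\<And>x. x \<le> 0 \<Longrightarrow> k x = 0" for k :: "real \<Rightarrow> real"
      unfolding set_lebesgue_integral_def
      by (rule Bochner_Integration.integral_cong) (use that in \<open>auto split: split_indicator\<close>)
    have "(LINT x|lborel. \<mu> x) = \<bar>tail t 0\<bar>" using full[of \<mu>, OF \<mu>0] t\<mu>[of 0] by simp
    also have "tail t 0 = (LINT x|lborel. d t x)" unfolding tail_def by (rule full[of "d t", OF W.d_supp, symmetric])
    finally show ?thesis .
  qed
  \<comment> \<open>The layer-cake inequality requires only the upper bound \<open>C\<close> on
    \<open>q\<close>, which stands in for a boundary value at x = 0.\<close>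
  define q where "q x = indicator {0<..} x * (w x * (a' x * F.u t - b' x) - C * x)" for x
  have qm[measurable]: "q \<in> borel_measurable borel" unfolding q_def by measurable
  have uK: "F.u t \<in> {K..rho}" using K F.u_bounds(2) by auto
  have w\<mu>i: "integrable lborel (\<lambda>x. indicator {0<..} x * w x * (a' x * F.u t - b' x) * \<mu> x)"
  proof -
    let ?p = "\<lambda>t x. indicator {0<..} x * w x * (a' x * F.u t - b' x) * sgn (tail t x)"
    have pb: "\<bar>?p t x\<bar> \<le> C * (U + 1) * (1 + x)" if "x > 0" for t x
    proof -
      have "\<bar>?p t x\<bar> = \<bar>w x * (a' x * F.u t - b' x)\<bar> * \<bar>sgn (tail t x)\<bar>" using that by (simp add: abs_mult)
      also have "\<dots> \<le> C * (U + 1) * (1 + x) * 1"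
        by (rule mult_mono[OF w_speed[OF that u_abs(1)] sg]) (use C that u_abs(1)[of t] in auto)
      finally show ?thesis by simp
    qed
    have m: "(\<lambda>(t, x). ?p t x) \<in> borel_measurable (borel \<Otimes>\<^sub>M borel)" by measurable
    have "indicator {0<..} x * w x * (a' x * F.u t - b' x) * \<mu> x = ?p t x * F.h t x - ?p t x * G.h t x" for x
      by (simp add: \<mu>_def d_def algebra_simps)
    then show ?thesis
      using Bochner_Integration.integrable_diff[OF F.mult_h_integrable(2)[OF m pb] G.mult_h_integrable(2)[OF m pb]]
      by simp
  qed
  have q\<mu>: "q x * \<mu> x = indicator {0<..} x * w x * (a' x * F.u t - b' x) * \<mu> x - C * (x * \<mu> x)" for x
    using \<mu>0[of x] by (cases "x > 0") (auto simp: q_def algebra_simps)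
  have q\<mu>i: "integrable lborel (\<lambda>x. q x * \<mu> x)"
    unfolding q\<mu> using w\<mu>i x\<mu>i by auto
  have "(LINT x|lborel. q x * \<mu> x) \<le> C * (LINT x|lborel. \<mu> x)"
  proof (rule integral_antimono_mult_le[OF \<mu>i \<mu>0 _ _ _ qm q\<mu>i])
    show "0 \<le> (LINT z:{x<..}|lborel. \<mu> z)" for x by (simp add: t\<mu>)
    show "antimono_on {0<..} q" using w_anti[OF uK] by (auto simp: q_def monotone_on_def)
    show "q x \<le> C" if "x > 0" for x using w_le[OF uK that] that by (simp add: q_def)
  qed
  moreover have "(LINT x|lborel. q x * \<mu> x)
      = (LINT x|lborel. indicator {0<..} x * w x * (a' x * F.u t - b' x) * \<mu> x) - C * (LINT x|lborel. x * \<mu> x)"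
    unfolding q\<mu> using w\<mu>i x\<mu>i by simp
  ultimately have first: "(LINT x|lborel. indicator {0<..} x * w x * (a' x * F.u t - b' x) * \<mu> x)
      \<le> C * \<bar>LINT x|lborel. d t x\<bar> + C * A t"
    by (simp add: x\<mu> tot)
  let ?r = "\<lambda>t x. indicator {0<..} x * w x * a' x * sgn (tail t x)"
  have rb: "\<bar>?r t x\<bar> \<le> C * (1 + x)" if "x > 0" for t x
  proof -
    have "\<bar>?r t x\<bar> = w x * a' x * \<bar>sgn (tail t x)\<bar>" using that wc[OF that] c a'_nn[OF that] by (simp add: abs_mult)
    also have "\<dots> \<le> C * (1 + x) * 1"
      by (rule mult_mono[OF wa[OF that] sg]) (use C that in auto)
    finally show ?thesis by simp
  qed
  have rm: "(\<lambda>(t, x). ?r t x) \<in> borel_measurable (borel \<Otimes>\<^sub>M borel)" by measurable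
  note ri = G.mult_h_integrable(2)[OF rm rb]
  have second: "\<bar>LINT x|lborel. ?r t x * G.h t x\<bar> \<le> C * Cm"
  proof -
    have mi: "integrable lborel (\<lambda>x. (1 + x) * G.h t x)" using G.moment_bound by blast
    have "\<bar>LINT x|lborel. ?r t x * G.h t x\<bar> \<le> (LINT x|lborel. \<bar>?r t x * G.h t x\<bar>)" by (rule integral_abs_bound)
    also have "\<dots> \<le> (LINT x|lborel. C * ((1 + x) * G.h t x))"
    proof (rule integral_mono)
      fix x show "\<bar>?r t x * G.h t x\<bar> \<le> C * ((1 + x) * G.h t x)"
      proof (cases "x > 0")
        case True
        have "\<bar>?r t x\<bar> * G.h t x \<le> C * (1 + x) * G.h t x" by (intro mult_right_mono rb True G.h_nonneg)
        then show ?thesis using G.h_nonneg[of t x] by (simp add: abs_mult mult.assoc)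
      qed (simp add: G.h_supp)
    qed (use ri mi in auto)
    also have "\<dots> = C * (LINT x|lborel. (1 + x) * G.h t x)" by simp
    also have "\<dots> \<le> C * Cm" by (intro mult_left_mono Cm C)
    finally show ?thesis .
  qed
  \<comment> \<open>The flux difference is split as (a u - b)(f - g) + (u - v) a g: transport of the
    difference with the speed of the first solution, and a source driven by the difference of the
    concentrations.\<close>
  have Js: "J t x = indicator {0<..} x * w x * (a' x * F.u t - b' x) * \<mu> x + (F.u t - G.u t) * (?r t x * G.h t x)" for x
    by (simp add: J_def flux_def \<mu>_def d_def algebra_simps)
  have "I t = (LINT x|lborel. indicator {0<..} x * w x * (a' x * F.u t - b' x) * \<mu> x)
     + (F.u t - G.u t) * (LINT x|lborel. ?r t x * G.h t x)"
    unfolding I_def Js using w\<mu>i ri by simp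
  also have "\<dots> \<le> (C * \<bar>LINT x|lborel. d t x\<bar> + C * A t) + A t * (C * Cm)"
  proof (rule add_mono[OF first])
    have "(F.u t - G.u t) * (LINT x|lborel. ?r t x * G.h t x) \<le> \<bar>F.u t - G.u t\<bar> * \<bar>LINT x|lborel. ?r t x * G.h t x\<bar>"
      unfolding abs_mult[symmetric] by (rule abs_ge_self)
    also have "\<dots> \<le> A t * (C * Cm)"
      by (rule mult_mono[OF u_diff_le second order_trans[OF abs_ge_zero u_diff_le] abs_ge_zero])
    finally show "(F.u t - G.u t) * (LINT x|lborel. ?r t x * G.h t x) \<le> A t * (C * Cm)" .
  qed
  finally show ?thesis by (simp add: algebra_simps)
qed

lemma H_cont: "continuous_on {0..S} H"
proof -
  have "continuous_on UNIV (\<lambda>t. LINT s:{..t}|lborel. I s)"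
    by (rule AC_continuous[OF I_int, of _ 0]) simp
  then have "continuous_on {0..S} (\<lambda>t. LINT s:{..t}|lborel. I s)" by (rule continuous_on_subset) simp
  then show ?thesis by (rule continuous_on_eq) (simp add: H_eq(2))
qed

lemma H_set_int: "t \<le> S \<Longrightarrow> set_integrable lborel {0..t} H"
  by (rule borel_integrable_atLeastAtMost') (rule continuous_on_subset[OF H_cont], auto)

lemma H_integral_mono:
  assumes "s \<le> t" "t \<le> S"
  shows "(LINT r:{0..s}|lborel. H r) \<le> (LINT r:{0..t}|lborel. H r)"
  unfolding set_lebesgue_integral_def
  by (rule integral_mono)
    (use H_set_int[of s] H_set_int[of t] assms H_nonneg in \<open>auto simp: set_integrable_def split: split_indicator\<close>)

text \<open>The total mass of \<open>d t\<close> is the time integral of the difference of the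
  boundary rates. The Lipschitz bound reduces these to differences of concentrations, which
  \<open>A\<close> and then \<open>H / c\<close> dominate.\<close>

lemma total_mass_le:
  "AE t in lborel. t \<in> {0<..<S} \<longrightarrow> c * \<bar>LINT x|lborel. d t x\<bar> \<le> L * (LINT r:{0..t}|lborel. H r)"
  using W.AE_boundary
proof eventually_elim
  case (elim t)
  show ?case
  proof
    assume t: "t \<in> {0<..<S}"
    have e: "(LINT x|lborel. d t x) = (LINT s|lborel. indicator {..t} s *\<^sub>R \<nu> s)"
      using elim t by (simp add: set_lebesgue_integral_def)
    have "c * \<bar>LINT x|lborel. d t x\<bar> = \<bar>LINT s|lborel. c * (indicator {..t} s *\<^sub>R \<nu> s)\<bar>"
      unfolding e integral_mult_right_zero using c by (simp add: abs_mult)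
    also have "\<dots> \<le> (LINT s|lborel. \<bar>c * (indicator {..t} s *\<^sub>R \<nu> s)\<bar>)" by (rule integral_abs_bound)
    also have "\<dots> \<le> (LINT s|lborel. L * (indicator {0..t} s *\<^sub>R H s))"
    proof (rule integral_mono)
      show "integrable lborel (\<lambda>s. \<bar>c * (indicator {..t} s *\<^sub>R \<nu> s)\<bar>)"
        by (rule integrable_abs[OF integrable_mult_right[OF integrable_mult_indicator[OF _ W.\<nu>_int]]]) simp
      show "integrable lborel (\<lambda>s. L * (indicator {0..t} s *\<^sub>R H s))"
        using H_set_int[of t] t by (simp add: set_integrable_def)
      fix s
      show "\<bar>c * (indicator {..t} s *\<^sub>R \<nu> s)\<bar> \<le> L * (indicator {0..t} s *\<^sub>R H s)"
      proof (cases "s \<in> {0..t}")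
        case True
        then have s: "s \<in> {0..S}" using t by auto
        have "\<bar>nn (F.u s) - nn (G.u s)\<bar> \<le> L * \<bar>F.u s - G.u s\<bar>"
          using F.u_bounds[of s] G.u_bounds[of s] s by (intro nn_lip) auto
        also have "\<dots> \<le> L * A s" by (intro mult_left_mono u_diff_le L)
        finally have "c * \<bar>nn (F.u s) - nn (G.u s)\<bar> \<le> c * (L * A s)" using c by (intro mult_left_mono) auto
        also have "\<dots> = L * (c * A s)" by simp
        also have "\<dots> \<le> L * H s" by (intro mult_left_mono A_le_H s L)
        finally show ?thesis using True s c by (simp add: \<nu>_def abs_mult)
      next
        case False
        then have "indicator {..t} s *\<^sub>R \<nu> s = 0" using t by (cases "s < 0") (auto simp: \<nu>_def)
        then show ?thesis using False by simp
      qed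
    qed
    also have "\<dots> = L * (LINT r:{0..t}|lborel. H r)" by (simp add: set_lebesgue_integral_def)
    finally show "c * \<bar>LINT x|lborel. d t x\<bar> \<le> L * (LINT r:{0..t}|lborel. H r)" .
  qed
qed

text \<open>Integrating the bound on \<open>I\<close> in time turns the boundary contribution into
  an iterated time integral of \<open>H\<close>, at most \<open>S\<close> times a single one, and
  Gronwall applies.\<close>

lemma H_zero:
  assumes t: "t \<in> {0..S}"
  shows "H t = 0"
proof -
  obtain Cm where Cm: "\<And>t. (LINT x|lborel. (1 + x) * G.h t x) \<le> Cm" using G.moment_bound by blast
  \<comment> \<open>The moment bound holds at all real times, and at time -1 the moment is
    zero.\<close>
  have Cm0: "Cm \<ge> 0" using Cm[of "- 1"] F.S by (simp add: G.h_supp(2))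
  \<comment> \<open>The first summand comes from the boundary term over a time of length at most
    \<open>S\<close>, the second from transport and source; the 1 ensures positivity.\<close>
  define E where "E = C * L / c * S + C * (1 + Cm) / c + 1"
  have E: "E > 0" unfolding E_def using C L c F.S Cm0 by (intro add_nonneg_pos add_nonneg_nonneg) auto
  show ?thesis
  proof (rule Gronwall_zero[OF _ _ H_cont E _ t])
    show "0 \<le> H t" for t by (rule H_nonneg)
    show "H t \<le> (LINT s|lborel. \<bar>I s\<bar>)" if "t \<in> {0..S}" for t
      using abs_set_integral_le[OF I_int, of "{..t}"] H_eq(2)[OF that] by simp
    fix t assume t: "t \<in> {0..S}"
    define Y where "Y = (LINT r:{0..t}|lborel. H r)"
    have Ic: "AE s in lborel. s \<in> {0<..<S} \<longrightarrow> s \<le> t \<longrightarrow> I s \<le> C * L / c * Y + C * (1 + Cm) / c * H s"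
      using total_mass_le
    proof eventually_elim
      case (elim s)
      show ?case
      proof (intro impI)
        assume s: "s \<in> {0<..<S}" "s \<le> t"
        \<comment> \<open>The integral of \<open>H\<close> up to s is enlarged to the one up to t,
          which makes the boundary contribution independent of s.\<close>
        have "c * \<bar>LINT x|lborel. d s x\<bar> \<le> L * Y"
          using elim s(1) mult_left_mono[OF H_integral_mono[of s t] L] s t by (auto simp: Y_def)
        then have "\<bar>LINT x|lborel. d s x\<bar> \<le> L * Y / c" using c by (simp add: field_simps)
        then have "C * \<bar>LINT x|lborel. d s x\<bar> \<le> C * (L * Y / c)" using C by (intro mult_left_mono)
        moreover have "A s \<le> H s / c" using A_le_H[of s] s c by (simp add: field_simps)
        then have "C * (1 + Cm) * A s \<le> C * (1 + Cm) * (H s / c)" using C Cm0 by (intro mult_left_mono) auto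
        ultimately show "I s \<le> C * L / c * Y + C * (1 + Cm) / c * H s"
          using I_le[OF Cm, of s] by simp
      qed
    qed
    have "H t = (LINT s:{0..t}|lborel. I s)"
    proof -
      have I0: "I s = 0" if "s < 0" for s using that by (simp add: I_def J_def flux_outside)
      show ?thesis unfolding H_eq(2)[OF t] set_lebesgue_integral_def
        by (rule Bochner_Integration.integral_cong) (use I0 in \<open>auto split: split_indicator\<close>)
    qed
    also have "\<dots> \<le> (LINT s:{0..t}|lborel. C * L / c * Y + C * (1 + Cm) / c * H s)"
    proof (rule set_integral_mono_AE)
      show "set_integrable lborel {0..t} I"
        using I_int by (simp add: set_integrable_def integrable_mult_indicator del: real_scaleR_def)
      have "set_integrable lborel {0..t} (\<lambda>s. C * L / c * Y)"
        by (rule borel_integrable_atLeastAtMost') (intro continuous_on_const)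
      then show "set_integrable lborel {0..t} (\<lambda>s. C * L / c * Y + C * (1 + Cm) / c * H s)"
        using H_set_int[of t] t by (intro set_integral_add) auto
      show "AE s\<in>{0..t} in lborel. I s \<le> C * L / c * Y + C * (1 + Cm) / c * H s"
        using Ic AE_lborel_singleton[of 0] AE_lborel_singleton[of S]
        by eventually_elim (use t in auto)
    qed
    also have "\<dots> = C * L / c * Y * t + C * (1 + Cm) / c * Y"
    proof -
      have c1: "set_integrable lborel {0..t} (\<lambda>s. C * L / c * Y)"
        by (rule borel_integrable_atLeastAtMost') (intro continuous_on_const)
      have c2: "(LINT s:{0..t}|lborel. C * L / c * Y) = C * L / c * Y * t"
        using t by (simp add: set_lebesgue_integral_def)
      have "(LINT s:{0..t}|lborel. C * L / c * Y + C * (1 + Cm) / c * H s)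
        = (LINT s:{0..t}|lborel. C * L / c * Y) + (LINT s:{0..t}|lborel. C * (1 + Cm) / c * H s)"
        using H_set_int[of t] t by (intro set_integral_add(2) c1) auto
      then show ?thesis unfolding c2 by (simp add: Y_def)
    qed
    also have "\<dots> \<le> E * Y"
    proof -
      have Y: "Y \<ge> 0" unfolding Y_def set_lebesgue_integral_def
        by (intro integral_nonneg_AE) (use H_nonneg in auto)
      have "C * L / c * Y * t \<le> C * L / c * Y * S" using t C L c Y by (intro mult_left_mono) auto
      then show ?thesis using Y by (simp add: E_def algebra_simps)
    qed
    finally show "H t \<le> E * (LINT s:{0..t}|lborel. H s)" by (simp add: Y_def)
  qed
qed

text \<open>A zero weighted norm with \<open>w\<close> at least \<open>c > 0\<close> forces the tail
  to vanish for almost every x > 0, and a density is determined by its tails.\<close>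

lemma solutions_agree:
  assumes t: "t \<in> {0..S}"
  shows "AE x in lborel. x > 0 \<longrightarrow> f t x = g t x"
proof -
  have nn: "AE x in lborel. 0 \<le> indicator {0<..} x * w x * \<bar>tail t x\<bar>"
  proof (rule AE_I2)
    fix x show "0 \<le> indicator {0<..} x * w x * \<bar>tail t x\<bar>"
      using wc[of x] c by (cases "x > 0") auto
  qed
  have "AE x in lborel. indicator {0<..} x * w x * \<bar>tail t x\<bar> = 0"
    using integral_nonneg_eq_0_iff_AE[OF H_eq(1)[OF t] nn] H_zero[OF t] by (simp add: H_def)
  then have "AE x in lborel. x > 0 \<longrightarrow> (LINT z:{x<..}|lborel. d t z) = 0"
  proof eventually_elim
    case (elim x)
    then show ?case using wc[of x] c by (auto simp: tail_def)
  qed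
  then have "AE x in lborel. d t x = 0"
    by (intro AE_zero_if_tail_integrals_zero[of "d t"] W.dt_int W.d_supp)
  then show ?thesis
    using F.h_eq_AE[OF t] G.h_eq_AE[OF t] by eventually_elim (auto simp: d_def)
qed

end

section \<open>Uniqueness\<close>

theorem mainTheorem2:
  fixes rho Phi0 :: real and a b nn fin :: "real \<Rightarrow> real"
  assumes rho_pos: "rho > 0"
    and a_nonneg: "\<forall>x\<ge>0. a x \<ge> 0" and b_nonneg: "\<forall>x\<ge>0. b x \<ge> 0"
    and a_cont: "continuous_on {0..} a" and b_cont: "continuous_on {0..} b"
    and a_C1: "\<forall>x>0. a differentiable (at x)" "continuous_on {0<..} (deriv a)"
    and b_C1: "\<forall>x>0. b differentiable (at x)" "continuous_on {0<..} (deriv b)"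
    and a'_bdd: "\<exists>M. \<forall>x>1. \<bar>deriv a x\<bar> \<le> M"
    and b'_bdd: "\<exists>M. \<forall>x>1. \<bar>deriv b x\<bar> \<le> M"
    and a_pos: "\<forall>x>0. a x > 0"
    and inv_a_L1: "set_integrable lborel {0<..<1} (\<lambda>x. 1 / a x)"
    and Phi_lim: "((\<lambda>x. b x / a x) \<longlongrightarrow> Phi0) (at_right 0)"
    and Phi0_lt: "Phi0 < rho"
    and Phi'_L1: "set_integrable lborel {0<..<1} (deriv (\<lambda>x. b x / a x))"
    and nn_nonneg: "\<forall>u\<ge>Phi0. nn u \<ge> 0"
    and nn_loclip: "\<forall>R. \<exists>L. \<forall>u\<in>{Phi0..R}. \<forall>v\<in>{Phi0..R}. \<bar>nn u - nn v\<bar> \<le> L * \<bar>u - v\<bar>"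
    and Phi_mono: "\<exists>xs>0. mono_on {0<..<xs} (\<lambda>x. b x / a x)
                     \<or> monotone_on {0<..<xs} (\<le>) (\<ge>) (\<lambda>x. b x / a x)"
    and fin_nonneg: "AE x in lborel. x \<in> {0<..} \<longrightarrow> fin x \<ge> 0"
    and fin_L1: "set_integrable lborel {0<..} (\<lambda>x. (1 + x) * fin x)"
    and fin_mass: "rho - set_lebesgue_integral lborel {0<..} (\<lambda>x. x * fin x) > Phi0"
  shows "\<forall>T>0. \<forall>f g. LS_solution rho Phi0 a b nn fin T f \<and> LS_solution rho Phi0 a b nn fin T g
           \<longrightarrow> (\<forall>t\<in>{0..<T}. AE x in lborel. x \<in> {0<..} \<longrightarrow> f t x = g t x)"
proof (intro allI impI ballI, elim conjE)
  fix T :: real and f g t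
  assume T: "T > 0"
    and f: "LS_solution rho Phi0 a b nn fin T f" and g: "LS_solution rho Phi0 a b nn fin T g"
    and t: "t \<in> {0..<T}"
  \<comment> \<open>Any end point strictly between t and \<open>T\<close> gives a compact time
    interval that contains t.\<close>
  define S where "S = (t + T) / 2"
  have S: "0 < S" "S < T" "t \<in> {0..S}" using t T by (auto simp: S_def)
  define a' b' where "a' x = indicator {0<..} x *\<^sub>R a x" and "b' x = indicator {0<..} x *\<^sub>R b x" for x
  have a': "a' \<in> borel_measurable borel" "\<And>x. x > 0 \<Longrightarrow> a' x = a x"
    unfolding a'_def
    by (rule borel_measurable_continuous_on_indicator, simp, rule continuous_on_subset[OF a_cont], auto)
  have b': "b' \<in> borel_measurable borel" "\<And>x. x > 0 \<Longrightarrow> b' x = b x"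
    unfolding b'_def
    by (rule borel_measurable_continuous_on_indicator, simp, rule continuous_on_subset[OF b_cont], auto)
  interpret F: LS_restricted rho Phi0 a b nn fin T S f a' b'
    by unfold_locales (use f S a' b' in auto)
  interpret G: LS_restricted rho Phi0 a b nn fin T S g a' b'
    by unfold_locales (use g S a' b' in auto)
  have ne: "compact {0..S}" "{0..S} \<noteq> {}" using S by auto
  obtain t1 where t1: "t1 \<in> {0..S}" "\<And>s. s \<in> {0..S} \<Longrightarrow> F.u t1 \<le> F.u s"
    using continuous_attains_inf[OF ne F.u_cont] by blast
  obtain t2 where t2: "t2 \<in> {0..S}" "\<And>s. s \<in> {0..S} \<Longrightarrow> G.u t2 \<le> G.u s"
    using continuous_attains_inf[OF ne G.u_cont] by blast
  \<comment> \<open>Both concentrations attain their minimum on [0,S], so the smaller minimum is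
    still strictly above \<open>Phi0\<close>. Outside [0,S] both equal \<open>rho\<close>, which is
    not below \<open>K\<close>.\<close>
  define K where "K = min (F.u t1) (G.u t2)"
  have K: "Phi0 < K" using F.u_bounds(1)[OF t1(1)] G.u_bounds(1)[OF t2(1)] by (simp add: K_def)
  have KF: "K \<le> F.u s" for s
    using t1(2)[of s] F.u_outside[of s] F.u_bounds(2)[of t1] by (cases "s \<in> {0..S}") (auto simp: K_def)
  have KG: "K \<le> G.u s" for s
    using t2(2)[of s] G.u_outside[of s] G.u_bounds(2)[of t2] by (cases "s \<in> {0..S}") (auto simp: K_def)
  obtain w C c where c: "c > 0" and w: "w \<in> borel_measurable borel" and C: "C \<ge> 0"
    and wc: "\<forall>x>0. w x \<ge> c" and wa: "\<forall>x>0. w x * a x \<le> C * (1 + x)" and wb: "\<forall>x>0. w x * b x \<le> C * (1 + x)"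
    and wv: "\<forall>v\<in>{K..rho}. antimono_on {0<..} (\<lambda>x. w x * (a x * v - b x) - C * x) \<and>
         (\<forall>x>0. w x * (a x * v - b x) - C * x \<le> C)"
    using transport_weight[where rho = rho, OF a_nonneg b_nonneg a_cont b_cont a_C1 b_C1 a'_bdd b'_bdd a_pos Phi_lim Phi_mono K]
    by (elim exE conjE) (rule that)
  obtain L where L: "\<And>u v. u \<in> {Phi0..rho} \<Longrightarrow> v \<in> {Phi0..rho} \<Longrightarrow> \<bar>nn u - nn v\<bar> \<le> L * \<bar>u - v\<bar>"
    using nn_loclip by meson
  interpret P: LS_pair rho Phi0 a b nn fin T S f g a' b' w K C c "max 0 L"
  proof
    show "\<bar>nn u - nn v\<bar> \<le> max 0 L * \<bar>u - v\<bar>" if "u \<in> {Phi0..rho}" "v \<in> {Phi0..rho}" for u v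
      using L[OF that] mult_right_mono[of L "max 0 L" "\<bar>u - v\<bar>"] by simp
    show "antimono_on {0<..} (\<lambda>x. w x * (a' x * v - b' x) - C * x)" if "v \<in> {K..rho}" for v
      using wv that by (auto simp: monotone_on_def a'(2) b'(2))
  qed (use c w C wc wa wb wv K KF KG a_nonneg b_nonneg a'(2) b'(2) in auto)
  show "AE x in lborel. x \<in> {0<..} \<longrightarrow> f t x = g t x"
    using P.solutions_agree[OF S(3)] by simp
qed

end
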